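(* Let $(M,g)$ be a Riemannian manifold of dimension $n\ge2$. (i) Given $\eta\in\mathfrak X(M)$, there is a unique section $\Phi\in\Gamma(\mathfrak o(TM))$ such that $d^{\widetilde\nabla^{\mathcal A}}\binom{\eta}{\Phi}$ is a section of $\mathcal H^1M\oplus(T^*M\otimes\mathfrak o(TM))\subset T^*M\otimes\mathcal AM$. Putting $L(\eta)=L^0(\eta):=\binom{\eta}{\Phi}$ defines a linear first order differential operator $L:\Gamma(\mathcal H^0M)\to\Gamma(\mathcal AM)=\Omega^0(M,\mathcal AM)$. (ii) Given $\psi\in\Gamma(\mathcal H^1M)\subset\Omega^1(M,TM)$, there is a unique $\Psi\in\Omega^1(M,\mathfrak o(TM))$ such that $d^{\widetilde\nabla^{\mathcal A}}\binom{\psi}{\Psi}$ is a section of the subbundle $\Lambda^2T^*M\otimes\mathfrak o(TM)\subset\Lambda^2T^*M\otimes\mathcal AM$. Putting $L(\psi)=L^1(\psi):=\binom{\psi}{\Psi}$ defines a linear first order differential operator $L:\Gamma(\mathcal H^1M)\to\Omega^1(M,\mathcal AM)$. (iii) For $k\ge2$ and $\Psi\in\Gamma(\mathcal H^kM)$, $L(\Psi):=\binom{0}{\Psi}$ defines a tensorial operator $L:\Gamma(\mathcal H^kM)\to\Omega^k(M,\mathcal AM)$, and $d^{\widetilde\nabla^{\mathcal A}}L(\Psi)\in\Gamma(\Lambda^{k+1}T^*M\otimes\mathfrak o(TM))\subset\Omega^{k+1}(M,\mathcal AM)$.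
   Context: $\nabla$ is the Levi-Civita connection of $g$, $\mathfrak o(TM)$ (resp. $\mathcal S(TM)$) the bundle of endomorphisms of $TM$ that are skew symmetric (resp. symmetric) with respect to $g$, and $R\in\Omega^2(M,\mathfrak o(TM))$ the Riemann curvature, $R(\xi_1,\xi_2)=[\nabla_{\xi_1},\nabla_{\xi_2}]-\nabla_{[\xi_1,\xi_2]}$. Put $\mathcal AM:=TM\oplus\mathfrak o(TM)$; sections, and $\mathcal AM$-valued $k$-forms, are written as columns $\binom{\psi}{\Psi}$ with $\psi\in\Omega^k(M,TM)$ and $\Psi\in\Omega^k(M,\mathfrak o(TM))$. The deformation connection is the linear connection $\widetilde\nabla^{\mathcal A}_\xi\binom{\eta}{\Phi}=\binom{\nabla_\xi\eta-\Phi(\xi)}{\nabla_\xi\Phi-R(\xi,\eta)}$ on $\mathcal AM$. For a vector bundle $E$, $\Omega^k(M,E)=\Gamma(\Lambda^kT^*M\otimes E)$, and $d^{\widetilde\nabla^{\mathcal A}}:\Omega^k(M,\mathcal AM)\to\Omega^{k+1}(M,\mathcal AM)$ is the covariant exterior derivative, $d^{\nabla}\varphi(\xi_0,\dots,\xi_k)=\sum_i(-1)^i\nabla_{\xi_i}(\varphi(\xi_0,\dots,\widehat{\xi_i},\dots,\xi_k))+\sum_{i<j}(-1)^{i+j}\varphi([\xi_i,\xi_j],\xi_0,\dots,\widehat{\xi_i},\dots,\widehat{\xi_j},\dots,\xi_k)$ (hats denote omission). For $\Psi\in\Omega^k(M,\mathfrak o(TM))$ let $\mathrm{Alt}(\Psi)\in\Omega^{k+1}(M,TM)$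 be $\mathrm{Alt}(\Psi)(\xi_0,\dots,\xi_k)=\sum_{i=0}^k(-1)^{k-i}\Psi(\xi_0,\dots,\widehat{\xi_i},\dots,\xi_k)(\xi_i)$; it comes from a vector bundle map. Harmonic subbundles $\mathcal H^kM\subset\Lambda^kT^*M\otimes\mathcal AM$, $k=0,\dots,n$: $\mathcal H^0M:=TM\subset\mathcal AM$; $\mathcal H^1M:=\mathcal S(TM)\subset T^*M\otimes TM\subset T^*M\otimes\mathcal AM$; for $k\ge2$, $\mathcal H^kM:=\ker(\mathrm{Alt}:\Lambda^kT^*M\otimes\mathfrak o(TM)\to\Lambda^{k+1}T^*M\otimes TM)$, viewed inside $\Lambda^kT^*M\otimes\mathcal AM$ via the bottom component. A tensorial operator is one that is linear over smooth functions. *)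

theory Defs
  imports "HOL-Analysis.Analysis"
begin

section \<open>Smooth manifolds\<close>

text \<open>\<open>Ck_on k S f\<close>: on the open set \<open>S\<close> the map \<open>f\<close> is \<open>k\<close> times continuously differentiable,
  expressed by iterated directional derivatives.\<close>

primrec Ck_on :: "nat \<Rightarrow> 'e::euclidean_space set \<Rightarrow> ('e \<Rightarrow> 'f::real_normed_vector) \<Rightarrow> bool" where
  "Ck_on 0 S f \<longleftrightarrow> continuous_on S f"
| "Ck_on (Suc k) S f \<longleftrightarrow>
     (\<forall>x\<in>S. f differentiable (at x)) \<and> (\<forall>v. Ck_on k S (\<lambda>x. frechet_derivative f (at x) v))"

definition smooth_on :: "'e::euclidean_space set \<Rightarrow> ('e \<Rightarrow> 'f::real_normed_vector) \<Rightarrow> bool" where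
  "smooth_on S f \<longleftrightarrow> (\<forall>k. Ck_on k S f)"

text \<open>A chart is a pair of its domain and its coordinate map. The manifold is the whole type
  \<open>'m\<close>; its dimension is \<open>DIM('e)\<close>.\<close>

type_synonym ('m, 'e) chart = "'m set \<times> ('m \<Rightarrow> 'e)"

definition chart_inv :: "('m, 'e) chart \<Rightarrow> 'e \<Rightarrow> 'm" where
  "chart_inv c = inv_into (fst c) (snd c)"

definition chart_img :: "('m, 'e) chart \<Rightarrow> 'e set" where
  "chart_img c = snd c ` fst c"

definition is_chart :: "('m::topological_space, 'e::euclidean_space) chart \<Rightarrow> bool" where
  "is_chart c \<longleftrightarrow> open (fst c) \<and> open (chart_img c) \<and>
     homeomorphism (fst c) (chart_img c) (snd c) (chart_inv c)"

definition smooth_atlas :: "('m::topological_space, 'e::euclidean_space) chart set \<Rightarrow> bool" where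
  "smooth_atlas A \<longleftrightarrow> (\<forall>c\<in>A. is_chart c) \<and> (\<Union>c\<in>A. fst c) = UNIV \<and>
     (\<forall>c\<in>A. \<forall>d\<in>A. smooth_on (snd c ` (fst c \<inter> fst d)) (snd d \<circ> chart_inv c))"

definition smooth_fun :: "('m, 'e::euclidean_space) chart set \<Rightarrow> ('m \<Rightarrow> real) \<Rightarrow> bool" where
  "smooth_fun A f \<longleftrightarrow> (\<forall>c\<in>A. smooth_on (chart_img c) (f \<circ> chart_inv c))"

section \<open>Tangent vectors and vector fields\<close>

text \<open>The tangent space at \<open>p\<close> is the model space \<open>'e\<close>, where a vector is given by its
  coordinates in one chosen chart \<open>chart_at A p\<close> around \<open>p\<close>. So a field of tangent vectors is a
  function \<open>'m \<Rightarrow> 'e\<close>, but different points use different charts: smoothness and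
  derivatives of fields must always be taken after passing to a single chart \<open>c\<close>, by means of
  the differential \<open>to_chart A c p\<close> of \<open>c\<close> at \<open>p\<close>, whose inverse is \<open>of_chart A c p\<close>.\<close>

definition chart_at :: "('m, 'e) chart set \<Rightarrow> 'm \<Rightarrow> ('m, 'e) chart" where
  "chart_at A p = (SOME c. c \<in> A \<and> p \<in> fst c)"

definition chart_change :: "('m, 'e::euclidean_space) chart \<Rightarrow> ('m, 'e) chart \<Rightarrow> 'm \<Rightarrow> 'e \<Rightarrow> 'e" where
  "chart_change c d p = frechet_derivative (snd d \<circ> chart_inv c) (at (snd c p))"

definition to_chart :: "('m, 'e::euclidean_space) chart set \<Rightarrow> ('m, 'e) chart \<Rightarrow> 'm \<Rightarrow> 'e \<Rightarrow> 'e" where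
  "to_chart A c p = chart_change (chart_at A p) c p"

definition of_chart :: "('m, 'e::euclidean_space) chart set \<Rightarrow> ('m, 'e) chart \<Rightarrow> 'm \<Rightarrow> 'e \<Rightarrow> 'e" where
  "of_chart A c p = chart_change c (chart_at A p) p"

definition field_rep ::
  "('m, 'e::euclidean_space) chart set \<Rightarrow> ('m, 'e) chart \<Rightarrow> ('m \<Rightarrow> 'e) \<Rightarrow> 'e \<Rightarrow> 'e" where
  "field_rep A c X x = to_chart A c (chart_inv c x) (X (chart_inv c x))"

definition vector_field :: "('m, 'e::euclidean_space) chart set \<Rightarrow> ('m \<Rightarrow> 'e) \<Rightarrow> bool" where
  "vector_field A X \<longleftrightarrow> (\<forall>c\<in>A. smooth_on (chart_img c) (field_rep A c X))"

definition dir_deriv ::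
  "('m, 'e::euclidean_space) chart set \<Rightarrow> ('m \<Rightarrow> 'e) \<Rightarrow> ('m \<Rightarrow> real) \<Rightarrow> 'm \<Rightarrow> real" where
  "dir_deriv A X f p =
     frechet_derivative (f \<circ> chart_inv (chart_at A p)) (at (snd (chart_at A p) p)) (X p)"

definition lie_bracket ::
  "('m, 'e::euclidean_space) chart set \<Rightarrow> ('m \<Rightarrow> 'e) \<Rightarrow> ('m \<Rightarrow> 'e) \<Rightarrow> 'm \<Rightarrow> 'e" where
  "lie_bracket A X Y p =
     (let c = chart_at A p in
        frechet_derivative (field_rep A c Y) (at (snd c p)) (X p)
      - frechet_derivative (field_rep A c X) (at (snd c p)) (Y p))"

text \<open>Some global vector field with value \<open>v\<close> at \<open>p\<close>. It is used to turn tensorial expressions in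
  vector fields into expressions in tangent vectors; their values do not depend on the choice.\<close>

definition extend :: "('m, 'e::euclidean_space) chart set \<Rightarrow> 'm \<Rightarrow> 'e \<Rightarrow> 'm \<Rightarrow> 'e" where
  "extend A p v = (SOME X. vector_field A X \<and> X p = v)"

section \<open>Riemannian metrics, the Levi-Civita connection and curvature\<close>

definition riemannian_metric ::
  "('m, 'e::euclidean_space) chart set \<Rightarrow> ('m \<Rightarrow> 'e \<Rightarrow> 'e \<Rightarrow> real) \<Rightarrow> bool" where
  "riemannian_metric A g \<longleftrightarrow>
     (\<forall>p. bilinear (g p)) \<and> (\<forall>p u v. g p u v = g p v u) \<and> (\<forall>p u. u \<noteq> 0 \<longrightarrow> g p u u > 0) \<and>
     (\<forall>c\<in>A. \<forall>u v. smooth_on (chart_img c)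
        (\<lambda>x. let q = chart_inv c x in g q (of_chart A c q u) (of_chart A c q v)))"

type_synonym ('m, 'e) connection = "('m \<Rightarrow> 'e) \<Rightarrow> ('m \<Rightarrow> 'e) \<Rightarrow> 'm \<Rightarrow> 'e"

definition affine_connection ::
  "('m, 'e::euclidean_space) chart set \<Rightarrow> ('m, 'e) connection \<Rightarrow> bool" where
  "affine_connection A D \<longleftrightarrow>
     (\<forall>X Y. vector_field A X \<longrightarrow> vector_field A Y \<longrightarrow> vector_field A (D X Y)) \<and>
     (\<forall>X X' Y p. vector_field A X \<longrightarrow> vector_field A X' \<longrightarrow> vector_field A Y \<longrightarrow>
        D (\<lambda>q. X q + X' q) Y p = D X Y p + D X' Y p) \<and>
     (\<forall>f X Y p. smooth_fun A f \<longrightarrow> vector_field A X \<longrightarrow> vector_field A Y \<longrightarrow>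
        D (\<lambda>q. f q *\<^sub>R X q) Y p = f p *\<^sub>R D X Y p) \<and>
     (\<forall>X Y Y' p. vector_field A X \<longrightarrow> vector_field A Y \<longrightarrow> vector_field A Y' \<longrightarrow>
        D X (\<lambda>q. Y q + Y' q) p = D X Y p + D X Y' p) \<and>
     (\<forall>f X Y p. smooth_fun A f \<longrightarrow> vector_field A X \<longrightarrow> vector_field A Y \<longrightarrow>
        D X (\<lambda>q. f q *\<^sub>R Y q) p = dir_deriv A X f p *\<^sub>R Y p + f p *\<^sub>R D X Y p)"

definition levi_civita ::
  "('m, 'e::euclidean_space) chart set \<Rightarrow> ('m \<Rightarrow> 'e \<Rightarrow> 'e \<Rightarrow> real) \<Rightarrow> ('m, 'e) connection \<Rightarrow> bool" where
  "levi_civita A g D \<longleftrightarrow> affine_connection A D \<and>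
     (\<forall>X Y p. vector_field A X \<longrightarrow> vector_field A Y \<longrightarrow>
        D X Y p - D Y X p = lie_bracket A X Y p) \<and>
     (\<forall>X Y Z p. vector_field A X \<longrightarrow> vector_field A Y \<longrightarrow> vector_field A Z \<longrightarrow>
        dir_deriv A X (\<lambda>q. g q (Y q) (Z q)) p = g p (D X Y p) (Z p) + g p (Y p) (D X Z p))"

definition curvature ::
  "('m, 'e::euclidean_space) chart set \<Rightarrow> ('m, 'e) connection \<Rightarrow> 'm \<Rightarrow> 'e \<Rightarrow> 'e \<Rightarrow> ('e \<Rightarrow>\<^sub>L 'e)" where
  "curvature A D p u v = Blinfun (\<lambda>w.
     let X = extend A p u; Y = extend A p v; Z = extend A p w
     in D X (D Y Z) p - D Y (D X Z) p - D (lie_bracket A X Y) Z p)"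

text \<open>The connection induced on endomorphisms of the tangent bundle,
  \<open>(\<nabla>\<^sub>X \<Phi>)(Z) = \<nabla>\<^sub>X (\<Phi>(Z)) - \<Phi>(\<nabla>\<^sub>X Z)\<close>.\<close>

definition conn_End ::
  "('m, 'e::euclidean_space) chart set \<Rightarrow> ('m, 'e) connection \<Rightarrow>
     ('m \<Rightarrow> 'e) \<Rightarrow> ('m \<Rightarrow> ('e \<Rightarrow>\<^sub>L 'e)) \<Rightarrow> 'm \<Rightarrow> ('e \<Rightarrow>\<^sub>L 'e)" where
  "conn_End A D X \<Phi> p = Blinfun (\<lambda>w.
     let Z = extend A p w
     in D X (\<lambda>q. blinfun_apply (\<Phi> q) (Z q)) p - blinfun_apply (\<Phi> p) (D X Z p))"

definition deformation_conn ::
  "('m, 'e::euclidean_space) chart set \<Rightarrow> ('m, 'e) connection \<Rightarrow>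
     ('m \<Rightarrow> 'e) \<Rightarrow> ('m \<Rightarrow> 'e \<times> ('e \<Rightarrow>\<^sub>L 'e)) \<Rightarrow> 'm \<Rightarrow> 'e \<times> ('e \<Rightarrow>\<^sub>L 'e)" where
  "deformation_conn A D X s p =
     (let \<eta> = (\<lambda>q. fst (s q)); \<Phi> = (\<lambda>q. snd (s q))
      in (D X \<eta> p - blinfun_apply (\<Phi> p) (X p),
          conn_End A D X \<Phi> p - curvature A D p (X p) (\<eta> p)))"

section \<open>Bundle-valued forms\<close>

text \<open>A \<open>k\<close>-form with values in a bundle with fibre \<open>'f\<close> is a function
  \<open>\<omega> :: 'm \<Rightarrow> (nat \<Rightarrow> 'e) \<Rightarrow> 'f\<close>; the arguments of \<open>\<omega> p\<close> are the entries \<open>0, ..., k - 1\<close> of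
  the sequence, and \<open>\<omega> p\<close> ignores the others. In particular a \<open>0\<close>-form is constant in the sequence,
  that is, a section of the bundle.\<close>

definition alternating_form :: "nat \<Rightarrow> ((nat \<Rightarrow> 'e::real_vector) \<Rightarrow> 'f::real_vector) \<Rightarrow> bool" where
  "alternating_form k \<omega> \<longleftrightarrow>
     (\<forall>v w. (\<forall>i<k. v i = w i) \<longrightarrow> \<omega> v = \<omega> w) \<and>
     (\<forall>v. \<forall>i<k. linear (\<lambda>x. \<omega> (v(i := x)))) \<and>
     (\<forall>v i j. i < j \<and> j < k \<and> v i = v j \<longrightarrow> \<omega> v = 0)"

definition omit :: "nat \<Rightarrow> (nat \<Rightarrow> 'a) \<Rightarrow> nat \<Rightarrow> 'a" where
  "omit i v = (\<lambda>j. if j < i then v j else v (Suc j))"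

definition form_rep ::
  "('m, 'e::euclidean_space) chart set \<Rightarrow> ('m, 'e) chart \<Rightarrow>
     ('m \<Rightarrow> (nat \<Rightarrow> 'e) \<Rightarrow> 'e) \<Rightarrow> (nat \<Rightarrow> 'e) \<Rightarrow> 'e \<Rightarrow> 'e" where
  "form_rep A c \<psi> u = field_rep A c (\<lambda>q. \<psi> q (\<lambda>i. of_chart A c q (u i)))"

definition Omega_TM ::
  "('m, 'e::euclidean_space) chart set \<Rightarrow> nat \<Rightarrow> ('m \<Rightarrow> (nat \<Rightarrow> 'e) \<Rightarrow> 'e) set" where
  "Omega_TM A k = {\<psi>. (\<forall>p. alternating_form k (\<psi> p)) \<and>
     (\<forall>c\<in>A. \<forall>u. smooth_on (chart_img c) (form_rep A c \<psi> u))}"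

definition Omega_o ::
  "('m, 'e::euclidean_space) chart set \<Rightarrow> ('m \<Rightarrow> 'e \<Rightarrow> 'e \<Rightarrow> real) \<Rightarrow> nat \<Rightarrow>
     ('m \<Rightarrow> (nat \<Rightarrow> 'e) \<Rightarrow> ('e \<Rightarrow>\<^sub>L 'e)) set" where
  "Omega_o A g k = {\<Psi>. (\<forall>p. alternating_form k (\<Psi> p)) \<and>
     (\<forall>p v x y. g p (blinfun_apply (\<Psi> p v) x) y = - g p x (blinfun_apply (\<Psi> p v) y)) \<and>
     (\<forall>c\<in>A. \<forall>u y. smooth_on (chart_img c) (field_rep A c (\<lambda>q.
        blinfun_apply (\<Psi> q (\<lambda>i. of_chart A c q (u i))) (of_chart A c q y))))}"

definition AM_col :: "('m \<Rightarrow> 'a \<Rightarrow> 'b) \<Rightarrow> ('m \<Rightarrow> 'a \<Rightarrow> 'c) \<Rightarrow> 'm \<Rightarrow> 'a \<Rightarrow> 'b \<times> 'c" where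
  "AM_col \<psi> \<Psi> = (\<lambda>p v. (\<psi> p v, \<Psi> p v))"

definition Omega_AM ::
  "('m, 'e::euclidean_space) chart set \<Rightarrow> ('m \<Rightarrow> 'e \<Rightarrow> 'e \<Rightarrow> real) \<Rightarrow> nat \<Rightarrow>
     ('m \<Rightarrow> (nat \<Rightarrow> 'e) \<Rightarrow> 'e \<times> ('e \<Rightarrow>\<^sub>L 'e)) set" where
  "Omega_AM A g k = {AM_col \<psi> \<Psi> | \<psi> \<Psi>. \<psi> \<in> Omega_TM A k \<and> \<Psi> \<in> Omega_o A g k}"

text \<open>The covariant exterior derivative with respect to a linear connection \<open>D\<close> on a bundle with
  fibre \<open>'f\<close>.\<close>

definition cov_ext_deriv ::
  "('m, 'e::euclidean_space) chart set \<Rightarrow>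
     (('m \<Rightarrow> 'e) \<Rightarrow> ('m \<Rightarrow> 'f::real_vector) \<Rightarrow> 'm \<Rightarrow> 'f) \<Rightarrow>
     nat \<Rightarrow> ('m \<Rightarrow> (nat \<Rightarrow> 'e) \<Rightarrow> 'f) \<Rightarrow> 'm \<Rightarrow> (nat \<Rightarrow> 'e) \<Rightarrow> 'f" where
  "cov_ext_deriv A D k \<phi> p v =
     (let \<xi> = (\<lambda>i. extend A p (v i)) in
        (\<Sum>i\<le>k. (-1) ^ i *\<^sub>R D (\<xi> i) (\<lambda>q. \<phi> q (omit i (\<lambda>j. \<xi> j q))) p)
      + (\<Sum>j\<le>k. \<Sum>i<j. (-1) ^ (i + j) *\<^sub>R
           \<phi> p (case_nat (lie_bracket A (\<xi> i) (\<xi> j) p) (omit i (omit j v)))))"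

definition Alt ::
  "nat \<Rightarrow> ('m \<Rightarrow> (nat \<Rightarrow> 'e::real_normed_vector) \<Rightarrow> ('e \<Rightarrow>\<^sub>L 'e)) \<Rightarrow> 'm \<Rightarrow> (nat \<Rightarrow> 'e) \<Rightarrow> 'e" where
  "Alt k \<Psi> p v = (\<Sum>i\<le>k. (-1) ^ (k - i) *\<^sub>R blinfun_apply (\<Psi> p (omit i v)) (v i))"

section \<open>Sections of the harmonic subbundles\<close>

text \<open>For \<open>k = 0, 1\<close> these lie in the top component \<open>\<Omega>\<^sup>k(M,TM)\<close>, for \<open>k \<ge> 2\<close> in the bottom component
  \<open>\<Omega>\<^sup>k(M,\<oo>(TM))\<close>; the inclusion into \<open>\<Omega>\<^sup>k(M,AM)\<close> is left implicit.\<close>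

definition Gamma_H0 ::
  "('m, 'e::euclidean_space) chart set \<Rightarrow> ('m \<Rightarrow> (nat \<Rightarrow> 'e) \<Rightarrow> 'e) set" where
  "Gamma_H0 A = {(\<lambda>p _. X p) | X. vector_field A X}"

definition Gamma_H1 ::
  "('m, 'e::euclidean_space) chart set \<Rightarrow> ('m \<Rightarrow> 'e \<Rightarrow> 'e \<Rightarrow> real) \<Rightarrow>
     ('m \<Rightarrow> (nat \<Rightarrow> 'e) \<Rightarrow> 'e) set" where
  "Gamma_H1 A g = {\<psi> \<in> Omega_TM A 1. \<forall>p x y. g p (\<psi> p (\<lambda>_. x)) y = g p x (\<psi> p (\<lambda>_. y))}"

definition Gamma_H ::
  "('m, 'e::euclidean_space) chart set \<Rightarrow> ('m \<Rightarrow> 'e \<Rightarrow> 'e \<Rightarrow> real) \<Rightarrow> nat \<Rightarrow>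
     ('m \<Rightarrow> (nat \<Rightarrow> 'e) \<Rightarrow> ('e \<Rightarrow>\<^sub>L 'e)) set" where
  "Gamma_H A g k = {\<Psi> \<in> Omega_o A g k. \<forall>p v. Alt k \<Psi> p v = 0}"

text \<open>Sections of \<open>H\<^sup>1M \<oplus> (T\<^sup>*M \<otimes> \<oo>(TM))\<close>, and of \<open>\<Lambda>\<^sup>kT\<^sup>*M \<otimes> \<oo>(TM)\<close> viewed inside
  \<open>\<Lambda>\<^sup>kT\<^sup>*M \<otimes> AM\<close>.\<close>

definition Gamma_H1_plus_o ::
  "('m, 'e::euclidean_space) chart set \<Rightarrow> ('m \<Rightarrow> 'e \<Rightarrow> 'e \<Rightarrow> real) \<Rightarrow>
     ('m \<Rightarrow> (nat \<Rightarrow> 'e) \<Rightarrow> 'e \<times> ('e \<Rightarrow>\<^sub>L 'e)) set" where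
  "Gamma_H1_plus_o A g = {AM_col \<psi> \<Psi> | \<psi> \<Psi>. \<psi> \<in> Gamma_H1 A g \<and> \<Psi> \<in> Omega_o A g 1}"

definition Omega_o_in_AM ::
  "('m, 'e::euclidean_space) chart set \<Rightarrow> ('m \<Rightarrow> 'e \<Rightarrow> 'e \<Rightarrow> real) \<Rightarrow> nat \<Rightarrow>
     ('m \<Rightarrow> (nat \<Rightarrow> 'e) \<Rightarrow> 'e \<times> ('e \<Rightarrow>\<^sub>L 'e)) set" where
  "Omega_o_in_AM A g k = {AM_col (\<lambda>_ _. 0) \<Psi> | \<Psi>. \<Psi> \<in> Omega_o A g k}"

section \<open>Differential operators\<close>

definition same_1jet ::
  "('m, 'e::euclidean_space) chart set \<Rightarrow> 'm \<Rightarrow>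
     ('m \<Rightarrow> (nat \<Rightarrow> 'e) \<Rightarrow> 'e) \<Rightarrow> ('m \<Rightarrow> (nat \<Rightarrow> 'e) \<Rightarrow> 'e) \<Rightarrow> bool" where
  "same_1jet A p \<psi> \<psi>' \<longleftrightarrow>
     (let c = chart_at A p; x = snd c p in
        \<forall>u. form_rep A c \<psi> u x = form_rep A c \<psi>' u x \<and>
            frechet_derivative (form_rep A c \<psi> u) (at x) =
            frechet_derivative (form_rep A c \<psi>' u) (at x))"

text \<open>A linear first order differential operator \<open>S \<rightarrow> T\<close> (meaning, as usual, of order at most one):
  a linear map whose value at a point depends only on the \<open>1\<close>-jet of the section there. Smoothness of
  the coefficients is automatic because \<open>L\<close> maps into the smooth sections \<open>T\<close>.\<close>

definition linear_first_order_diff_op ::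
  "('m, 'e::euclidean_space) chart set \<Rightarrow> ('m \<Rightarrow> (nat \<Rightarrow> 'e) \<Rightarrow> 'e) set \<Rightarrow>
     ('m \<Rightarrow> (nat \<Rightarrow> 'e) \<Rightarrow> 'f::real_vector) set \<Rightarrow>
     (('m \<Rightarrow> (nat \<Rightarrow> 'e) \<Rightarrow> 'e) \<Rightarrow> 'm \<Rightarrow> (nat \<Rightarrow> 'e) \<Rightarrow> 'f) \<Rightarrow> bool" where
  "linear_first_order_diff_op A S T L \<longleftrightarrow>
     (\<forall>s\<in>S. L s \<in> T) \<and>
     (\<forall>s\<in>S. \<forall>t\<in>S. L (\<lambda>p v. s p v + t p v) = (\<lambda>p v. L s p v + L t p v)) \<and>
     (\<forall>a. \<forall>s\<in>S. L (\<lambda>p v. a *\<^sub>R s p v) = (\<lambda>p v. a *\<^sub>R L s p v)) \<and>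
     (\<forall>p. \<forall>s\<in>S. \<forall>t\<in>S. same_1jet A p s t \<longrightarrow> L s p = L t p)"

definition tensorial_op ::
  "('m, 'e::euclidean_space) chart set \<Rightarrow> ('m \<Rightarrow> (nat \<Rightarrow> 'e) \<Rightarrow> 'h::real_vector) set \<Rightarrow>
     ('m \<Rightarrow> (nat \<Rightarrow> 'e) \<Rightarrow> 'f::real_vector) set \<Rightarrow>
     (('m \<Rightarrow> (nat \<Rightarrow> 'e) \<Rightarrow> 'h) \<Rightarrow> 'm \<Rightarrow> (nat \<Rightarrow> 'e) \<Rightarrow> 'f) \<Rightarrow> bool" where
  "tensorial_op A S T L \<longleftrightarrow>
     (\<forall>s\<in>S. L s \<in> T) \<and>
     (\<forall>s\<in>S. \<forall>t\<in>S. L (\<lambda>p v. s p v + t p v) = (\<lambda>p v. L s p v + L t p v)) \<and>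
     (\<forall>f. smooth_fun A f \<longrightarrow>
        (\<forall>s\<in>S. L (\<lambda>p v. f p *\<^sub>R s p v) = (\<lambda>p v. f p *\<^sub>R L s p v)))"

section \<open>The splitting operators\<close>

abbreviation d_deform ::
  "('m, 'e::euclidean_space) chart set \<Rightarrow> ('m, 'e) connection \<Rightarrow> nat \<Rightarrow>
     ('m \<Rightarrow> (nat \<Rightarrow> 'e) \<Rightarrow> 'e \<times> ('e \<Rightarrow>\<^sub>L 'e)) \<Rightarrow> 'm \<Rightarrow> (nat \<Rightarrow> 'e) \<Rightarrow> 'e \<times> ('e \<Rightarrow>\<^sub>L 'e)" where
  "d_deform A D \<equiv> cov_ext_deriv A (deformation_conn A D)"

definition L0 ::
  "('m, 'e::euclidean_space) chart set \<Rightarrow> ('m \<Rightarrow> 'e \<Rightarrow> 'e \<Rightarrow> real) \<Rightarrow> ('m, 'e) connection \<Rightarrow>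
     ('m \<Rightarrow> (nat \<Rightarrow> 'e) \<Rightarrow> 'e) \<Rightarrow> 'm \<Rightarrow> (nat \<Rightarrow> 'e) \<Rightarrow> 'e \<times> ('e \<Rightarrow>\<^sub>L 'e)" where
  "L0 A g D \<eta> = AM_col \<eta>
     (THE \<Phi>. \<Phi> \<in> Omega_o A g 0 \<and> d_deform A D 0 (AM_col \<eta> \<Phi>) \<in> Gamma_H1_plus_o A g)"

definition L1 ::
  "('m, 'e::euclidean_space) chart set \<Rightarrow> ('m \<Rightarrow> 'e \<Rightarrow> 'e \<Rightarrow> real) \<Rightarrow> ('m, 'e) connection \<Rightarrow>
     ('m \<Rightarrow> (nat \<Rightarrow> 'e) \<Rightarrow> 'e) \<Rightarrow> 'm \<Rightarrow> (nat \<Rightarrow> 'e) \<Rightarrow> 'e \<times> ('e \<Rightarrow>\<^sub>L 'e)" where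
  "L1 A g D \<psi> = AM_col \<psi>
     (THE \<Psi>. \<Psi> \<in> Omega_o A g 1 \<and> d_deform A D 1 (AM_col \<psi> \<Psi>) \<in> Omega_o_in_AM A g 2)"

definition Lk ::
  "('m \<Rightarrow> (nat \<Rightarrow> 'e) \<Rightarrow> ('e::euclidean_space \<Rightarrow>\<^sub>L 'e)) \<Rightarrow> 'm \<Rightarrow> (nat \<Rightarrow> 'e) \<Rightarrow> 'e \<times> ('e \<Rightarrow>\<^sub>L 'e)" where
  "Lk \<Psi> = AM_col (\<lambda>_ _. 0) \<Psi>"

end

theory Submission
  imports Defs
begin

text \<open>Everything rests on tensoriality: an operation on global vector fields that is linear over smooth
  functions depends only on values at a point, because bump functions allow every field to be written,
  near the point, as a combination of coordinate fields with smooth coefficients. Connections are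
  likewise determined by one-jets. Torsion-freeness gives
  \<open>d\<^sup>\<nabla> \<phi> (v\<^sub>0, \<dots>, v\<^sub>k) = \<Sum>\<^sub>i (-1)\<^sup>i (\<nabla> \<phi>) (v\<^sub>i; \<dots>)\<close> with the
  \<open>i\<close>-th argument omitted on the right, so exterior derivatives are honest forms, and the bottom
  component of the derivative of an \<open>AM\<close>-valued form is automatically skew-symmetric and smooth.
  The conditions of (i) and (ii) concern the top component only. There they are algebraic at each point:
  \<open>\<Phi>\<close> must be the skew part of \<open>\<nabla> \<eta>\<close>, and \<open>\<Psi>\<close> is found from
  \<open>d\<^sup>\<nabla> \<psi>\<close> as in the Koszul formula. For (iii) the top component is, up to sign,
  \<open>Alt \<Psi>\<close>.\<close>

section \<open>Calculus of smooth maps\<close>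

text \<open>Vectors at different points are written in different charts \<open>chart_at A p\<close>,
  so a smooth field need not even be continuous as a function into the model space, and
  \<open>extend\<close> picks a global field by choice. An expression in fields is therefore first
  shown independent of the extension, and only then evaluated on a field that suits the purpose:
  coordinate fields for jets, \<open>extend\<close> for algebra. A second obstacle is that \<Phi>
  and \<Psi> are known only through their inner products. Their smoothness is recovered from a
  smooth orthogonal frame, made by Gram-Schmidt without normalisation, so that division but no
  square root occurs. Symmetry of second derivatives enters once, through
  \<open>[X,Y] f = X (Y f) - Y (X f)\<close>; this identity makes the curvature tensorial in its
  last slot and skew.\<close>

lemma has_derivative_cong_open:
  assumes "open S" "x \<in> S" "\<And>y. y \<in> S \<Longrightarrow> f y = g y"
  shows "(f has_derivative f') (at x) \<longleftrightarrow> (g has_derivative f') (at x)"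
  using assms by (metis has_derivative_transform_within_open)

lemma frechet_derivative_cong_open:
  assumes "open S" "x \<in> S" "\<And>y. y \<in> S \<Longrightarrow> f y = g y"
  shows "frechet_derivative f (at x) = frechet_derivative g (at x)"
  unfolding frechet_derivative_def by (simp add: has_derivative_cong_open[OF assms])

lemma differentiable_cong_open:
  assumes "open S" "x \<in> S" "\<And>y. y \<in> S \<Longrightarrow> f y = g y"
  shows "f differentiable (at x) \<longleftrightarrow> g differentiable (at x)"
  unfolding differentiable_def by (simp add: has_derivative_cong_open[OF assms])

lemma frechet_derivative_eq:
  "(f has_derivative f') (at x) \<Longrightarrow> frechet_derivative f (at x) = f'"
  by (simp add: frechet_derivative_at[symmetric])

section \<open>Closure properties of maps differentiable to finite order\<close>

lemma Ck_on_cong: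
  assumes "open S" "\<And>x. x \<in> S \<Longrightarrow> f x = g x"
  shows "Ck_on k S f \<longleftrightarrow> Ck_on k S g"
  using assms(2)
proof (induction k arbitrary: f g)
  case 0
  then show ?case by (auto intro: continuous_on_cong[THEN iffD1])
next
  case (Suc k)
  \<comment> \<open>Openness of \<open>S\<close> carries the argument: a derivative at a point of
    \<open>S\<close> sees a neighbourhood inside \<open>S\<close>, so maps equal on \<open>S\<close>
    have derivatives equal on \<open>S\<close>, and the hypothesis reproduces itself.\<close>
  have "\<And>v. Ck_on k S (\<lambda>x. frechet_derivative f (at x) v) \<longleftrightarrow>
      Ck_on k S (\<lambda>x. frechet_derivative g (at x) v)"
    by (rule Suc.IH) (simp add: frechet_derivative_cong_open[OF assms(1) _ Suc.prems])
  moreover have "\<And>x. x \<in> S \<Longrightarrow> f differentiable (at x) \<longleftrightarrow> g differentiable (at x)"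
    by (rule differentiable_cong_open[OF assms(1) _ Suc.prems])
  ultimately show ?case by simp
qed

lemma Ck_on_subset: "Ck_on k S f \<Longrightarrow> T \<subseteq> S \<Longrightarrow> Ck_on k T f"
  by (induction k arbitrary: f) (auto intro: continuous_on_subset)

lemma Ck_on_local:
  assumes "\<And>x. x \<in> S \<Longrightarrow> \<exists>T. open T \<and> x \<in> T \<and> Ck_on k T f"
  shows "Ck_on k S f"
  using assms
proof (induction k arbitrary: f)
  case 0
  then have "\<And>x. x \<in> S \<Longrightarrow> isCont f x"
    using continuous_on_eq_continuous_at by (metis Ck_on.simps(1))
  then show ?case by (simp add: continuous_at_imp_continuous_on)
next
  case (Suc k)
  have "f differentiable (at x)" if "x \<in> S" for x
    using Suc.prems[OF that] by auto
  moreover have "Ck_on k S (\<lambda>x. frechet_derivative f (at x) v)" for v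
  proof (rule Suc.IH)
    show "\<exists>T. open T \<and> x \<in> T \<and> Ck_on k T (\<lambda>x. frechet_derivative f (at x) v)" if "x \<in> S" for x
      using Suc.prems[OF that] by auto
  qed
  ultimately show ?case by simp
qed

text \<open>\<open>Ck_on\<close> refers to the chosen \<open>frechet_derivative\<close>. Here any
  family \<open>f'\<close> known to be the derivative takes its place, so the rules below can insert
  the formula of the product, chain or inverse rule.\<close>

lemma Ck_on_SucI:
  assumes "open S" "\<And>x. x \<in> S \<Longrightarrow> (f has_derivative f' x) (at x)" "\<And>v. Ck_on k S (\<lambda>x. f' x v)"
  shows "Ck_on (Suc k) S f"
proof -
  have "Ck_on k S (\<lambda>x. frechet_derivative f (at x) v) \<longleftrightarrow> Ck_on k S (\<lambda>x. f' x v)" for v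
    by (rule Ck_on_cong[OF assms(1)]) (simp add: frechet_derivative_eq[OF assms(2)])
  then show ?thesis using assms by (auto simp: differentiable_def)
qed

lemma Ck_on_Suc_has_derivative:
  assumes "Ck_on (Suc k) S f" "x \<in> S"
  shows "(f has_derivative frechet_derivative f (at x)) (at x)"
  using assms by (simp add: frechet_derivative_works)

text \<open>\<open>Ck_on (Suc k)\<close> speaks of derivatives only, so the lower order has to be
  deduced; at the bottom, differentiability gives continuity.\<close>

lemma Ck_on_SucD:
  "Ck_on (Suc k) S f \<Longrightarrow> Ck_on k S f"
proof (induction k arbitrary: f)
  case 0
  then show ?case
    by (auto intro!: continuous_at_imp_continuous_on differentiable_imp_continuous_within)
qed auto

lemma Ck_on_const: "Ck_on k S (\<lambda>x. c)"
  by (induction k arbitrary: c) auto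

lemma Ck_on_bounded_linear:
  assumes "open S" "bounded_linear h"
  shows "Ck_on k S f \<Longrightarrow> Ck_on k S (\<lambda>x. h (f x))"
proof (induction k arbitrary: f)
  case 0
  then show ?case using assms(2) by (auto intro: bounded_linear.continuous_on)
next
  case (Suc k)
  show ?case
  proof (rule Ck_on_SucI[OF assms(1)])
    show "((\<lambda>x. h (f x)) has_derivative (\<lambda>v. h (frechet_derivative f (at x) v))) (at x)"
      if "x \<in> S" for x
      by (rule bounded_linear.has_derivative[OF assms(2) Ck_on_Suc_has_derivative[OF Suc.prems that]])
  qed (use Suc in auto)
qed

lemma Ck_on_add:
  assumes "open S"
  shows "Ck_on k S f \<Longrightarrow> Ck_on k S g \<Longrightarrow> Ck_on k S (\<lambda>x. f x + g x)"
proof (induction k arbitrary: f g)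
  case (Suc k)
  have d: "Ck_on k S (\<lambda>x. frechet_derivative f (at x) v)" "Ck_on k S (\<lambda>x. frechet_derivative g (at x) v)" for v
    using Suc.prems by auto
  show ?case
    by (rule Ck_on_SucI[OF assms has_derivative_add[OF
          Ck_on_Suc_has_derivative[OF Suc.prems(1)] Ck_on_Suc_has_derivative[OF Suc.prems(2)]]])
      (auto intro!: Suc.IH d)
qed (auto intro: continuous_on_add)

lemma Ck_on_bilinear:
  assumes "open S" "bounded_bilinear h"
  shows "Ck_on k S f \<Longrightarrow> Ck_on k S g \<Longrightarrow> Ck_on k S (\<lambda>x. h (f x) (g x))"
proof (induction k arbitrary: f g)
  case 0
  then show ?case using bounded_bilinear.continuous_on[OF assms(2)] by auto
next
  case (Suc k)
  \<comment> \<open>The product rule leaves \<open>f\<close> and \<open>g\<close> themselves as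
    factors, so they are needed at order \<open>k\<close> along with their derivatives.\<close>
  note sm = Ck_on_SucD[OF Suc.prems(1)] Ck_on_SucD[OF Suc.prems(2)]
  have d: "Ck_on k S (\<lambda>x. frechet_derivative f (at x) v)" "Ck_on k S (\<lambda>x. frechet_derivative g (at x) v)" for v
    using Suc.prems by auto
  show ?case
    by (rule Ck_on_SucI[OF assms(1) bounded_bilinear.FDERIV[OF assms(2)
          Ck_on_Suc_has_derivative[OF Suc.prems(1)] Ck_on_Suc_has_derivative[OF Suc.prems(2)]]])
      (auto intro!: Ck_on_add assms(1) Suc.IH d sm)
qed

lemma Ck_on_sum:
  assumes "open S"
  shows "(\<And>i. i \<in> I \<Longrightarrow> Ck_on k S (f i)) \<Longrightarrow> Ck_on k S (\<lambda>x. \<Sum>i\<in>I. f i x)"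
  by (induction I rule: infinite_finite_induct) (auto intro: Ck_on_const Ck_on_add[OF assms])

text \<open>\<open>Ck_on\<close> differentiates in constant directions only. For a direction that
  moves with the point, this shifts the motion into scalar coefficients.\<close>

lemma frechet_derivative_basis:
  fixes f :: "'a::euclidean_space \<Rightarrow> 'b::real_normed_vector"
  assumes "f differentiable (at x)"
  shows "frechet_derivative f (at x) v = (\<Sum>b\<in>Basis. (v \<bullet> b) *\<^sub>R frechet_derivative f (at x) b)"
proof -
  have l: "linear (frechet_derivative f (at x))"
    using assms by (rule linear_frechet_derivative)
  have "frechet_derivative f (at x) v = frechet_derivative f (at x) (\<Sum>b\<in>Basis. (v \<bullet> b) *\<^sub>R b)"
    by (simp add: euclidean_representation)
  then show ?thesis by (simp add: linear_sum[OF l] linear_scale[OF l])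
qed

lemma Ck_on_compose:
  fixes f :: "'a::euclidean_space \<Rightarrow> 'b::euclidean_space" and g :: "'b \<Rightarrow> 'c::real_normed_vector"
  assumes "open S" "open T" "f ` S \<subseteq> T"
  shows "Ck_on k T g \<Longrightarrow> Ck_on k S f \<Longrightarrow> Ck_on k S (\<lambda>x. g (f x))"
proof (induction k arbitrary: g)
  case 0
  then show ?case using assms by (auto intro: continuous_on_compose2)
next
  case (Suc k)
  have df: "(f has_derivative frechet_derivative f (at x)) (at x)" if "x \<in> S" for x
    using Ck_on_Suc_has_derivative[OF Suc.prems(2) that] .
  have dg: "(g has_derivative frechet_derivative g (at y)) (at y)" if "y \<in> T" for y
    using Ck_on_Suc_has_derivative[OF Suc.prems(1) that] .
  have gd: "g differentiable (at (f x))" if "x \<in> S" for x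
    using Suc.prems(1) assms(3) that by auto
  \<comment> \<open>In the chain rule \<open>g\<close> is differentiated in a direction that moves
    with \<open>x\<close>. Over the basis only composites of \<open>f\<close> with a derivative of
    \<open>g\<close> in a fixed direction \<open>b\<close> remain, and the induction hypothesis
    covers these.\<close>
  have "Ck_on k S (\<lambda>x. \<Sum>b\<in>Basis. (frechet_derivative f (at x) v \<bullet> b) *\<^sub>R frechet_derivative g (at (f x)) b)" for v
    by (intro Ck_on_sum assms Ck_on_bilinear[OF _ bounded_bilinear_scaleR]
        Ck_on_bounded_linear[OF _ bounded_linear_inner_left] Suc.IH)
      (use Suc.prems Ck_on_SucD in auto)
  then have "Ck_on k S (\<lambda>x. frechet_derivative g (at (f x)) (frechet_derivative f (at x) v))" for v
    by (subst Ck_on_cong[OF assms(1) frechet_derivative_basis[OF gd]])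
  then show ?case
    by (intro Ck_on_SucI[OF assms(1) has_derivative_compose[OF df dg]]) (use assms(3) in auto)
qed

lemma Ck_on_inverse:
  fixes f :: "'a::euclidean_space \<Rightarrow> real"
  assumes "open S" "\<And>x. x \<in> S \<Longrightarrow> f x \<noteq> 0"
  shows "Ck_on k S f \<Longrightarrow> Ck_on k S (\<lambda>x. inverse (f x))"
proof (induction k)
  case 0
  then show ?case using assms by (auto intro: continuous_on_inverse)
next
  case (Suc k)
  \<comment> \<open>The derivative of \<open>inverse f\<close> contains \<open>inverse f\<close>
    again, but only at order \<open>k\<close>.\<close>
  have IH: "Ck_on k S (\<lambda>x. inverse (f x))" using Suc Ck_on_SucD by blast
  have "Ck_on k S (\<lambda>x. - (inverse (f x) * frechet_derivative f (at x) v * inverse (f x)))" for v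
    by (intro Ck_on_bounded_linear[OF assms(1), of "\<lambda>x. - x"] bounded_linear_minus bounded_linear_ident
        Ck_on_bilinear[OF assms(1) bounded_bilinear_mult] IH) (use Suc.prems in auto)
  then show ?case
    by (intro Ck_on_SucI[OF assms(1) Deriv.has_derivative_inverse[OF _ Ck_on_Suc_has_derivative[OF Suc.prems]]])
       (use assms in auto)
qed

section \<open>Closure properties of smooth maps\<close>

lemma smooth_on_cong:
  "open S \<Longrightarrow> (\<And>x. x \<in> S \<Longrightarrow> f x = g x) \<Longrightarrow> smooth_on S f \<longleftrightarrow> smooth_on S g"
  unfolding smooth_on_def using Ck_on_cong by blast

lemma smooth_on_subset: "smooth_on S f \<Longrightarrow> T \<subseteq> S \<Longrightarrow> smooth_on T f"
  unfolding smooth_on_def using Ck_on_subset by blast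

lemma smooth_on_local:
  assumes "\<And>x. x \<in> S \<Longrightarrow> \<exists>T. open T \<and> x \<in> T \<and> smooth_on T f"
  shows "smooth_on S f"
  unfolding smooth_on_def
proof (intro allI Ck_on_local)
  fix k x assume "x \<in> S"
  then show "\<exists>T. open T \<and> x \<in> T \<and> Ck_on k T f" using assms unfolding smooth_on_def by blast
qed

lemma smooth_on_differentiable: "smooth_on S f \<Longrightarrow> x \<in> S \<Longrightarrow> f differentiable (at x)"
  unfolding smooth_on_def by (metis Ck_on.simps(2))

lemma smooth_on_has_derivative:
  "smooth_on S f \<Longrightarrow> x \<in> S \<Longrightarrow> (f has_derivative frechet_derivative f (at x)) (at x)"
  using smooth_on_differentiable frechet_derivative_works by blast

lemma smooth_on_frechet_derivative:
  "smooth_on S f \<Longrightarrow> smooth_on S (\<lambda>x. frechet_derivative f (at x) v)"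
  unfolding smooth_on_def by (metis Ck_on.simps(2))

lemma smooth_on_const: "smooth_on S (\<lambda>x. c)"
  by (simp add: smooth_on_def Ck_on_const)

lemma smooth_on_bounded_linear:
  "open S \<Longrightarrow> bounded_linear h \<Longrightarrow> smooth_on S f \<Longrightarrow> smooth_on S (\<lambda>x. h (f x))"
  unfolding smooth_on_def using Ck_on_bounded_linear by blast

lemma smooth_on_ident: "open S \<Longrightarrow> smooth_on S (\<lambda>x. x)"
proof -
  assume S: "open S"
  have "Ck_on k S (\<lambda>x. x)" for k
  proof (cases k)
    case (Suc m)
    show ?thesis unfolding Suc
      by (rule Ck_on_SucI[OF S has_derivative_ident]) (rule Ck_on_const)
  qed simp
  then show ?thesis by (simp add: smooth_on_def)
qed

lemma smooth_on_add:
  "open S \<Longrightarrow> smooth_on S f \<Longrightarrow> smooth_on S g \<Longrightarrow> smooth_on S (\<lambda>x. f x + g x)"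
  unfolding smooth_on_def using Ck_on_add by blast

lemma smooth_on_bilinear:
  "open S \<Longrightarrow> bounded_bilinear h \<Longrightarrow> smooth_on S f \<Longrightarrow> smooth_on S g \<Longrightarrow>
    smooth_on S (\<lambda>x. h (f x) (g x))"
  unfolding smooth_on_def using Ck_on_bilinear by blast

lemmas smooth_on_scaleR = smooth_on_bilinear[OF _ bounded_bilinear_scaleR]
lemmas smooth_on_mult = smooth_on_bilinear[OF _ bounded_bilinear_mult]
lemmas smooth_on_inner = smooth_on_bilinear[OF _ bounded_bilinear_inner]
lemmas smooth_on_minus = smooth_on_bounded_linear[OF _ bounded_linear_minus[OF bounded_linear_ident]]

lemma smooth_on_diff:
  assumes "open S" "smooth_on S f" "smooth_on S g"
  shows "smooth_on S (\<lambda>x. f x - g x)"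
  using smooth_on_add[OF assms(1,2) smooth_on_minus[OF assms(1,3)]] by simp

lemma smooth_on_sum:
  "open S \<Longrightarrow> (\<And>i. i \<in> I \<Longrightarrow> smooth_on S (f i)) \<Longrightarrow> smooth_on S (\<lambda>x. \<Sum>i\<in>I. f i x)"
  by (simp add: smooth_on_def Ck_on_sum)

lemma smooth_on_compose:
  fixes f :: "'a::euclidean_space \<Rightarrow> 'b::euclidean_space" and g :: "'b \<Rightarrow> 'c::real_normed_vector"
  assumes "open S" "open T" "f ` S \<subseteq> T" "smooth_on T g" "smooth_on S f"
  shows "smooth_on S (\<lambda>x. g (f x))"
  using assms Ck_on_compose[OF assms(1-3)] unfolding smooth_on_def by blast

lemma smooth_on_inverse:
  fixes f :: "'a::euclidean_space \<Rightarrow> real"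
  assumes "open S" "\<And>x. x \<in> S \<Longrightarrow> f x \<noteq> 0" "smooth_on S f"
  shows "smooth_on S (\<lambda>x. inverse (f x))"
  using assms by (simp add: smooth_on_def Ck_on_inverse)

lemma smooth_on_frechet_derivative_field:
  fixes f :: "'a::euclidean_space \<Rightarrow> 'b::real_normed_vector"
  assumes "open S" "smooth_on S f" "smooth_on S V"
  shows "smooth_on S (\<lambda>x. frechet_derivative f (at x) (V x))"
proof -
  have "smooth_on S (\<lambda>x. \<Sum>b\<in>Basis. (V x \<bullet> b) *\<^sub>R frechet_derivative f (at x) b)"
    by (intro smooth_on_sum smooth_on_scaleR smooth_on_inner smooth_on_const
        smooth_on_frechet_derivative assms)
  then show ?thesis
    by (subst smooth_on_cong[OF assms(1) frechet_derivative_basis[OF smooth_on_differentiable[OF assms(2)]]])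
qed

section \<open>Second derivatives, bump functions and orthogonal frames\<close>

lemma DERIV_along_line:
  fixes f :: "'a::real_normed_vector \<Rightarrow> real"
  assumes "(f has_derivative f') (at (x + s *\<^sub>R u))"
  shows "((\<lambda>t. f (x + t *\<^sub>R u)) has_real_derivative f' u) (at s)"
proof -
  have "((\<lambda>t. x + t *\<^sub>R u) has_derivative (\<lambda>t. t *\<^sub>R u)) (at s)"
    by (auto intro!: derivative_eq_intros)
  then have "((\<lambda>t. f (x + t *\<^sub>R u)) has_derivative (\<lambda>t. f' (t *\<^sub>R u))) (at s)"
    by (rule has_derivative_compose) (rule assms)
  then show ?thesis
    by (rule has_derivative_imp_has_field_derivative)
      (simp add: linear_scale[OF has_derivative_linear[OF assms]])
qed

text \<open>The second difference over a parallelogram is symmetric in \<open>u\<close> and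
  \<open>v\<close>. The mean value theorem, once along each side, turns it into a mixed derivative
  at some nearby point; with \<open>u\<close> and \<open>v\<close> exchanged it gives the other
  mixed derivative.\<close>

lemma second_difference_mean_value:
  fixes f :: "'a::euclidean_space \<Rightarrow> real"
  assumes f: "Ck_on (Suc (Suc 0)) S f" and S: "ball x d \<subseteq> S"
    and h: "h > 0" "h * (norm u + norm v) < d"
  shows "\<exists>y\<in>ball x d. f (x + h *\<^sub>R u + h *\<^sub>R v) - f (x + h *\<^sub>R u) - f (x + h *\<^sub>R v) + f x
    = h * h * frechet_derivative (\<lambda>y. frechet_derivative f (at y) u) (at y) v"
proof -
  have inb: "x + s *\<^sub>R u + t *\<^sub>R v \<in> ball x d" if "0 \<le> s" "s \<le> h" "0 \<le> t" "t \<le> h" for s t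
  proof -
    have "norm (s *\<^sub>R u + t *\<^sub>R v) \<le> norm (s *\<^sub>R u) + norm (t *\<^sub>R v)" by (rule norm_triangle_ineq)
    also have "\<dots> \<le> h * norm u + h * norm v" using that by (auto intro!: add_mono mult_right_mono)
    also have "\<dots> < d" using h by (simp add: algebra_simps)
    finally have "dist x (x + (s *\<^sub>R u + t *\<^sub>R v)) < d"
      by (metis dist_add_cancel add.right_neutral dist_0_norm)
    then show ?thesis by (simp add: add.assoc)
  qed
  have df: "(f has_derivative frechet_derivative f (at y)) (at y)" if "y \<in> ball x d" for y
    using f S that by (auto simp: frechet_derivative_works[symmetric])
  have ddf: "((\<lambda>y. frechet_derivative f (at y) u) has_derivative
      frechet_derivative (\<lambda>y. frechet_derivative f (at y) u) (at y)) (at y)" if "y \<in> ball x d" for y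
    using f S that by (auto simp: frechet_derivative_works[symmetric])
  \<comment> \<open>The increment of \<phi> over \<open>[0, h]\<close> is the second difference. Its
    slope compares \<open>u\<close>-derivatives at two points that differ by
    \<open>h *\<^sub>R v\<close>; \<open>\<psi>\<close> below runs between them.\<close>
  define \<phi> where "\<phi> s = f ((x + h *\<^sub>R v) + s *\<^sub>R u) - f (x + s *\<^sub>R u)" for s
  have "(\<phi> has_real_derivative (frechet_derivative f (at ((x + h *\<^sub>R v) + s *\<^sub>R u)) u
      - frechet_derivative f (at (x + s *\<^sub>R u)) u)) (at s)" if "0 \<le> s" "s \<le> h" for s
    unfolding \<phi>_def
    by (intro DERIV_diff DERIV_along_line df)
      (use inb[of s h] inb[of s 0] that h in \<open>auto simp: algebra_simps\<close>)
  from MVT2[OF h(1) this] obtain s where s: "0 < s" "s < h"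
    and e1: "\<phi> h - \<phi> 0 = h * (frechet_derivative f (at ((x + h *\<^sub>R v) + s *\<^sub>R u)) u
      - frechet_derivative f (at (x + s *\<^sub>R u)) u)" by auto
  define \<psi> where "\<psi> t = frechet_derivative f (at ((x + s *\<^sub>R u) + t *\<^sub>R v)) u" for t
  have "(\<psi> has_real_derivative frechet_derivative (\<lambda>y. frechet_derivative f (at y) u)
      (at ((x + s *\<^sub>R u) + t *\<^sub>R v)) v) (at t)" if "0 \<le> t" "t \<le> h" for t
    unfolding \<psi>_def
    by (rule DERIV_along_line[of "\<lambda>y. frechet_derivative f (at y) u"], rule ddf)
      (use inb[of s t] that s in auto)
  from MVT2[OF h(1) this] obtain t where t: "0 < t" "t < h"
    and e2: "\<psi> h - \<psi> 0 = h * frechet_derivative (\<lambda>y. frechet_derivative f (at y) u)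
      (at ((x + s *\<^sub>R u) + t *\<^sub>R v)) v" by auto
  have "\<psi> h - \<psi> 0 = frechet_derivative f (at ((x + h *\<^sub>R v) + s *\<^sub>R u)) u
      - frechet_derivative f (at (x + s *\<^sub>R u)) u"
    unfolding \<psi>_def by (simp add: algebra_simps)
  then have "\<phi> h - \<phi> 0 = h * (h * frechet_derivative (\<lambda>y. frechet_derivative f (at y) u)
      (at ((x + s *\<^sub>R u) + t *\<^sub>R v)) v)" using e1 e2 by simp
  moreover have "\<phi> h - \<phi> 0 = f (x + h *\<^sub>R u + h *\<^sub>R v) - f (x + h *\<^sub>R u) - f (x + h *\<^sub>R v) + f x"
    unfolding \<phi>_def by (simp add: algebra_simps)
  ultimately show ?thesis using inb[of s t] s t by (intro bexI[of _ "(x + s *\<^sub>R u) + t *\<^sub>R v"]) auto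
qed

lemma second_derivative_symmetric:
  fixes f :: "'a::euclidean_space \<Rightarrow> real"
  assumes f: "Ck_on (Suc (Suc 0)) S f" and S: "open S" "x \<in> S"
  shows "frechet_derivative (\<lambda>y. frechet_derivative f (at y) u) (at x) v
    = frechet_derivative (\<lambda>y. frechet_derivative f (at y) v) (at x) u"
    (is "?a x = ?b x")
proof (rule ccontr)
  assume ne: "?a x \<noteq> ?b x"
  \<comment> \<open>Half the gap: two deviations below \<open>e\<close> cannot bridge it.\<close>
  define e where "e = \<bar>?a x - ?b x\<bar> / 2"
  have e: "e > 0" using ne by (simp add: e_def)
  have "continuous_on S ?a" "continuous_on S ?b" using f by auto
  then have "isCont ?a x" "isCont ?b x" using S by (auto simp: continuous_on_eq_continuous_at)
  then obtain d1 d2 where d1: "d1 > 0" "\<And>y. dist y x < d1 \<Longrightarrow> dist (?a y) (?a x) < e"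
    and d2: "d2 > 0" "\<And>y. dist y x < d2 \<Longrightarrow> dist (?b y) (?b x) < e"
    unfolding continuous_at_eps_delta using e by metis
  obtain d3 where d3: "d3 > 0" "ball x d3 \<subseteq> S" using S openE by blast
  define d where "d = min d1 (min d2 d3)"
  have d: "d > 0" "ball x d \<subseteq> S" using d1 d2 d3 by (auto simp: d_def)
  \<comment> \<open>Small enough that the parallelogram stays in the ball; the \<open>+ 1\<close>
    keeps the denominator positive when \<open>u\<close> and \<open>v\<close> are both 0.\<close>
  define h where "h = d / (2 * (norm u + norm v + 1))"
  have pos: "2 * (norm u + norm v + 1) > 0" by (intro mult_pos_pos add_nonneg_pos add_nonneg_nonneg) auto
  have h: "h > 0" using d pos by (simp add: h_def)
  have "h * (2 * (norm u + norm v + 1)) = d" using pos by (simp add: h_def)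
  then have "h * (norm u + norm v) + (h * (norm u + norm v) + 2 * h) = d" by (simp add: algebra_simps)
  moreover have "0 < h * (norm u + norm v) + 2 * h"
    using h by (intro add_nonneg_pos mult_nonneg_nonneg add_nonneg_nonneg) auto
  ultimately have "h * (norm u + norm v) < d" by linarith
  then have h2: "h * (norm u + norm v) < d" "h * (norm v + norm u) < d" by (simp_all add: add.commute)
  from second_difference_mean_value[OF f d(2) h h2(1)] second_difference_mean_value[OF f d(2) h h2(2)]
  obtain y z where y: "y \<in> ball x d" and z: "z \<in> ball x d" and eq: "h * h * ?a y = h * h * ?b z"
    by (auto simp: algebra_simps)
  have "?a y = ?b z" using eq h by simp
  moreover have "dist (?a y) (?a x) < e" using y by (intro d1) (auto simp: d_def dist_commute)
  moreover have "dist (?b z) (?b x) < e" using z by (intro d2) (auto simp: d_def dist_commute)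
  ultimately have "\<bar>?a x - ?b x\<bar> < 2 * e" by (simp add: dist_real_def)
  then show False by (simp add: e_def)
qed

section \<open>Smooth bump functions on the model space\<close>

definition flat_exp :: "real poly \<Rightarrow> real \<Rightarrow> real" where
  "flat_exp p t = (if t > 0 then poly p (inverse t) * exp (- inverse t) else 0)"

lemma poly_times_exp_minus_tendsto_0:
  fixes p :: "real poly"
  shows "((\<lambda>s. poly p s * exp (- s)) \<longlongrightarrow> 0) at_top"
proof -
  have "((\<lambda>s. \<Sum>i\<le>degree p. coeff p i * (s ^ i / exp s)) \<longlongrightarrow> (\<Sum>i\<le>degree p. coeff p i * 0)) at_top"
    by (intro tendsto_sum tendsto_mult tendsto_const tendsto_power_div_exp_0)
  then show ?thesis
    by (simp add: poly_altdef sum_distrib_right exp_minus divide_inverse mult.assoc)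
qed

lemma flat_exp_tendsto_0: "(flat_exp p \<longlongrightarrow> 0) (at 0)"
proof -
  have "((\<lambda>t. poly p (inverse t) * exp (- inverse t)) \<longlongrightarrow> 0) (at_right 0)"
    by (rule filterlim_compose[OF poly_times_exp_minus_tendsto_0 filterlim_inverse_at_top_right])
  then have "(flat_exp p \<longlongrightarrow> 0) (at_right 0)"
    by (rule tendsto_cong[THEN iffD1, rotated])
      (auto simp: flat_exp_def eventually_at_filter)
  moreover have "(flat_exp p \<longlongrightarrow> 0) (at_left 0)"
    by (rule tendsto_cong[THEN iffD1, OF _ tendsto_const])
      (auto simp: flat_exp_def eventually_at_filter)
  ultimately show ?thesis by (simp add: filterlim_split_at)
qed

text \<open>With \<open>s = 1/t\<close>, the derivative of \<open>p(s) exp(-s)\<close> in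
  \<open>t\<close> is \<open>s^2 (p(s) - p'(s)) exp(-s)\<close>. The polynomial parameter of
  \<open>flat_exp\<close> is there for this closure under differentiation, which makes smoothness a
  single induction; \<open>p = 1\<close> is the classical flat function.\<close>

lemma flat_exp_has_derivative:
  "(flat_exp p has_real_derivative flat_exp (monom 1 2 * (p - pderiv p)) t) (at t)"
proof -
  consider "t > 0" | "t < 0" | "t = 0" by linarith
  then show ?thesis
  proof cases
    case 1
    have "((\<lambda>t. poly p (inverse t) * exp (- inverse t)) has_real_derivative
        flat_exp (monom 1 2 * (p - pderiv p)) t) (at t)"
      using 1 by (auto intro!: derivative_eq_intros DERIV_chain2[OF poly_DERIV]
          simp: flat_exp_def poly_monom power2_eq_square algebra_simps)
    then show ?thesis
      by (rule has_field_derivative_transform_within_open[OF _ open_greaterThan[of 0]]) (auto simp: 1 flat_exp_def)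
  next
    case 2
    have "((\<lambda>t. 0) has_real_derivative flat_exp (monom 1 2 * (p - pderiv p)) t) (at t)"
      using 2 by (simp add: flat_exp_def)
    then show ?thesis
      by (rule has_field_derivative_transform_within_open[OF _ open_lessThan[of 0]]) (auto simp: 2 flat_exp_def)
  next
    case 3
    \<comment> \<open>At 0 the difference quotient has one more factor \<open>1/h\<close>, so the
      polynomial is multiplied by its variable; the quotient still tends to 0.\<close>
    have "flat_exp p h / h = flat_exp (pCons 0 p) h" for h
      by (simp add: flat_exp_def field_simps)
    then show ?thesis
      using flat_exp_tendsto_0[of "pCons 0 p"]
      unfolding 3 DERIV_def by (simp add: flat_exp_def[of _ 0])
  qed
qed

lemma smooth_on_flat_exp: "smooth_on UNIV (flat_exp p)"
proof -
  have "Ck_on k UNIV (flat_exp p)" for k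
  proof (induction k arbitrary: p)
    case 0
    show ?case
      using flat_exp_has_derivative[THEN DERIV_isCont] by (auto intro!: continuous_at_imp_continuous_on)
  next
    case (Suc k)
    have "Ck_on k UNIV (\<lambda>t. flat_exp (monom 1 2 * (p - pderiv p)) t * v)" for v
      by (intro Ck_on_bounded_linear[OF _ bounded_linear_mult_left] Suc.IH) auto
    then show ?case
      by (intro Ck_on_SucI[OF _ flat_exp_has_derivative[unfolded has_field_derivative_def]]) auto
  qed
  then show ?thesis by (simp add: smooth_on_def)
qed

text \<open>\<open>a\<close> vanishes from radius \<open>r\<close> outwards and \<open>b\<close>
  from radius \<open>r / 2\<close> inwards, so they never vanish together, and
  \<open>a / (a + b)\<close> has the required plateau.\<close>

lemma smooth_bump_exists:
  fixes x0 :: "'a::euclidean_space"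
  assumes "r > 0"
  obtains f :: "'a \<Rightarrow> real" where "smooth_on UNIV f"
    "\<And>x. x \<in> ball x0 (r / 2) \<Longrightarrow> f x = 1" "\<And>x. x \<notin> cball x0 r \<Longrightarrow> f x = 0"
proof -
  \<comment> \<open>The squared distance is smooth everywhere; the distance itself is not smooth at
    \<open>x0\<close>.\<close>
  define q where "q x = (x - x0) \<bullet> (x - x0)" for x
  define a where "a x = flat_exp 1 (r\<^sup>2 - q x)" for x
  define b where "b x = flat_exp 1 (q x - (r / 2)\<^sup>2)" for x
  have q: "q x = (dist x0 x)\<^sup>2" for x by (simp add: q_def power2_norm_eq_inner[symmetric] dist_norm norm_minus_commute)
  have nn: "flat_exp 1 t \<ge> 0" for t by (simp add: flat_exp_def)
  have rr: "(r / 2)\<^sup>2 < r\<^sup>2" using assms by (simp add: power2_eq_square)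
  have "a x + b x > 0" for x
  proof (cases "q x < r\<^sup>2")
    case True
    then have "a x > 0" by (simp add: a_def flat_exp_def)
    then show ?thesis using nn by (simp add: b_def add_pos_nonneg)
  next
    case False
    then have "b x > 0" using rr by (simp add: b_def flat_exp_def)
    then show ?thesis using nn by (simp add: a_def add_nonneg_pos)
  qed
  then have ne: "a x + b x \<noteq> 0" for x by (metis less_irrefl)
  have sq: "smooth_on UNIV q"
    unfolding q_def by (intro smooth_on_inner smooth_on_diff smooth_on_ident smooth_on_const open_UNIV)
  have sa: "smooth_on UNIV a" unfolding a_def
    by (rule smooth_on_compose[OF _ open_UNIV _ smooth_on_flat_exp])
      (auto intro!: smooth_on_diff sq smooth_on_const)
  have sb: "smooth_on UNIV b" unfolding b_def
    by (rule smooth_on_compose[OF _ open_UNIV _ smooth_on_flat_exp])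
      (auto intro!: smooth_on_diff sq smooth_on_const)
  show ?thesis
  proof (rule that[of "\<lambda>x. a x * inverse (a x + b x)"])
    show "smooth_on UNIV (\<lambda>x. a x * inverse (a x + b x))"
      by (intro smooth_on_mult smooth_on_inverse smooth_on_add sa sb open_UNIV ne)
    show "a x * inverse (a x + b x) = 1" if "x \<in> ball x0 (r / 2)" for x
    proof -
      have "q x < (r / 2)\<^sup>2" unfolding q using that by (intro power_strict_mono) auto
      then have "b x = 0" by (simp add: b_def flat_exp_def)
      then show ?thesis using ne[of x] by simp
    qed
    show "a x * inverse (a x + b x) = 0" if "x \<notin> cball x0 r" for x
    proof -
      have "r\<^sup>2 < q x" unfolding q using that assms by (intro power_strict_mono) auto
      then show ?thesis by (simp add: a_def flat_exp_def)
    qed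
  qed
qed

section \<open>Smooth families of inner products\<close>

lemma bilinear_sum_left: "bilinear h \<Longrightarrow> h (\<Sum>i\<in>I. f i) y = (\<Sum>i\<in>I. h (f i) y)"
  by (simp add: bilinear_def linear_sum[of "\<lambda>x. h x y"])

lemma bilinear_sum_right: "bilinear h \<Longrightarrow> h y (\<Sum>i\<in>I. f i) = (\<Sum>i\<in>I. h y (f i))"
  by (simp add: bilinear_def linear_sum)

text \<open>Smoothness of \<open>G\<close> is given on constant vectors only; expanding both
  arguments in the basis transfers it to moving ones.\<close>

lemma smooth_on_bilinear_family:
  fixes G :: "'a::euclidean_space \<Rightarrow> 'b::euclidean_space \<Rightarrow> 'b \<Rightarrow> real"
  assumes S: "open S" and bil: "\<And>x. x \<in> S \<Longrightarrow> bilinear (G x)"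
    and sm: "\<And>u v. smooth_on S (\<lambda>x. G x u v)" and U: "smooth_on S U" and V: "smooth_on S V"
  shows "smooth_on S (\<lambda>x. G x (U x) (V x))"
proof -
  have "G x (U x) (V x) = (\<Sum>b\<in>Basis. \<Sum>c\<in>Basis. (U x \<bullet> b) * ((V x \<bullet> c) * G x b c))" if "x \<in> S" for x
  proof -
    note B = bil[OF that]
    have "G x (U x) (V x) = G x (\<Sum>b\<in>Basis. (U x \<bullet> b) *\<^sub>R b) (\<Sum>c\<in>Basis. (V x \<bullet> c) *\<^sub>R c)"
      by (simp add: euclidean_representation)
    also have "\<dots> = (\<Sum>b\<in>Basis. \<Sum>c\<in>Basis. (U x \<bullet> b) * ((V x \<bullet> c) * G x b c))"
      unfolding bilinear_sum_left[OF B] bilinear_sum_right[OF B] bilinear_lmul[OF B] bilinear_rmul[OF B]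
      by (subst sum.swap) (simp add: sum_distrib_left mult.left_commute)
    finally show ?thesis .
  qed
  moreover have "smooth_on S (\<lambda>x. \<Sum>b\<in>Basis. \<Sum>c\<in>Basis. (U x \<bullet> b) * ((V x \<bullet> c) * G x b c))"
    by (intro smooth_on_sum smooth_on_mult smooth_on_inner S U V sm smooth_on_const)
  ultimately show ?thesis by (subst smooth_on_cong[OF S]) auto
qed

text \<open>One frame serves all of \<open>S\<close>, since the procedure is the same rational
  expression at every point. Dividing by the positive \<open>G x (F b x) (F b x)\<close> replaces
  normalisation. The span is tracked so that \<open>c\<close> minus its projection is seen to be
  nonzero.\<close>

lemma smooth_gram_schmidt:
  fixes G :: "'a::euclidean_space \<Rightarrow> 'b::euclidean_space \<Rightarrow> 'b \<Rightarrow> real"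
  assumes S: "open S" and bil: "\<And>x. x \<in> S \<Longrightarrow> bilinear (G x)"
    and sym: "\<And>x u v. x \<in> S \<Longrightarrow> G x u v = G x v u"
    and pos: "\<And>x u. x \<in> S \<Longrightarrow> u \<noteq> 0 \<Longrightarrow> G x u u > 0"
    and sm: "\<And>u v. smooth_on S (\<lambda>x. G x u v)"
  shows "finite B \<Longrightarrow> independent B \<Longrightarrow>
    \<exists>F. (\<forall>b\<in>B. smooth_on S (F b)) \<and> (\<forall>x\<in>S. (\<forall>b\<in>B. F b x \<noteq> 0) \<and>
      (\<forall>b\<in>B. \<forall>c\<in>B. b \<noteq> c \<longrightarrow> G x (F b x) (F c x) = 0) \<and> span ((\<lambda>b. F b x) ` B) = span B)"
proof (induction B rule: finite_induct)
  case empty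
  then show ?case by auto
next
  case (insert c B)
  have indep: "independent B" and cB: "c \<notin> span B"
    using insert.prems insert.hyps by (auto simp: independent_insert)
  then obtain F where F: "\<And>b. b \<in> B \<Longrightarrow> smooth_on S (F b)"
    and ne: "\<And>x b. x \<in> S \<Longrightarrow> b \<in> B \<Longrightarrow> F b x \<noteq> 0"
    and orth: "\<And>x b d. x \<in> S \<Longrightarrow> b \<in> B \<Longrightarrow> d \<in> B \<Longrightarrow> b \<noteq> d \<Longrightarrow> G x (F b x) (F d x) = 0"
    and span: "\<And>x. x \<in> S \<Longrightarrow> span ((\<lambda>b. F b x) ` B) = span B"
    using insert.IH by blast
  define P where "P x = (\<Sum>b\<in>B. (G x c (F b x) * inverse (G x (F b x) (F b x))) *\<^sub>R F b x)" for x
  define F' where "F' = F(c := \<lambda>x. c - P x)"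
  have F'B: "F' b = F b" if "b \<in> B" for b using that insert.hyps by (auto simp: F'_def)
  have F'c: "F' c x = c - P x" for x by (simp add: F'_def)
  have nz: "G x (F b x) (F b x) \<noteq> 0" if "x \<in> S" "b \<in> B" for x b
    using pos[OF that(1) ne[OF that]] by simp
  have sP: "smooth_on S P" unfolding P_def
    by (intro smooth_on_sum S smooth_on_scaleR smooth_on_mult smooth_on_inverse
        smooth_on_bilinear_family[OF S bil sm] smooth_on_const F nz)
  have Pspan: "P x \<in> span ((\<lambda>b. F b x) ` B)" for x unfolding P_def
    by (intro span_sum span_scale span_base) auto
  have c0: "F' c x \<noteq> 0" if "x \<in> S" for x
    using Pspan[of x] cB by (auto simp: F'c span[OF that])
  have oc: "G x (F' c x) (F d x) = 0" if "x \<in> S" "d \<in> B" for x d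
  proof -
    note bl = bil[OF that(1)]
    have "G x (P x) (F d x) = (\<Sum>b\<in>B. if b = d then G x c (F d x) else 0)"
      unfolding P_def bilinear_sum_left[OF bl] bilinear_lmul[OF bl]
      using orth[OF that(1) _ that(2)] nz[OF that] by (intro sum.cong) auto
    then show ?thesis using that(2) insert.hyps by (simp add: F'c bilinear_lsub[OF bl])
  qed
  have sp: "span ((\<lambda>b. F' b x) ` insert c B) = span (insert c B)" if "x \<in> S" for x
  proof -
    have "(\<lambda>b. F' b x) ` insert c B = insert (c - P x) ((\<lambda>b. F b x) ` B)"
      using F'B by (auto simp: F'c image_iff)
    also have "span \<dots> = span (insert c ((\<lambda>b. F b x) ` B))"
      by (rule eq_span_insert_eq) (use span_neg[OF Pspan[of x]] in simp)
    also have "\<dots> = span (insert c B)"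
      unfolding span_insert by (simp add: span[OF that])
    finally show ?thesis .
  qed
  have "\<forall>b\<in>insert c B. smooth_on S (F' b)"
    using F F'B smooth_on_diff[OF S smooth_on_const sP] by (auto simp: F'_def)
  moreover have "\<forall>x\<in>S. (\<forall>b\<in>insert c B. F' b x \<noteq> 0)" using c0 ne F'B by auto
  moreover have "\<forall>x\<in>S. \<forall>b\<in>insert c B. \<forall>d\<in>insert c B. b \<noteq> d \<longrightarrow> G x (F' b x) (F' d x) = 0"
    using oc orth F'B sym by (metis insert_iff)
  ultimately show ?case using sp by blast
qed

text \<open>Pairings with constant vectors determine those with an orthogonal frame, and these are,
  up to division by smooth positive functions, the coefficients of \<open>W\<close>. No Gram matrix
  has to be inverted.\<close>

lemma smooth_on_riesz:
  fixes G :: "'a::euclidean_space \<Rightarrow> 'b::euclidean_space \<Rightarrow> 'b \<Rightarrow> real"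
  assumes S: "open S" and bil: "\<And>x. x \<in> S \<Longrightarrow> bilinear (G x)"
    and sym: "\<And>x u v. x \<in> S \<Longrightarrow> G x u v = G x v u"
    and pos: "\<And>x u. x \<in> S \<Longrightarrow> u \<noteq> 0 \<Longrightarrow> G x u u > 0"
    and sm: "\<And>u v. smooth_on S (\<lambda>x. G x u v)"
    and W: "\<And>u. smooth_on S (\<lambda>x. G x (W x) u)"
  shows "smooth_on S W"
proof -
  obtain F where F: "\<And>b. b \<in> Basis \<Longrightarrow> smooth_on S (F b)"
    and ne: "\<And>x b. x \<in> S \<Longrightarrow> b \<in> Basis \<Longrightarrow> F b x \<noteq> 0"
    and orth: "\<And>x b d. x \<in> S \<Longrightarrow> b \<in> Basis \<Longrightarrow> d \<in> Basis \<Longrightarrow> b \<noteq> d \<Longrightarrow> G x (F b x) (F d x) = 0"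
    and span: "\<And>x. x \<in> S \<Longrightarrow> span ((\<lambda>b. F b x) ` (Basis :: 'b set)) = UNIV"
    using smooth_gram_schmidt[OF S bil sym pos sm finite_Basis independent_Basis]
    unfolding span_Basis by metis
  have nz: "G x (F b x) (F b x) \<noteq> 0" if "x \<in> S" "b \<in> Basis" for x b
    using pos[OF that(1) ne[OF that]] by simp
  have GW: "G x (W x) (V x) = (\<Sum>c\<in>Basis. (V x \<bullet> c) * G x (W x) c)" if "x \<in> S" for V x
  proof -
    note bl = bil[OF that]
    have "G x (W x) (V x) = G x (W x) (\<Sum>c\<in>Basis. (V x \<bullet> c) *\<^sub>R c)"
      by (simp add: euclidean_representation)
    then show ?thesis by (simp add: bilinear_sum_right[OF bl] bilinear_rmul[OF bl])
  qed
  have sW: "smooth_on S (\<lambda>x. G x (W x) (F b x))" if "b \<in> Basis" for b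
    by (subst smooth_on_cong[OF S GW])
      (auto intro!: smooth_on_sum smooth_on_mult smooth_on_inner S W F that smooth_on_const)
  define P where "P x = (\<Sum>b\<in>Basis. (G x (W x) (F b x) * inverse (G x (F b x) (F b x))) *\<^sub>R F b x)" for x
  have sP: "smooth_on S P" unfolding P_def
    by (intro smooth_on_sum S smooth_on_scaleR smooth_on_mult smooth_on_inverse
        smooth_on_bilinear_family[OF S bil sm] sW F nz)
  have "W x = P x" if x: "x \<in> S" for x
  proof -
    note bl = bil[OF that]
    have G0: "G x (W x - P x) (F d x) = 0" if "d \<in> Basis" for d
    proof -
      have "G x (P x) (F d x) = (\<Sum>b\<in>Basis. if b = d then G x (W x) (F d x) else 0)"
        unfolding P_def bilinear_sum_left[OF bl] bilinear_lmul[OF bl]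
        using orth[OF x _ that] nz[OF x that] by (intro sum.cong) auto
      then show ?thesis using that by (simp add: bilinear_lsub[OF bl])
    qed
    \<comment> \<open>The difference is orthogonal to a spanning set, hence to itself, and
      definiteness makes it 0.\<close>
    have "G x (W x - P x) z = 0" if "z \<in> span ((\<lambda>b. F b x) ` (Basis :: 'b set))" for z
      using that
      by (induction rule: span_induct_alt)
        (auto simp: bilinear_radd[OF bl] bilinear_rmul[OF bl] bilinear_rzero[OF bl] G0)
    then have "G x (W x - P x) (W x - P x) = 0" by (simp add: span[OF x])
    then show ?thesis using pos[OF x, of "W x - P x"] by force
  qed
  then show ?thesis using sP by (subst smooth_on_cong[OF S]) auto
qed

section \<open>Tensoriality on manifolds\<close>

text \<open>Separates the variation of the field from a pure second derivative of \<open>f\<close>.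
  In a commutator of two fields the first kind of term produces the Lie bracket.\<close>

lemma frechet_derivative_pairing:
  fixes f :: "'a::euclidean_space \<Rightarrow> real"
  assumes S: "open S" "x \<in> S" and f: "smooth_on S f" and V: "smooth_on S V"
  shows "frechet_derivative (\<lambda>y. frechet_derivative f (at y) (V y)) (at x) u
    = frechet_derivative f (at x) (frechet_derivative V (at x) u)
      + frechet_derivative (\<lambda>y. frechet_derivative f (at y) (V x)) (at x) u"
proof -
  let ?f2 = "\<lambda>b. frechet_derivative (\<lambda>y. frechet_derivative f (at y) b) (at x)"
  have df: "((\<lambda>y. frechet_derivative f (at y) b) has_derivative ?f2 b) (at x)" for b
    by (rule smooth_on_has_derivative[OF smooth_on_frechet_derivative[OF f] S(2)])
  have main: "frechet_derivative (\<lambda>y. frechet_derivative f (at y) (W y)) (at x) u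
    = (\<Sum>b\<in>Basis. (W x \<bullet> b) * ?f2 b u) + (\<Sum>b\<in>Basis. (frechet_derivative W (at x) u \<bullet> b) * frechet_derivative f (at x) b)"
    if W: "smooth_on S W" for W
  proof -
    have dW: "(W has_derivative frechet_derivative W (at x)) (at x)"
      by (rule smooth_on_has_derivative[OF W S(2)])
    have "frechet_derivative (\<lambda>y. frechet_derivative f (at y) (W y)) (at x)
        = frechet_derivative (\<lambda>y. \<Sum>b\<in>Basis. (W y \<bullet> b) * frechet_derivative f (at y) b) (at x)"
      by (rule frechet_derivative_cong_open[OF S])
        (simp add: frechet_derivative_basis[OF smooth_on_differentiable[OF f], of _ "W _"])
    also have "\<dots> = (\<lambda>u. \<Sum>b\<in>Basis. (W x \<bullet> b) * ?f2 b u + (frechet_derivative W (at x) u \<bullet> b) * frechet_derivative f (at x) b)"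
      by (rule frechet_derivative_eq, rule has_derivative_sum,
        rule has_derivative_mult[OF bounded_linear.has_derivative[OF bounded_linear_inner_left dW] df])
    finally show ?thesis by (simp add: sum.distrib)
  qed
  have "frechet_derivative f (at x) (frechet_derivative V (at x) u)
      = (\<Sum>b\<in>Basis. (frechet_derivative V (at x) u \<bullet> b) * frechet_derivative f (at x) b)"
    using frechet_derivative_basis[OF smooth_on_differentiable[OF f S(2)], of "frechet_derivative V (at x) u"]
    by (simp only: real_scaleR_def)
  \<comment> \<open>The second use of \<open>main\<close>, on the constant field with value
    \<open>V x\<close>, identifies the sum of second derivatives.\<close>
  then show ?thesis using main[OF V] main[OF smooth_on_const[of S "V x"]] by simp
qed

locale smooth_manifold =
  fixes A :: "('m::t2_space, 'e::euclidean_space) chart set"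
  assumes atlas: "smooth_atlas A"
begin

section \<open>Charts and the differentials of transition maps\<close>

lemma chart_homeomorphism:
  "c \<in> A \<Longrightarrow> homeomorphism (fst c) (chart_img c) (snd c) (chart_inv c)"
  using atlas by (auto simp: smooth_atlas_def is_chart_def)

lemma open_chart_domain: "c \<in> A \<Longrightarrow> open (fst c)"
  and open_chart_img: "c \<in> A \<Longrightarrow> open (chart_img c)"
  using atlas by (auto simp: smooth_atlas_def is_chart_def)

lemma chart_inv_chart: "c \<in> A \<Longrightarrow> p \<in> fst c \<Longrightarrow> chart_inv c (snd c p) = p"
  using chart_homeomorphism by (simp add: homeomorphism_def)

lemma chart_in_img: "p \<in> fst c \<Longrightarrow> snd c p \<in> chart_img c"
  by (simp add: chart_img_def)

lemma chart_chart_inv: "c \<in> A \<Longrightarrow> x \<in> chart_img c \<Longrightarrow> snd c (chart_inv c x) = x"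
  and chart_inv_in: "c \<in> A \<Longrightarrow> x \<in> chart_img c \<Longrightarrow> chart_inv c x \<in> fst c"
  using chart_homeomorphism[of c] unfolding homeomorphism_def by blast+

lemma chart_at_in: "chart_at A p \<in> A" and in_chart_at: "p \<in> fst (chart_at A p)"
proof -
  have "p \<in> (\<Union>c\<in>A. fst c)" using atlas by (simp add: smooth_atlas_def)
  then have "\<exists>c. c \<in> A \<and> p \<in> fst c" by blast
  from someI_ex[OF this] show "chart_at A p \<in> A" "p \<in> fst (chart_at A p)"
    by (auto simp: chart_at_def)
qed

lemma open_chart_image:
  assumes "c \<in> A" "open V"
  shows "open (snd c ` (fst c \<inter> V))"
proof -
  have "openin (top_of_set (fst c)) (fst c \<inter> V)" using assms by auto
  from homeomorphism_imp_open_map[OF chart_homeomorphism[OF assms(1)] this]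
  show ?thesis using open_chart_img[OF assms(1)] openin_open_eq by blast
qed

lemma chart_image_iff:
  "c \<in> A \<Longrightarrow> x \<in> snd c ` (fst c \<inter> V) \<longleftrightarrow> x \<in> chart_img c \<and> chart_inv c x \<in> V"
  by (metis (no_types, lifting) Int_iff chart_chart_inv chart_img_def chart_inv_chart chart_inv_in image_iff)

lemma transition_smooth:
  "c \<in> A \<Longrightarrow> d \<in> A \<Longrightarrow> smooth_on (snd c ` (fst c \<inter> fst d)) (snd d \<circ> chart_inv c)"
  using atlas by (auto simp: smooth_atlas_def)

lemma transition_has_derivative:
  assumes "c \<in> A" "d \<in> A" "p \<in> fst c" "p \<in> fst d"
  shows "((snd d \<circ> chart_inv c) has_derivative chart_change c d p) (at (snd c p))"
  unfolding chart_change_def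
  by (rule smooth_on_has_derivative[OF transition_smooth]) (use assms in auto)

lemma linear_chart_change:
  assumes "c \<in> A" "d \<in> A" "p \<in> fst c" "p \<in> fst d"
  shows "linear (chart_change c d p)"
  using has_derivative_linear[OF transition_has_derivative[OF assms]] .

lemma chart_change_self:
  assumes "c \<in> A" "p \<in> fst c"
  shows "chart_change c c p v = v"
proof -
  have "((snd c \<circ> chart_inv c) has_derivative (\<lambda>v. v)) (at (snd c p))"
    by (rule has_derivative_transform_within_open[OF has_derivative_ident open_chart_img[OF assms(1)]])
      (use assms in \<open>auto simp: chart_in_img chart_chart_inv\<close>)
  then show ?thesis by (simp add: chart_change_def frechet_derivative_eq)
qed

text \<open>Chain rule. The composite of two transition maps equals the third only on the image of
  the overlap of \<open>c\<close> and \<open>d\<close>, but this is an open set around the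
  point.\<close>

lemma chart_change_trans:
  assumes A: "c \<in> A" "d \<in> A" "e \<in> A" and p: "p \<in> fst c" "p \<in> fst d" "p \<in> fst e"
  shows "chart_change d e p (chart_change c d p v) = chart_change c e p v"
proof -
  have 1: "((snd d \<circ> chart_inv c) has_derivative chart_change c d p) (at (snd c p))"
    by (rule transition_has_derivative) (use A p in auto)
  have 2: "((snd e \<circ> chart_inv d) has_derivative chart_change d e p) (at ((snd d \<circ> chart_inv c) (snd c p)))"
    using transition_has_derivative[OF A(2,3) p(2,3)] A p by (simp add: chart_inv_chart)
  have 3: "((\<lambda>x. (snd e \<circ> chart_inv d) ((snd d \<circ> chart_inv c) x)) has_derivative
      (\<lambda>v. chart_change d e p (chart_change c d p v))) (at (snd c p))"
    by (rule has_derivative_compose[OF 1 2])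
  have "((snd e \<circ> chart_inv c) has_derivative
      (\<lambda>v. chart_change d e p (chart_change c d p v))) (at (snd c p))"
    by (rule has_derivative_transform_within_open[OF 3 open_chart_image[OF A(1) open_chart_domain[OF A(2)]]])
      (use A p in \<open>auto simp: chart_inv_chart\<close>)
  then show ?thesis by (simp add: chart_change_def[of c e] frechet_derivative_eq)
qed

lemma linear_to_chart: "c \<in> A \<Longrightarrow> p \<in> fst c \<Longrightarrow> linear (to_chart A c p)"
  and linear_of_chart: "c \<in> A \<Longrightarrow> p \<in> fst c \<Longrightarrow> linear (of_chart A c p)"
  unfolding to_chart_def of_chart_def by (auto intro!: linear_chart_change chart_at_in in_chart_at)

lemma to_chart_of_chart: "c \<in> A \<Longrightarrow> p \<in> fst c \<Longrightarrow> to_chart A c p (of_chart A c p v) = v"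
  and of_chart_to_chart: "c \<in> A \<Longrightarrow> p \<in> fst c \<Longrightarrow> of_chart A c p (to_chart A c p v) = v"
  unfolding to_chart_def of_chart_def
  by (simp_all add: chart_change_trans chart_change_self chart_at_in in_chart_at)

lemma to_chart_change:
  "c \<in> A \<Longrightarrow> d \<in> A \<Longrightarrow> p \<in> fst c \<Longrightarrow> p \<in> fst d \<Longrightarrow>
    chart_change c d p (to_chart A c p v) = to_chart A d p v"
  unfolding to_chart_def by (simp add: chart_change_trans chart_at_in in_chart_at)

text \<open>In the preferred chart a vector is its own coordinate vector. So
  \<open>dir_deriv\<close>, \<open>lie_bracket\<close> and \<open>same_1jet\<close> can be evaluated
  at \<open>p\<close> without a change of chart.\<close>

lemma to_chart_chart_at: "to_chart A (chart_at A p) p v = v"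
  and of_chart_chart_at: "of_chart A (chart_at A p) p v = v"
  unfolding to_chart_def of_chart_def by (simp_all add: chart_change_self chart_at_in in_chart_at)

lemma field_rep_chart: "c \<in> A \<Longrightarrow> p \<in> fst c \<Longrightarrow> field_rep A c X (snd c p) = to_chart A c p (X p)"
  by (simp add: field_rep_def chart_inv_chart)

section \<open>Smooth functions and fields, tested in one chart around each point\<close>

lemma smooth_on_transition_compose:
  assumes A: "c \<in> A" "d \<in> A" and W: "open W" "W \<subseteq> fst c"
    and h: "smooth_on (snd c ` W) h"
  shows "smooth_on (snd d ` (fst d \<inter> W)) (\<lambda>x. h ((snd c \<circ> chart_inv d) x))"
proof (rule smooth_on_compose[OF _ _ _ h])
  have "smooth_on (snd d ` (fst d \<inter> fst c)) (snd c \<circ> chart_inv d)"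
    by (rule transition_smooth[OF A(2,1)])
  then show "smooth_on (snd d ` (fst d \<inter> W)) (snd c \<circ> chart_inv d)"
    by (rule smooth_on_subset) (use W in auto)
  show "open (snd d ` (fst d \<inter> W))" by (rule open_chart_image[OF A(2) W(1)])
  show "open (snd c ` W)" using open_chart_image[OF A(1) W(1)] W(2) by (simp add: Int_absorb1)
  show "(snd c \<circ> chart_inv d) ` snd d ` (fst d \<inter> W) \<subseteq> snd c ` W"
    using A by (auto simp: chart_inv_chart)
qed

lemma smooth_funI:
  assumes "\<And>p. \<exists>c W. c \<in> A \<and> open W \<and> p \<in> W \<and> W \<subseteq> fst c \<and> smooth_on (snd c ` W) (f \<circ> chart_inv c)"
  shows "smooth_fun A f"
  unfolding smooth_fun_def
proof (intro ballI smooth_on_local)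
  fix d x assume d: "d \<in> A" and x: "x \<in> chart_img d"
  obtain c W where c: "c \<in> A" and W: "open W" "chart_inv d x \<in> W" "W \<subseteq> fst c"
    and sm: "smooth_on (snd c ` W) (f \<circ> chart_inv c)" using assms by blast
  let ?T = "snd d ` (fst d \<inter> W)"
  have T: "open ?T" by (rule open_chart_image[OF d W(1)])
  have "smooth_on ?T (\<lambda>x. (f \<circ> chart_inv c) ((snd c \<circ> chart_inv d) x))"
    by (rule smooth_on_transition_compose[OF c d W(1,3) sm])
  then have "smooth_on ?T (f \<circ> chart_inv d)"
    by (subst smooth_on_cong[OF T]) (use W c d in \<open>auto simp: chart_inv_chart subset_iff\<close>)
  then show "\<exists>T. open T \<and> x \<in> T \<and> smooth_on T (f \<circ> chart_inv d)"
    using T chart_image_iff[OF d, of x W] x W by blast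
qed

text \<open>The representative in another chart \<open>d\<close> is the derivative of the transition
  map applied to the representative in \<open>c\<close>, that is, a derivative in a smoothly varying
  direction.\<close>

lemma vector_fieldI:
  assumes "\<And>p. \<exists>c W. c \<in> A \<and> open W \<and> p \<in> W \<and> W \<subseteq> fst c \<and> smooth_on (snd c ` W) (field_rep A c X)"
  shows "vector_field A X"
  unfolding vector_field_def
proof (intro ballI smooth_on_local)
  fix d x assume d: "d \<in> A" and x: "x \<in> chart_img d"
  obtain c W where c: "c \<in> A" and W: "open W" "chart_inv d x \<in> W" "W \<subseteq> fst c"
    and sm: "smooth_on (snd c ` W) (field_rep A c X)" using assms by blast
  let ?W = "fst d \<inter> W"
  let ?T = "snd d ` ?W"
  have oW: "open ?W" using W open_chart_domain[OF d] by auto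
  have T: "open ?T" by (rule open_chart_image[OF d W(1)])
  have cW: "open (snd c ` ?W)" using open_chart_image[OF c oW] W(3) by (simp add: Int_absorb1 le_infI2)
  have "smooth_on (snd c ` ?W) (\<lambda>y. frechet_derivative (snd d \<circ> chart_inv c) (at y) (field_rep A c X y))"
    by (rule smooth_on_frechet_derivative_field[OF cW smooth_on_subset[OF transition_smooth[OF c d]] smooth_on_subset[OF sm]])
      (use W in auto)
  from smooth_on_transition_compose[OF c d oW _ this] W(3)
  have "smooth_on ?T (\<lambda>x. frechet_derivative (snd d \<circ> chart_inv c) (at ((snd c \<circ> chart_inv d) x))
      (field_rep A c X ((snd c \<circ> chart_inv d) x)))" by auto
  moreover have "frechet_derivative (snd d \<circ> chart_inv c) (at ((snd c \<circ> chart_inv d) y))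
      (field_rep A c X ((snd c \<circ> chart_inv d) y)) = field_rep A d X y" if "y \<in> ?T" for y
    using that W c d
    by (auto simp: chart_inv_chart field_rep_chart subset_iff to_chart_change chart_change_def[symmetric])
  ultimately have "smooth_on ?T (field_rep A d X)"
    by (subst smooth_on_cong[OF T]) auto
  then show "\<exists>T. open T \<and> x \<in> T \<and> smooth_on T (field_rep A d X)"
    using T chart_image_iff[OF d, of x W] x W by blast
qed

lemma smooth_fun_on: "smooth_fun A f \<Longrightarrow> c \<in> A \<Longrightarrow> smooth_on (chart_img c) (f \<circ> chart_inv c)"
  by (simp add: smooth_fun_def)

lemma vector_field_on: "vector_field A X \<Longrightarrow> c \<in> A \<Longrightarrow> smooth_on (chart_img c) (field_rep A c X)"
  by (simp add: vector_field_def)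

lemma smooth_fun_const: "smooth_fun A (\<lambda>q. a)"
  by (simp add: smooth_fun_def comp_def smooth_on_const)

lemma smooth_fun_add: "smooth_fun A f \<Longrightarrow> smooth_fun A h \<Longrightarrow> smooth_fun A (\<lambda>q. f q + h q)"
  by (auto simp: smooth_fun_def comp_def intro!: smooth_on_add open_chart_img)

lemma smooth_fun_mult: "smooth_fun A f \<Longrightarrow> smooth_fun A h \<Longrightarrow> smooth_fun A (\<lambda>q. f q * h q)"
  by (auto simp: smooth_fun_def comp_def intro!: smooth_on_mult open_chart_img)

lemma field_rep_add:
  "c \<in> A \<Longrightarrow> x \<in> chart_img c \<Longrightarrow>
    field_rep A c (\<lambda>q. X q + Y q) x = field_rep A c X x + field_rep A c Y x"
  by (simp add: field_rep_def linear_add[OF linear_to_chart] chart_inv_in)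

lemma field_rep_scaleR:
  "c \<in> A \<Longrightarrow> x \<in> chart_img c \<Longrightarrow>
    field_rep A c (\<lambda>q. f q *\<^sub>R X q) x = f (chart_inv c x) *\<^sub>R field_rep A c X x"
  by (simp add: field_rep_def linear_scale[OF linear_to_chart] chart_inv_in)

lemma field_rep_zero:
  "c \<in> A \<Longrightarrow> x \<in> chart_img c \<Longrightarrow> field_rep A c (\<lambda>q. 0) x = 0"
  by (simp add: field_rep_def linear_0[OF linear_to_chart] chart_inv_in)

lemma field_rep_of_chart:
  "c \<in> A \<Longrightarrow> x \<in> chart_img c \<Longrightarrow> field_rep A c (\<lambda>q. of_chart A c q (F q)) x = F (chart_inv c x)"
  by (simp add: field_rep_def to_chart_of_chart chart_inv_in)

lemma vector_field_add:
  assumes "vector_field A X" "vector_field A Y"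
  shows "vector_field A (\<lambda>q. X q + Y q)"
  unfolding vector_field_def
proof
  fix c assume c: "c \<in> A"
  show "smooth_on (chart_img c) (field_rep A c (\<lambda>q. X q + Y q))"
    by (rule smooth_on_cong[OF open_chart_img[OF c] field_rep_add[OF c], THEN iffD2], assumption)
      (intro smooth_on_add open_chart_img c vector_field_on assms)
qed

lemma vector_field_scaleR:
  assumes "smooth_fun A f" "vector_field A X"
  shows "vector_field A (\<lambda>q. f q *\<^sub>R X q)"
  unfolding vector_field_def
proof
  fix c assume c: "c \<in> A"
  show "smooth_on (chart_img c) (field_rep A c (\<lambda>q. f q *\<^sub>R X q))"
    by (rule smooth_on_cong[OF open_chart_img[OF c] field_rep_scaleR[OF c], THEN iffD2], assumption)
      (intro smooth_on_scaleR open_chart_img c vector_field_on assms smooth_fun_on[unfolded comp_def])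
qed

lemma vector_field_zero: "vector_field A (\<lambda>q. 0)"
  unfolding vector_field_def
proof
  fix c assume c: "c \<in> A"
  show "smooth_on (chart_img c) (field_rep A c (\<lambda>q. 0))"
    by (rule smooth_on_cong[OF open_chart_img[OF c] field_rep_zero[OF c], THEN iffD2], assumption)
      (rule smooth_on_const)
qed

lemmas vector_field_cmult = vector_field_scaleR[OF smooth_fun_const]

lemma vector_field_minus: "vector_field A X \<Longrightarrow> vector_field A (\<lambda>q. - X q)"
  using vector_field_cmult[of X "-1"] by simp

lemma vector_field_diff:
  assumes "vector_field A X" "vector_field A Y"
  shows "vector_field A (\<lambda>q. X q - Y q)"
  using vector_field_add[OF assms(1) vector_field_minus[OF assms(2)]] by simp

lemma vector_field_sum:
  "(\<And>i. i \<in> I \<Longrightarrow> vector_field A (X i)) \<Longrightarrow> vector_field A (\<lambda>q. \<Sum>i\<in>I. X i q)"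
  by (induction I rule: infinite_finite_induct) (auto intro: vector_field_zero vector_field_add)

section \<open>Cutoffs and globally defined coordinate fields\<close>

lemma bump_function:
  assumes c: "c \<in> A" and p: "p \<in> fst c"
  obtains \<beta> N K where "smooth_fun A \<beta>" "open N" "p \<in> N" "N \<subseteq> fst c" "closed K" "K \<subseteq> fst c"
    "\<And>q. q \<in> N \<Longrightarrow> \<beta> q = 1" "\<And>q. q \<notin> K \<Longrightarrow> \<beta> q = 0"
proof -
  obtain r where r: "r > 0" "cball (snd c p) r \<subseteq> chart_img c"
    using open_chart_img[OF c] chart_in_img[OF p] open_contains_cball by blast
  obtain \<rho> :: "'e \<Rightarrow> real" where \<rho>: "smooth_on UNIV \<rho>"
    "\<And>x. x \<in> ball (snd c p) (r / 2) \<Longrightarrow> \<rho> x = 1" "\<And>x. x \<notin> cball (snd c p) r \<Longrightarrow> \<rho> x = 0"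
    using smooth_bump_exists[OF r(1)] by blast
  define \<beta> where "\<beta> q = (if q \<in> fst c then \<rho> (snd c q) else 0)" for q
  define K where "K = chart_inv c ` cball (snd c p) r"
  define N where "N = fst c \<inter> snd c -` ball (snd c p) (r / 2)"
  have cont: "continuous_on (chart_img c) (chart_inv c)" "continuous_on (fst c) (snd c)"
    using chart_homeomorphism[OF c] by (auto simp: homeomorphism_def)
  \<comment> \<open>The Hausdorff property enters here: \<open>K\<close> is compact as the image of
    a closed ball, and it has to be closed in the whole manifold for the extension by zero to be
    smooth beyond the chart.\<close>
  have K: "closed K" unfolding K_def
    by (intro compact_imp_closed compact_continuous_image continuous_on_subset[OF cont(1) r(2)] compact_cball)
  have Kc: "K \<subseteq> fst c" unfolding K_def using r(2) chart_inv_in[OF c] by auto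
  have N: "open N" unfolding N_def
    by (rule continuous_open_preimage[OF cont(2) open_chart_domain[OF c] open_ball])
  have pN: "p \<in> N" using r p by (simp add: N_def)
  have \<beta>0: "\<beta> q = 0" if "q \<notin> K" for q
    using that \<rho>(3)[of "snd c q"] chart_inv_chart[OF c, of q] by (force simp: \<beta>_def K_def image_iff)
  have "smooth_fun A \<beta>"
  proof (rule smooth_funI)
    fix q
    show "\<exists>d W. d \<in> A \<and> open W \<and> q \<in> W \<and> W \<subseteq> fst d \<and> smooth_on (snd d ` W) (\<beta> \<circ> chart_inv d)"
    proof (cases "q \<in> fst c")
      case True
      have "smooth_on (chart_img c) (\<beta> \<circ> chart_inv c)"
        by (subst smooth_on_cong[OF open_chart_img[OF c], of _ \<rho>])
          (auto simp: \<beta>_def chart_inv_in chart_chart_inv c intro: smooth_on_subset[OF \<rho>(1)])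
      then show ?thesis using c True open_chart_domain[OF c] by (intro exI[of _ c] exI[of _ "fst c"]) (auto simp: chart_img_def)
    next
      case False
      let ?d = "chart_at A q"
      let ?W = "fst ?d \<inter> - K"
      have d: "?d \<in> A" by (rule chart_at_in)
      have W: "open (- K)" using K by auto
      have "smooth_on (snd ?d ` ?W) (\<beta> \<circ> chart_inv ?d)"
        by (subst smooth_on_cong[OF open_chart_image[OF d W], of _ "\<lambda>_. 0"])
          (auto simp: chart_inv_chart[OF d] \<beta>0 smooth_on_const)
      then show ?thesis using d open_Int[OF open_chart_domain[OF d] W] in_chart_at[of q] False Kc
        by (intro exI[of _ ?d] exI[of _ ?W]) auto
    qed
  qed
  then show ?thesis
    by (rule that[OF _ N pN _ K Kc]) (auto simp: N_def \<beta>_def \<rho>(2) \<beta>0[unfolded \<beta>_def])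
qed

text \<open>Outside the domain of \<open>c\<close> the values of \<open>of_chart A c\<close> and
  \<open>F\<close> carry no meaning, but the factor \<beta> is 0 there. The domain and the
  complement of \<open>K\<close> form an open cover, and on each of them smoothness is
  evident.\<close>

lemma vector_field_cutoff:
  assumes c: "c \<in> A" and F: "smooth_on (chart_img c) F"
    and \<beta>: "smooth_fun A \<beta>" and K: "closed K" "K \<subseteq> fst c" "\<And>q. q \<notin> K \<Longrightarrow> \<beta> q = 0"
  shows "vector_field A (\<lambda>q. \<beta> q *\<^sub>R of_chart A c q (F (snd c q)))" (is "vector_field A ?X")
proof (rule vector_fieldI)
  fix q
  show "\<exists>d W. d \<in> A \<and> open W \<and> q \<in> W \<and> W \<subseteq> fst d \<and> smooth_on (snd d ` W) (field_rep A d ?X)"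
  proof (cases "q \<in> fst c")
    case True
    have "smooth_on (chart_img c) (field_rep A c ?X)"
      by (subst smooth_on_cong[OF open_chart_img[OF c], of _ "\<lambda>x. (\<beta> \<circ> chart_inv c) x *\<^sub>R F x"])
        (auto simp: field_rep_scaleR field_rep_of_chart chart_chart_inv c
          intro!: smooth_on_scaleR open_chart_img smooth_fun_on[OF \<beta>, unfolded comp_def] F)
    then show ?thesis using c True open_chart_domain[OF c] by (intro exI[of _ c] exI[of _ "fst c"]) (auto simp: chart_img_def)
  next
    case False
    let ?d = "chart_at A q"
    let ?W = "fst ?d \<inter> - K"
    have d: "?d \<in> A" by (rule chart_at_in)
    have W: "open (- K)" using K by auto
    have "smooth_on (snd ?d ` ?W) (field_rep A ?d ?X)"
      by (subst smooth_on_cong[OF open_chart_image[OF d W], of _ "\<lambda>_. 0"])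
        (auto simp: field_rep_chart[OF d] K(3) linear_0[OF linear_to_chart[OF d]] smooth_on_const)
    then show ?thesis using d open_Int[OF open_chart_domain[OF d] W] in_chart_at[of q] False K
      by (intro exI[of _ ?d] exI[of _ ?W]) auto
  qed
qed

lemma smooth_fun_cutoff:
  assumes c: "c \<in> A" and h: "smooth_on (chart_img c) h"
    and \<beta>: "smooth_fun A \<beta>" and K: "closed K" "K \<subseteq> fst c" "\<And>q. q \<notin> K \<Longrightarrow> \<beta> q = 0"
  shows "smooth_fun A (\<lambda>q. \<beta> q * h (snd c q))" (is "smooth_fun A ?f")
proof (rule smooth_funI)
  fix q
  show "\<exists>d W. d \<in> A \<and> open W \<and> q \<in> W \<and> W \<subseteq> fst d \<and> smooth_on (snd d ` W) (?f \<circ> chart_inv d)"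
  proof (cases "q \<in> fst c")
    case True
    have "smooth_on (chart_img c) (?f \<circ> chart_inv c)"
      by (subst smooth_on_cong[OF open_chart_img[OF c], of _ "\<lambda>x. (\<beta> \<circ> chart_inv c) x * h x"])
        (auto simp: chart_chart_inv c
          intro!: smooth_on_mult open_chart_img smooth_fun_on[OF \<beta>, unfolded comp_def] h)
    then show ?thesis using c True open_chart_domain[OF c] by (intro exI[of _ c] exI[of _ "fst c"]) (auto simp: chart_img_def)
  next
    case False
    let ?d = "chart_at A q"
    let ?W = "fst ?d \<inter> - K"
    have d: "?d \<in> A" by (rule chart_at_in)
    have W: "open (- K)" using K by auto
    have "smooth_on (snd ?d ` ?W) (?f \<circ> chart_inv ?d)"
      by (subst smooth_on_cong[OF open_chart_image[OF d W], of _ "\<lambda>_. 0"])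
        (auto simp: chart_inv_chart[OF d] K(3) smooth_on_const)
    then show ?thesis using d open_Int[OF open_chart_domain[OF d] W] in_chart_at[of q] False K
      by (intro exI[of _ ?d] exI[of _ ?W]) auto
  qed
qed

text \<open>The fields are global, and they agree with constant coordinate vectors on a
  neighbourhood rather than at \<open>p\<close> alone; derivatives at \<open>p\<close> see the whole
  neighbourhood.\<close>

lemma coordinate_fields:
  assumes c: "c \<in> A" and p: "p \<in> fst c"
  obtains E N where "open N" "p \<in> N" "N \<subseteq> fst c" "\<And>v. vector_field A (E v)"
    "\<And>q v. q \<in> N \<Longrightarrow> E v q = of_chart A c q v"
proof -
  obtain \<beta> N K where \<beta>: "smooth_fun A \<beta>" "open N" "p \<in> N" "N \<subseteq> fst c" "closed K" "K \<subseteq> fst c"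
    "\<And>q. q \<in> N \<Longrightarrow> \<beta> q = 1" "\<And>q. q \<notin> K \<Longrightarrow> \<beta> q = 0"
    using bump_function[OF c p] by blast
  show ?thesis
    by (rule that[of N "\<lambda>v q. \<beta> q *\<^sub>R of_chart A c q v"])
      (use \<beta> vector_field_cutoff[OF c smooth_on_const \<beta>(1,5,6,8)] in auto)
qed

lemma extend_ex: "\<exists>X. vector_field A X \<and> X p = v"
proof -
  let ?c = "chart_at A p"
  obtain E N where "p \<in> N" "\<And>v. vector_field A (E v)" "\<And>q v. q \<in> N \<Longrightarrow> E v q = of_chart A ?c q v"
    using coordinate_fields[OF chart_at_in in_chart_at, of p] by metis
  then show ?thesis by (intro exI[of _ "E v"]) (simp add: of_chart_chart_at)
qed

lemma vector_field_extend: "vector_field A (extend A p v)" and extend_at: "extend A p v p = v"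
  using someI_ex[OF extend_ex[of p v]] by (auto simp: extend_def)

lemma field_decomposition:
  assumes X: "vector_field A X" and c: "c \<in> A" and p: "p \<in> fst c"
  obtains \<beta> w E N where "smooth_fun A \<beta>" "\<And>b. smooth_fun A (w b)" "\<And>b. vector_field A (E b)"
    "open N" "p \<in> N" "N \<subseteq> fst c" "\<And>q. q \<in> N \<Longrightarrow> \<beta> q = 1"
    "\<And>q b. q \<in> N \<Longrightarrow> w b q = field_rep A c X (snd c q) \<bullet> b"
    "(\<lambda>q. \<beta> q *\<^sub>R X q) = (\<lambda>q. \<Sum>b\<in>Basis. w b q *\<^sub>R E b q)"
proof -
  obtain \<beta> N K where \<beta>: "smooth_fun A \<beta>" "open N" "p \<in> N" "N \<subseteq> fst c" "closed K" "K \<subseteq> fst c"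
    "\<And>q. q \<in> N \<Longrightarrow> \<beta> q = 1" "\<And>q. q \<notin> K \<Longrightarrow> \<beta> q = 0"
    using bump_function[OF c p] by blast
  define w where "w b q = \<beta> q * (field_rep A c X (snd c q) \<bullet> b)" for b q
  define E where "E b q = \<beta> q *\<^sub>R of_chart A c q b" for b q
  show ?thesis
  \<comment> \<open>The cutoff is squared because one factor makes the coefficients global and the
    other the fields.\<close>
  proof (rule that[of "\<lambda>q. \<beta> q * \<beta> q" w E N])
    show "smooth_fun A (w b)" for b unfolding w_def
      by (rule smooth_fun_cutoff[OF c _ \<beta>(1,5,6,8)])
        (auto intro!: smooth_on_inner vector_field_on X c open_chart_img smooth_on_const)
    show "vector_field A (E b)" for b unfolding E_def
      using vector_field_cutoff[OF c smooth_on_const \<beta>(1,5,6,8)] .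
    show "(\<lambda>q. (\<beta> q * \<beta> q) *\<^sub>R X q) = (\<lambda>q. \<Sum>b\<in>Basis. w b q *\<^sub>R E b q)"
    proof
      fix q
      show "(\<beta> q * \<beta> q) *\<^sub>R X q = (\<Sum>b\<in>Basis. w b q *\<^sub>R E b q)"
      proof (cases "q \<in> fst c")
        case True
        note l = linear_of_chart[OF c True]
        have "X q = of_chart A c q (to_chart A c q (X q))" by (simp add: of_chart_to_chart c True)
        also have "\<dots> = of_chart A c q (\<Sum>b\<in>Basis. (to_chart A c q (X q) \<bullet> b) *\<^sub>R b)"
          by (simp add: euclidean_representation)
        also have "\<dots> = (\<Sum>b\<in>Basis. (field_rep A c X (snd c q) \<bullet> b) *\<^sub>R of_chart A c q b)"
          by (simp add: linear_sum[OF l] linear_scale[OF l] field_rep_chart c True)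
        finally have "X q = \<dots>" .
        then have "(\<beta> q * \<beta> q) *\<^sub>R X q
            = (\<beta> q * \<beta> q) *\<^sub>R (\<Sum>b\<in>Basis. (field_rep A c X (snd c q) \<bullet> b) *\<^sub>R of_chart A c q b)"
          by (rule arg_cong)
        then show ?thesis by (simp add: w_def E_def scaleR_sum_right mult_ac)
      next
        case False
        then have "\<beta> q = 0" using \<beta>(6,8) by blast
        then show ?thesis by (simp add: w_def E_def)
      qed
    qed
  qed (use \<beta> in \<open>auto intro: smooth_fun_mult simp: w_def\<close>)
qed

section \<open>Operators that depend on the value of a field only\<close>

definition tensorial_at :: "'m \<Rightarrow> (('m \<Rightarrow> 'e) \<Rightarrow> 'b::real_vector) \<Rightarrow> bool" where
  "tensorial_at p F \<longleftrightarrow>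
    (\<forall>X Y. vector_field A X \<longrightarrow> vector_field A Y \<longrightarrow> F (\<lambda>q. X q + Y q) = F X + F Y) \<and>
    (\<forall>f X. smooth_fun A f \<longrightarrow> vector_field A X \<longrightarrow> F (\<lambda>q. f q *\<^sub>R X q) = f p *\<^sub>R F X)"

lemma tensorial_at_sum:
  assumes F: "tensorial_at p F" and X: "\<And>i. i \<in> I \<Longrightarrow> vector_field A (X i)"
  shows "F (\<lambda>q. \<Sum>i\<in>I. X i q) = (\<Sum>i\<in>I. F (X i))"
proof -
  have z: "F (\<lambda>q. 0) = 0"
    using F smooth_fun_const[of 0] vector_field_zero unfolding tensorial_at_def by fastforce
  show ?thesis using X
  proof (induction I rule: infinite_finite_induct)
    case (insert i I)
    have add: "F (\<lambda>q. X q + Y q) = F X + F Y" if "vector_field A X" "vector_field A Y" for X Y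
      using F that unfolding tensorial_at_def by blast
    have "F (\<lambda>q. X i q + (\<Sum>i\<in>I. X i q)) = F (X i) + F (\<lambda>q. \<Sum>i\<in>I. X i q)"
      using insert.prems by (intro add vector_field_sum) auto
    then show ?case using insert by simp
  qed (auto simp: z)
qed

text \<open>Tensoriality is assumed for global fields and functions, and locality follows:
  multiplying by \<beta> leaves \<open>F X\<close> unchanged, as \<beta> is 1 at \<open>p\<close>,
  and turns \<open>X\<close> into a global combination whose coefficients vanish at
  \<open>p\<close>.\<close>

lemma tensorial_at_zero:
  assumes F: "tensorial_at p F" and X: "vector_field A X" and X0: "X p = 0"
  shows "F X = 0"
proof -
  let ?c = "chart_at A p"
  obtain \<beta> w E N where d: "smooth_fun A \<beta>" "\<And>b. smooth_fun A (w b)" "\<And>b. vector_field A (E b)"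
    "p \<in> N" "\<And>q. q \<in> N \<Longrightarrow> \<beta> q = 1"
    "\<And>q b. q \<in> N \<Longrightarrow> w b q = field_rep A ?c X (snd ?c q) \<bullet> b"
    "(\<lambda>q. \<beta> q *\<^sub>R X q) = (\<lambda>q. \<Sum>b\<in>Basis. w b q *\<^sub>R E b q)"
    by (rule field_decomposition[OF X chart_at_in in_chart_at]) blast
  have w0: "w b p = 0" for b
    using d(4,6) by (simp add: field_rep_chart chart_at_in in_chart_at to_chart_chart_at X0)
  have "F X = F (\<lambda>q. \<beta> q *\<^sub>R X q)" using F d(1,4,5) X unfolding tensorial_at_def by simp
  also have "\<dots> = (\<Sum>b\<in>Basis. F (\<lambda>q. w b q *\<^sub>R E b q))"
    unfolding d(7) by (rule tensorial_at_sum[OF F]) (intro vector_field_scaleR d)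
  also have "\<dots> = 0" using F d(2,3) w0 unfolding tensorial_at_def by simp
  finally show ?thesis .
qed

lemma tensorial_at_eq:
  assumes F: "tensorial_at p F" and X: "vector_field A X" and Y: "vector_field A Y" and eq: "X p = Y p"
  shows "F X = F Y"
proof -
  have "F (\<lambda>q. Y q + (X q - Y q)) = F Y + F (\<lambda>q. X q - Y q)"
    using F Y vector_field_diff[OF X Y] unfolding tensorial_at_def by blast
  moreover have "F (\<lambda>q. X q - Y q) = 0"
    by (rule tensorial_at_zero[OF F vector_field_diff[OF X Y]]) (simp add: eq)
  ultimately show ?thesis by simp
qed

lemma tensorial_at_extend:
  assumes F: "tensorial_at p F" and X: "vector_field A X"
  shows "F (extend A p (X p)) = F X"
  by (rule tensorial_at_eq[OF F vector_field_extend X]) (rule extend_at)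

lemma tensorial_at_linear:
  assumes F: "tensorial_at p F"
  shows "linear (\<lambda>v. F (extend A p v))"
proof (rule linearI)
  note ve = vector_field_extend[of p]
  fix u v and r :: real
  have "F (extend A p (u + v)) = F (\<lambda>q. extend A p u q + extend A p v q)"
    by (rule tensorial_at_eq[OF F]) (auto intro: ve vector_field_add simp: extend_at)
  then show "F (extend A p (u + v)) = F (extend A p u) + F (extend A p v)"
    using F ve unfolding tensorial_at_def by simp
  have "F (extend A p (r *\<^sub>R v)) = F (\<lambda>q. r *\<^sub>R extend A p v q)"
    by (rule tensorial_at_eq[OF F]) (auto intro: ve vector_field_cmult simp: extend_at)
  then show "F (extend A p (r *\<^sub>R v)) = r *\<^sub>R F (extend A p v)"
    using F ve smooth_fun_const[of r] unfolding tensorial_at_def by simp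
qed

text \<open>Arguments are exchanged one at a time. \<open>F\<close> takes infinite sequences of
  fields, and \<open>loc\<close> takes care of the entries from \<open>n\<close> on.\<close>

lemma tensorial_at_multi_eq:
  fixes F :: "(nat \<Rightarrow> 'm \<Rightarrow> 'e) \<Rightarrow> 'b::real_vector"
  assumes F: "\<And>U i. (\<And>i. vector_field A (U i)) \<Longrightarrow> i < n \<Longrightarrow> tensorial_at p (\<lambda>X. F (U(i := X)))"
    and loc: "\<And>U V. (\<And>i. i < n \<Longrightarrow> U i = V i) \<Longrightarrow> F U = F V"
    and U: "\<And>i. vector_field A (U i)" and V: "\<And>i. vector_field A (V i)"
    and eq: "\<And>i. i < n \<Longrightarrow> U i p = V i p"
  shows "F U = F V"
proof -
  have "j \<le> n \<Longrightarrow> F U = F (\<lambda>i. if i < j then V i else U i)" for j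
  proof (induction j)
    case (Suc j)
    let ?W = "\<lambda>i. if i < j then V i else U i"
    have W: "\<And>i. vector_field A (?W i)" using U V by simp
    have "F U = F ?W" using Suc by simp
    also have "\<dots> = F (?W(j := U j))" by (rule arg_cong[of _ _ F]) auto
    also have "\<dots> = F (?W(j := V j))"
      by (rule tensorial_at_eq[OF F[OF W] U V eq]) (use Suc in auto)
    also have "\<dots> = F (\<lambda>i. if i < Suc j then V i else U i)"
      by (rule arg_cong[of _ _ F]) (auto simp: less_Suc_eq)
    finally show ?case .
  qed simp
  from this[of n] show ?thesis using loc[of "\<lambda>i. if i < n then V i else U i" V] by simp
qed

section \<open>Directional derivatives and the Lie bracket\<close>

lemma dir_deriv_chart:
  assumes c: "c \<in> A" "p \<in> fst c" and f: "smooth_fun A f"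
  shows "dir_deriv A X f p = frechet_derivative (f \<circ> chart_inv c) (at (snd c p)) (to_chart A c p (X p))"
proof -
  let ?d = "chart_at A p"
  have d: "?d \<in> A" "p \<in> fst ?d" by (auto simp: chart_at_in in_chart_at)
  have 1: "((snd c \<circ> chart_inv ?d) has_derivative to_chart A c p) (at (snd ?d p))"
    unfolding to_chart_def by (rule transition_has_derivative) (use c d in auto)
  have 2: "((f \<circ> chart_inv c) has_derivative frechet_derivative (f \<circ> chart_inv c) (at (snd c p)))
      (at ((snd c \<circ> chart_inv ?d) (snd ?d p)))"
    using smooth_on_has_derivative[OF smooth_fun_on[OF f c(1)] chart_in_img[OF c(2)]] d
    by (simp add: chart_inv_chart)
  have "((f \<circ> chart_inv ?d) has_derivative
      (\<lambda>v. frechet_derivative (f \<circ> chart_inv c) (at (snd c p)) (to_chart A c p v))) (at (snd ?d p))"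
    by (rule has_derivative_transform_within_open[OF has_derivative_compose[OF 1 2]
          open_chart_image[OF d(1) open_chart_domain[OF c(1)]]])
      (use c d in \<open>auto simp: chart_inv_chart\<close>)
  then show ?thesis by (simp add: dir_deriv_def frechet_derivative_eq)
qed

text \<open>\<open>dir_deriv\<close> uses a different chart at each point. Here it is described over
  a whole chart, as its smoothness and its further differentiation require.\<close>

lemma dir_deriv_rep:
  assumes c: "c \<in> A" "x \<in> chart_img c" and f: "smooth_fun A f"
  shows "(dir_deriv A X f \<circ> chart_inv c) x = frechet_derivative (f \<circ> chart_inv c) (at x) (field_rep A c X x)"
  using dir_deriv_chart[OF c(1) chart_inv_in[OF c] f] c by (simp add: chart_chart_inv field_rep_def)

lemma smooth_fun_dir_deriv:
  assumes f: "smooth_fun A f" and X: "vector_field A X"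
  shows "smooth_fun A (dir_deriv A X f)"
  unfolding smooth_fun_def
proof
  fix c assume c: "c \<in> A"
  show "smooth_on (chart_img c) (dir_deriv A X f \<circ> chart_inv c)"
    by (rule smooth_on_cong[OF open_chart_img[OF c] dir_deriv_rep[OF c _ f], THEN iffD2], assumption)
      (intro smooth_on_frechet_derivative_field open_chart_img c smooth_fun_on[OF f] vector_field_on[OF X])
qed

lemma dir_deriv_zeroI:
  assumes c: "c \<in> A" and N: "open N" "p \<in> N" "N \<subseteq> fst c" and f: "smooth_fun A f"
    and eq: "\<And>q. q \<in> N \<Longrightarrow> f q = h (snd c q)" and h: "(h has_derivative (\<lambda>v. 0)) (at (snd c p))"
  shows "dir_deriv A X f p = 0"
proof -
  have "((f \<circ> chart_inv c) has_derivative (\<lambda>v. 0)) (at (snd c p))"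
    by (rule has_derivative_transform_within_open[OF h open_chart_image[OF c N(1)]])
      (use N c in \<open>auto simp: eq chart_inv_chart\<close>)
  then show ?thesis using N c by (simp add: dir_deriv_chart[OF c _ f] subset_iff frechet_derivative_eq)
qed

lemma smooth_fun_has_derivative:
  assumes "smooth_fun A f"
  shows "((f \<circ> chart_inv (chart_at A p)) has_derivative
    frechet_derivative (f \<circ> chart_inv (chart_at A p)) (at (snd (chart_at A p) p))) (at (snd (chart_at A p) p))"
  by (rule smooth_on_has_derivative[OF smooth_fun_on[OF assms chart_at_in] chart_in_img[OF in_chart_at]])

lemma dir_deriv_mult:
  assumes f: "smooth_fun A f" and h: "smooth_fun A h"
  shows "dir_deriv A X (\<lambda>q. f q * h q) p = f p * dir_deriv A X h p + dir_deriv A X f p * h p"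
proof -
  have "((\<lambda>x. (f \<circ> chart_inv (chart_at A p)) x * (h \<circ> chart_inv (chart_at A p)) x) has_derivative
    (\<lambda>v. f p * frechet_derivative (h \<circ> chart_inv (chart_at A p)) (at (snd (chart_at A p) p)) v
       + frechet_derivative (f \<circ> chart_inv (chart_at A p)) (at (snd (chart_at A p) p)) v * h p))
    (at (snd (chart_at A p) p))"
    using has_derivative_mult[OF smooth_fun_has_derivative[OF f, of p] smooth_fun_has_derivative[OF h, of p]]
    by (simp add: chart_inv_chart chart_at_in in_chart_at)
  then show ?thesis by (simp add: dir_deriv_def comp_def frechet_derivative_eq)
qed

lemma dir_deriv_add:
  assumes f: "smooth_fun A f" and h: "smooth_fun A h"
  shows "dir_deriv A X (\<lambda>q. f q + h q) p = dir_deriv A X f p + dir_deriv A X h p"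
  using has_derivative_add[OF smooth_fun_has_derivative[OF f, of p] smooth_fun_has_derivative[OF h, of p]]
  by (simp add: dir_deriv_def comp_def frechet_derivative_eq)

lemma dir_deriv_const: "dir_deriv A X (\<lambda>q. a) p = 0"
  by (simp add: dir_deriv_def comp_def)

text \<open>In the chart at \<open>p\<close> each iterated derivative is a term with the derivative
  of the inner field plus a second derivative of \<open>f\<close>; the latter is symmetric in
  \<open>X\<close> and \<open>Y\<close> and drops out.\<close>

lemma lie_bracket_dir_deriv:
  assumes X: "vector_field A X" and Y: "vector_field A Y" and f: "smooth_fun A f"
  shows "dir_deriv A (lie_bracket A X Y) f p
    = dir_deriv A X (dir_deriv A Y f) p - dir_deriv A Y (dir_deriv A X f) p"
proof -
  let ?c = "chart_at A p"
  let ?x = "snd ?c p"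
  let ?f = "f \<circ> chart_inv ?c"
  have c: "?c \<in> A" "p \<in> fst ?c" by (auto simp: chart_at_in in_chart_at)
  note oc = open_chart_img[OF c(1)] and xc = chart_in_img[OF c(2)]
  have sf: "smooth_on (chart_img ?c) ?f" by (rule smooth_fun_on[OF f c(1)])
  have rep: "field_rep A ?c Z ?x = Z p" for Z
    by (simp add: field_rep_chart c to_chart_chart_at)
  have 1: "dir_deriv A Z (dir_deriv A W f) p
      = frechet_derivative ?f (at ?x) (frechet_derivative (field_rep A ?c W) (at ?x) (Z p))
        + frechet_derivative (\<lambda>y. frechet_derivative ?f (at y) (W p)) (at ?x) (Z p)"
    if W: "vector_field A W" for Z W
  proof -
    have "frechet_derivative (dir_deriv A W f \<circ> chart_inv ?c) (at ?x)
        = frechet_derivative (\<lambda>y. frechet_derivative ?f (at y) (field_rep A ?c W y)) (at ?x)"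
      by (rule frechet_derivative_cong_open[OF oc xc dir_deriv_rep[OF c(1) _ f]])
    then show ?thesis
      using frechet_derivative_pairing[OF oc xc sf vector_field_on[OF W c(1)]]
      by (simp add: dir_deriv_def[of A Z] rep)
  qed
  have "Ck_on (Suc (Suc 0)) (chart_img ?c) ?f" using sf unfolding smooth_on_def by blast
  from second_derivative_symmetric[OF this oc xc]
  have 2: "frechet_derivative (\<lambda>y. frechet_derivative ?f (at y) (Y p)) (at ?x) (X p)
    = frechet_derivative (\<lambda>y. frechet_derivative ?f (at y) (X p)) (at ?x) (Y p)" .
  have "linear (frechet_derivative ?f (at ?x))"
    by (rule linear_frechet_derivative[OF smooth_on_differentiable[OF sf xc]])
  then show ?thesis
    by (simp add: 1 X Y 2 dir_deriv_def[of A "lie_bracket A X Y"] lie_bracket_def Let_def linear_diff)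
qed

end

section \<open>Alternating forms\<close>

text \<open>Once entry \<open>i\<close> is gone, the later entry \<open>Suc j\<close> sits at
  position \<open>j\<close>.\<close>

lemma omit_omit: "i \<le> j \<Longrightarrow> omit i (omit (Suc j) v) = omit j (omit i v)"
  by (auto simp: omit_def fun_eq_iff)

lemma omit_upd_self: "omit i (v(i := x)) = omit i v"
  by (auto simp: omit_def fun_eq_iff)

lemma omit_upd_less: "a < i \<Longrightarrow> omit i (v(a := x)) = (omit i v)(a := x)"
  by (auto simp: omit_def fun_eq_iff)

lemma omit_upd_greater: "i \<le> a \<Longrightarrow> omit i (v(Suc a := x)) = (omit i v)(a := x)"
  by (auto simp: omit_def fun_eq_iff)

lemma alternating_form_cong:
  "alternating_form k \<omega> \<Longrightarrow> (\<And>i. i < k \<Longrightarrow> v i = w i) \<Longrightarrow> \<omega> v = \<omega> w"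
  and alternating_form_linear: "alternating_form k \<omega> \<Longrightarrow> i < k \<Longrightarrow> linear (\<lambda>x. \<omega> (v(i := x)))"
  and alternating_form_eq_0: "alternating_form k \<omega> \<Longrightarrow> i < j \<Longrightarrow> j < k \<Longrightarrow> v i = v j \<Longrightarrow> \<omega> v = 0"
  unfolding alternating_form_def by blast+

text \<open>Alternation is left out because endomorphism-valued forms, evaluated on a vector, are
  treated as tensors too, and their last slot has no symmetry with the others.\<close>

definition multilinear_form :: "nat \<Rightarrow> ((nat \<Rightarrow> 'e::real_vector) \<Rightarrow> 'f::real_vector) \<Rightarrow> bool" where
  "multilinear_form n T \<longleftrightarrow>
     (\<forall>v w. (\<forall>i<n. v i = w i) \<longrightarrow> T v = T w) \<and> (\<forall>v. \<forall>i<n. linear (\<lambda>x. T (v(i := x))))"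

lemma alternating_form_multilinear: "alternating_form n T \<Longrightarrow> multilinear_form n T"
  unfolding alternating_form_def multilinear_form_def by blast

lemma multilinear_form_cong: "multilinear_form n T \<Longrightarrow> (\<And>i. i < n \<Longrightarrow> v i = w i) \<Longrightarrow> T v = T w"
  and multilinear_form_linear: "multilinear_form n T \<Longrightarrow> i < n \<Longrightarrow> linear (\<lambda>x. T (v(i := x)))"
  unfolding multilinear_form_def by blast+

text \<open>Polarisation at \<open>x + y\<close>, with vanishing demanded for this one pair of
  slots; tensors that alternate in only some slots are covered.\<close>

lemma multilinear_form_swap:
  assumes T: "multilinear_form n T" and ij: "i \<noteq> j" "i < n" "j < n"
    and z: "\<And>v. v i = v j \<Longrightarrow> T v = 0"
  shows "T (v(i := x, j := y)) = - T (v(i := y, j := x))"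
proof -
  define h where "h a b = T (v(i := a, j := b))" for a b
  have l1: "linear (\<lambda>a. h a b)" for b
    using multilinear_form_linear[OF T ij(2), of "v(j := b)"] ij unfolding h_def by (simp add: fun_upd_twist)
  have l2: "linear (h a)" for a
    unfolding h_def by (rule multilinear_form_linear[OF T ij(3)])
  have z: "h a a = 0" for a
    unfolding h_def using ij by (intro z) auto
  have "h (x + y) (x + y) = h x x + h x y + h y x + h y y"
    by (simp add: linear_add[OF l1] linear_add[OF l2])
  then have "h x y + h y x = 0" by (simp add: z)
  then show ?thesis by (simp add: h_def eq_neg_iff_add_eq_0)
qed

lemma alternating_form_swap:
  assumes "alternating_form k \<omega>" "i < j" "j < k"
  shows "\<omega> (v(i := x, j := y)) = - \<omega> (v(i := y, j := x))"
  using assms by (intro multilinear_form_swap[OF alternating_form_multilinear])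
    (auto intro: alternating_form_eq_0)

text \<open>The exterior derivative has the bracket in front, a correction term has its new vector
  in the slot of the differentiated field; passing between them takes \<open>j\<close> adjacent
  swaps.\<close>

lemma alternating_form_to_front:
  assumes \<omega>: "alternating_form k \<omega>"
  shows "j < k \<Longrightarrow> \<omega> (case_nat x (omit j w)) = (-1) ^ j *\<^sub>R \<omega> (w(j := x))"
proof (induction j arbitrary: w)
  case 0
  have "case_nat x (omit 0 w) = w(0 := x)" by (auto simp: omit_def fun_eq_iff split: nat.splits)
  then show ?case by simp
next
  case (Suc j)
  let ?w = "w(j := w (Suc j), Suc j := w j)"
  have e: "case_nat x (omit (Suc j) w) = case_nat x (omit j ?w)"
    by (auto simp: omit_def fun_eq_iff less_Suc_eq split: nat.splits)
  have "\<omega> (case_nat x (omit (Suc j) w)) = (-1) ^ j *\<^sub>R \<omega> (?w(j := x))"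
    unfolding e by (rule Suc.IH) (use Suc.prems in simp)
  also have "?w(j := x) = w(j := x, Suc j := w j)" by (auto simp: fun_eq_iff)
  also have "\<omega> (w(j := x, Suc j := w j)) = - \<omega> (w(j := w j, Suc j := x))"
    by (rule alternating_form_swap[OF \<omega>]) (use Suc.prems in auto)
  also have "w(j := w j, Suc j := x) = w(Suc j := x)" by (simp only: fun_upd_triv)
  finally show ?case by simp
qed

lemma sum_triangle_swap:
  fixes f :: "nat \<Rightarrow> nat \<Rightarrow> 'b::comm_monoid_add"
  shows "(\<Sum>j\<le>k. \<Sum>i<j. f i j) = (\<Sum>i\<le>k. \<Sum>j\<in>{i<..k}. f i j)"
proof -
  have "(\<Sum>j\<le>k. \<Sum>i<j. f i j) = (\<Sum>(j, i)\<in>(SIGMA j:{..k}. {..<j}). f i j)"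
    by (simp add: sum.Sigma)
  also have "\<dots> = (\<Sum>(i, j)\<in>(SIGMA i:{..k}. {i<..k}). f i j)"
    by (rule sum.reindex_bij_witness[of _ "\<lambda>(i, j). (j, i)" "\<lambda>(j, i). (i, j)"]) auto
  also have "\<dots> = (\<Sum>i\<le>k. \<Sum>j\<in>{i<..k}. f i j)" by (simp add: sum.Sigma)
  finally show ?thesis .
qed

text \<open>This is how torsion-freeness turns the bracket terms of the exterior derivative into the
  correction terms of the covariant derivative; \<open>M i j\<close> stands for the derivative of the
  \<open>j\<close>-th field in the direction of the \<open>i\<close>-th one.\<close>

lemma alternating_form_bracket_sum:
  assumes \<omega>: "alternating_form k \<omega>"
  shows "(\<Sum>i\<le>k. (-1) ^ i *\<^sub>R (\<Sum>j<k. \<omega> ((omit i v)(j := omit i (M i) j))))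
    = - (\<Sum>j\<le>k. \<Sum>i<j. (-1) ^ (i + j) *\<^sub>R \<omega> (case_nat (M i j - M j i) (omit i (omit j v))))"
proof -
  define F where "F x i j = (-1) ^ (i + j) *\<^sub>R \<omega> (case_nat x (omit i (omit j v)))" for x i j
  have inner: "(-1) ^ i *\<^sub>R (\<Sum>j<k. \<omega> ((omit i v)(j := omit i (M i) j)))
    = (\<Sum>j<i. F (M i j) j i) - (\<Sum>j\<in>{i<..k}. F (M i j) i j)" if i: "i \<le> k" for i
  proof -
    have a: "(-1) ^ i *\<^sub>R \<omega> ((omit i v)(j := omit i (M i) j)) = F (M i j) j i" if "j < i" for j
    proof -
      have "\<omega> (case_nat (M i j) (omit j (omit i v))) = (-1) ^ j *\<^sub>R \<omega> ((omit i v)(j := M i j))"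
        by (rule alternating_form_to_front[OF \<omega>]) (use that i in auto)
      moreover have "omit i (M i) j = M i j" using that by (simp add: omit_def)
      ultimately show ?thesis by (simp add: F_def power_add mult.assoc flip: power_mult_distrib)
    qed
    \<comment> \<open>From \<open>i\<close> on, slot \<open>j\<close> of \<open>omit i v\<close>
      holds entry \<open>Suc j\<close>. This shift by one is the source of the opposite sign
      compared with \<open>a\<close>.\<close>
    have b: "(-1) ^ i *\<^sub>R \<omega> ((omit i v)(j := omit i (M i) j)) = - F (M i (Suc j)) i (Suc j)"
      if "i \<le> j" "j < k" for j
    proof -
      have "\<omega> (case_nat (M i (Suc j)) (omit j (omit i v))) = (-1) ^ j *\<^sub>R \<omega> ((omit i v)(j := M i (Suc j)))"
        by (rule alternating_form_to_front[OF \<omega>]) (use that in auto)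
      moreover have "omit i (M i) j = M i (Suc j)" using that by (simp add: omit_def)
      ultimately show ?thesis
        by (simp add: F_def omit_omit that power_add mult.assoc flip: power_mult_distrib)
    qed
    have "(-1) ^ i *\<^sub>R (\<Sum>j<k. \<omega> ((omit i v)(j := omit i (M i) j)))
      = (\<Sum>j\<in>{..<i} \<union> {i..<k}. (-1) ^ i *\<^sub>R \<omega> ((omit i v)(j := omit i (M i) j)))"
      using i by (simp add: scaleR_sum_right ivl_disj_un)
    also have "\<dots> = (\<Sum>j<i. F (M i j) j i) + (\<Sum>j\<in>{i..<k}. - F (M i (Suc j)) i (Suc j))"
      by (subst sum.union_disjoint) (auto simp: a b)
    also have "(\<Sum>j\<in>{i..<k}. - F (M i (Suc j)) i (Suc j)) = (\<Sum>j\<in>{i<..k}. - F (M i j) i j)"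
      by (rule sum.reindex_bij_witness[of _ "\<lambda>j. j - 1" Suc]) auto
    finally show ?thesis by (simp only: sum_negf add_uminus_conv_diff)
  qed
  have lin: "F (x - y) i j = F x i j - F y i j" if "i < j" "j \<le> k" for x y i j
  proof -
    have l: "linear (\<lambda>z. \<omega> (case_nat z w))" for w
    proof -
      have "case_nat z w = (case_nat 0 w)(0 := z)" for z
        by (auto simp: fun_eq_iff split: nat.splits)
      then have "(\<lambda>z. \<omega> (case_nat z w)) = (\<lambda>z. \<omega> ((case_nat 0 w)(0 := z)))" by metis
      then show ?thesis using alternating_form_linear[OF \<omega>, of 0 "case_nat 0 w"] that by (simp only:)
    qed
    show ?thesis unfolding F_def linear_diff[OF l] by (rule scaleR_diff_right)
  qed
  have "(\<Sum>i\<le>k. (-1) ^ i *\<^sub>R (\<Sum>j<k. \<omega> ((omit i v)(j := omit i (M i) j))))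
    = (\<Sum>i\<le>k. \<Sum>j<i. F (M i j) j i) - (\<Sum>i\<le>k. \<Sum>j\<in>{i<..k}. F (M i j) i j)"
    by (simp add: inner sum_subtractf)
  \<comment> \<open>Both double sums now run over pairs \<open>i < j\<close> and differ only in the
    first argument of \<open>F\<close>, so linearity collects them into the difference.\<close>
  also have "\<dots> = (\<Sum>j\<le>k. \<Sum>i<j. F (M j i) i j) - (\<Sum>j\<le>k. \<Sum>i<j. F (M i j) i j)"
    by (simp add: sum_triangle_swap)
  also have "\<dots> = - (\<Sum>j\<le>k. \<Sum>i<j. F (M i j - M j i) i j)"
    by (simp add: lin sum_subtractf)
  finally show ?thesis by (simp add: F_def)
qed

text \<open>The exterior derivative has this shape, \<open>N x\<close> being the covariant
  derivative in direction \<open>x\<close>. If two entries agree, every term that omits neither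
  still sees a repeated entry, and the two remaining terms cancel.\<close>

lemma alternating_form_wedge:
  assumes N: "\<And>x. alternating_form k (N x)" and lin: "\<And>v. linear (\<lambda>x. N x v)"
  shows "alternating_form (Suc k) (\<lambda>v. \<Sum>i\<le>k. (-1) ^ i *\<^sub>R N (v i) (omit i v))"
  unfolding alternating_form_def
proof (intro conjI allI impI)
  fix v w :: "nat \<Rightarrow> 'a" assume eq: "\<forall>i<Suc k. v i = w i"
  have "N (v i) (omit i v) = N (w i) (omit i w)" if "i \<le> k" for i
  proof -
    have "N (w i) (omit i v) = N (w i) (omit i w)"
      by (rule alternating_form_cong[OF N]) (use eq in \<open>auto simp: omit_def\<close>)
    then show ?thesis using eq that by simp
  qed
  then show "(\<Sum>i\<le>k. (-1) ^ i *\<^sub>R N (v i) (omit i v)) = (\<Sum>i\<le>k. (-1) ^ i *\<^sub>R N (w i) (omit i w))"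
    by simp
next
  fix v :: "nat \<Rightarrow> 'a" and a assume a: "a < Suc k"
  have "linear (\<lambda>x. N ((v(a := x)) i) (omit i (v(a := x))))" if "i \<le> k" for i
  proof (cases a i rule: linorder_cases)
    case less
    then show ?thesis using that by (simp add: omit_upd_less alternating_form_linear[OF N])
  next
    case equal
    then show ?thesis by (simp add: omit_upd_self lin)
  next
    case greater
    then obtain b where b: "a = Suc b" "i \<le> b" by (cases a) auto
    then show ?thesis using a by (simp add: omit_upd_greater alternating_form_linear[OF N])
  qed
  then show "linear (\<lambda>x. \<Sum>i\<le>k. (-1) ^ i *\<^sub>R N ((v(a := x)) i) (omit i (v(a := x))))"
    by (intro linear_compose_sum linear_compose_scale_right ballI) auto
next
  fix v :: "nat \<Rightarrow> 'a" and a b assume "a < b \<and> b < Suc k \<and> v a = v b"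
  then have ab: "a < b" "b \<le> k" and eq: "v a = v b" by auto
  obtain m where m: "b = Suc m" "a \<le> m" using ab by (cases b) auto
  let ?f = "\<lambda>i. (-1) ^ i *\<^sub>R N (v i) (omit i v)"
  have zero: "?f i = 0" if i: "i \<le> k" "i \<noteq> a" "i \<noteq> b" for i
  proof -
    \<comment> \<open>The positions of the equal entries after entry \<open>i\<close> has been
      removed.\<close>
    define a' where "a' = (if a < i then a else a - 1)"
    define b' where "b' = (if b < i then b else b - 1)"
    have "a' < b'" "b' < k" "omit i v a' = omit i v b'"
      using ab eq i by (auto simp: a'_def b'_def omit_def)
    then show ?thesis using alternating_form_eq_0[OF N] by simp
  qed
  \<comment> \<open>Both surviving terms are compared with the sequence that has the common vector
    in front of \<open>v\<close> without entries \<open>a\<close> and \<open>b\<close>. This takes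
    \<open>a\<close> moves in one term and \<open>m = b - 1\<close> in the other, which makes the
    total signs opposite.\<close>
  have "N (v a) (case_nat (v a) (omit a (omit b v))) = (-1) ^ a *\<^sub>R N (v a) ((omit b v)(a := v a))"
    by (rule alternating_form_to_front[OF N]) (use ab in auto)
  moreover have "(omit b v)(a := v a) = omit b v" using ab by (auto simp: omit_def fun_eq_iff)
  ultimately have 1: "N (v a) (case_nat (v a) (omit a (omit b v))) = (-1) ^ a *\<^sub>R N (v a) (omit b v)" by simp
  have "N (v a) (case_nat (v a) (omit m (omit a v))) = (-1) ^ m *\<^sub>R N (v a) ((omit a v)(m := v a))"
    by (rule alternating_form_to_front[OF N]) (use ab m in auto)
  moreover have "(omit a v)(m := v a) = omit a v" using m eq by (auto simp: omit_def fun_eq_iff)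
  ultimately have 2: "N (v a) (case_nat (v a) (omit a (omit b v))) = (-1) ^ m *\<^sub>R N (v a) (omit a v)"
    using m by (simp add: omit_omit)
  have sq: "((-1::real) ^ n) * (-1) ^ n = 1" for n by (simp flip: power_mult_distrib)
  have e1: "N (v a) (omit b v) = (-1) ^ a *\<^sub>R N (v a) (case_nat (v a) (omit a (omit b v)))"
    unfolding 1 by (simp add: sq)
  have e2: "N (v a) (omit a v) = (-1) ^ m *\<^sub>R N (v a) (case_nat (v a) (omit a (omit b v)))"
    unfolding 2 by (simp add: sq)
  have "(\<Sum>i\<le>k. ?f i) = (\<Sum>i\<in>{a, b}. ?f i)"
    by (rule sum.mono_neutral_right) (use ab zero in auto)
  also have "\<dots> = ?f a + ?f b" using ab by simp
  also have "\<dots> = 0" unfolding eq[symmetric] e1 e2 by (simp add: m)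
  finally show "(\<Sum>i\<le>k. ?f i) = 0" .
qed

lemma alternating_form_blinfunI:
  fixes \<Omega> :: "(nat \<Rightarrow> 'e::real_vector) \<Rightarrow> ('a::real_normed_vector \<Rightarrow>\<^sub>L 'b::real_normed_vector)"
  assumes "\<And>w. alternating_form k (\<lambda>v. blinfun_apply (\<Omega> v) w)"
  shows "alternating_form k \<Omega>"
  unfolding alternating_form_def
proof (intro conjI allI impI)
  fix v w :: "nat \<Rightarrow> 'e" assume "\<forall>i<k. v i = w i"
  then show "\<Omega> v = \<Omega> w" using alternating_form_cong[OF assms] by (intro blinfun_eqI) blast
next
  fix v :: "nat \<Rightarrow> 'e" and i assume "i < k"
  then have l: "linear (\<lambda>x. blinfun_apply (\<Omega> (v(i := x))) w)" for w
    by (rule alternating_form_linear[OF assms])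
  show "linear (\<lambda>x. \<Omega> (v(i := x)))"
    by (rule linearI; rule blinfun_eqI)
      (simp_all add: linear_add[OF l] linear_scale[OF l] blinfun.add_left blinfun.scaleR_left)
next
  fix v :: "nat \<Rightarrow> 'e" and i j assume "i < j \<and> j < k \<and> v i = v j"
  then show "\<Omega> v = 0" using alternating_form_eq_0[OF assms] by (intro blinfun_eqI) auto
qed

lemma alternating_form_blinfunD:
  fixes \<Omega> :: "(nat \<Rightarrow> 'e::real_vector) \<Rightarrow> ('a::real_normed_vector \<Rightarrow>\<^sub>L 'b::real_normed_vector)"
  assumes "alternating_form k \<Omega>"
  shows "alternating_form k (\<lambda>v. blinfun_apply (\<Omega> v) w)"
  unfolding alternating_form_def
proof (intro conjI allI impI)
  fix u v :: "nat \<Rightarrow> 'e" assume "\<forall>i<k. u i = v i"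
  then show "\<Omega> u w = \<Omega> v w" using alternating_form_cong[OF assms] by metis
next
  fix v :: "nat \<Rightarrow> 'e" and i assume "i < k"
  then have l: "linear (\<lambda>x. \<Omega> (v(i := x)))" by (rule alternating_form_linear[OF assms])
  show "linear (\<lambda>x. blinfun_apply (\<Omega> (v(i := x))) w)"
    by (rule linearI) (simp_all add: linear_add[OF l] linear_scale[OF l] blinfun.add_left blinfun.scaleR_left)
next
  fix v :: "nat \<Rightarrow> 'e" and i j assume "i < j \<and> j < k \<and> v i = v j"
  then show "\<Omega> v w = 0" using alternating_form_eq_0[OF assms] by auto
qed

text \<open>An endomorphism-valued \<open>k\<close>-form is treated as a tensor with \<open>k + 1\<close> slots: the
  endomorphism is applied to entry \<open>k\<close> of the sequence, which the form itself ignores.\<close>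

lemma multilinear_form_apply:
  fixes \<Omega> :: "(nat \<Rightarrow> 'e::real_normed_vector) \<Rightarrow> ('e \<Rightarrow>\<^sub>L 'b::real_normed_vector)"
  assumes "alternating_form k \<Omega>"
  shows "multilinear_form (Suc k) (\<lambda>v. blinfun_apply (\<Omega> v) (v k))"
  unfolding multilinear_form_def
proof (intro conjI allI impI)
  fix v w :: "nat \<Rightarrow> 'e" assume "\<forall>i<Suc k. v i = w i"
  then show "\<Omega> v (v k) = \<Omega> w (w k)" using alternating_form_cong[OF assms, of v w] by simp
next
  fix v :: "nat \<Rightarrow> 'e" and i assume i: "i < Suc k"
  show "linear (\<lambda>x. \<Omega> (v(i := x)) ((v(i := x)) k))"
  proof (cases "i = k")
    case True
    have "\<Omega> (v(k := x)) = \<Omega> v" for x by (rule alternating_form_cong[OF assms]) auto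
    then show ?thesis using True by (simp add: blinfun.bounded_linear_right bounded_linear.linear)
  next
    case False
    then show ?thesis using i alternating_form_linear[OF alternating_form_blinfunD[OF assms]] by simp
  qed
qed

context smooth_manifold
begin

section \<open>Smoothness of forms expressed by global vector fields\<close>

lemma smooth_on_coordinates:
  assumes T: "\<And>U. (\<And>i. vector_field A (U i)) \<Longrightarrow> vector_field A (\<lambda>q. T q (\<lambda>i::nat. U i q))"
    and c: "c \<in> A"
  shows "smooth_on (chart_img c) (field_rep A c (\<lambda>q. T q (\<lambda>i. of_chart A c q (u i))))"
proof (rule smooth_on_local)
  fix x assume x: "x \<in> chart_img c"
  \<comment> \<open>Constant coordinate vectors do not form global fields, so the hypothesis is
    applied to global fields that agree with them near the point.\<close>
  obtain E N where N: "open N" "chart_inv c x \<in> N" "N \<subseteq> fst c" and E: "\<And>v. vector_field A (E v)"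
    and EN: "\<And>q v. q \<in> N \<Longrightarrow> E v q = of_chart A c q v"
    by (rule coordinate_fields[OF c chart_inv_in[OF c x]], rule that)
  let ?S = "snd c ` (fst c \<inter> N)"
  have S: "open ?S" by (rule open_chart_image[OF c N(1)])
  have "smooth_on (chart_img c) (field_rep A c (\<lambda>q. T q (\<lambda>i. E (u i) q)))"
    by (intro vector_field_on T E c)
  then have a: "smooth_on ?S (field_rep A c (\<lambda>q. T q (\<lambda>i. E (u i) q)))"
    by (rule smooth_on_subset) (auto simp: chart_img_def)
  have e: "field_rep A c (\<lambda>q. T q (\<lambda>i. E (u i) q)) y = field_rep A c (\<lambda>q. T q (\<lambda>i. of_chart A c q (u i))) y"
    if "y \<in> ?S" for y
    using that by (auto simp: field_rep_chart[OF c] EN)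
  have "smooth_on ?S (field_rep A c (\<lambda>q. T q (\<lambda>i. of_chart A c q (u i))))"
    by (rule smooth_on_cong[OF S e, THEN iffD1, OF _ a])
  then show "\<exists>S. open S \<and> x \<in> S \<and> smooth_on S (field_rep A c (\<lambda>q. T q (\<lambda>i. of_chart A c q (u i))))"
    using S x N chart_image_iff[OF c] by blast
qed

text \<open>The converse of \<open>smooth_on_coordinates\<close>: the field in one slot after
  another is expanded in coordinates, which leaves values on constant coordinate vectors.\<close>

lemma vector_field_multilinear:
  assumes T: "\<And>q. multilinear_form n (T q)"
    and sm: "\<And>c u. c \<in> A \<Longrightarrow> smooth_on (chart_img c) (field_rep A c (\<lambda>q. T q (\<lambda>i. of_chart A c q (u i))))"
    and U: "\<And>i. vector_field A (U i)"
  shows "vector_field A (\<lambda>q. T q (\<lambda>i. U i q))"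
  unfolding vector_field_def
proof
  fix c assume c: "c \<in> A"
  \<comment> \<open>Slots below \<open>j\<close> hold fields, the others constant coordinate
    vectors. The induction lets \<open>u\<close> vary because expanding slot \<open>j\<close> puts
    basis vectors there.\<close>
  let ?V = "\<lambda>j u q i. if i < j then U i q else of_chart A c q (u i)"
  have *: "j \<le> n \<Longrightarrow> smooth_on (chart_img c) (field_rep A c (\<lambda>q. T q (?V j u q)))" for j u
  proof (induction j arbitrary: u)
    case (Suc j)
    have eq: "field_rep A c (\<lambda>q. T q (?V (Suc j) u q)) x
      = (\<Sum>b\<in>Basis. (field_rep A c (U j) x \<bullet> b) *\<^sub>R field_rep A c (\<lambda>q. T q (?V j (u(j := b)) q)) x)"
      if x: "x \<in> chart_img c" for x
    proof -
      let ?q = "chart_inv c x"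
      have q: "?q \<in> fst c" by (rule chart_inv_in[OF c x])
      note lo = linear_of_chart[OF c q] and lt = linear_to_chart[OF c q]
      have upd: "(?V j u ?q)(j := of_chart A c ?q b) = ?V j (u(j := b)) ?q" for b
        by (auto simp: fun_eq_iff)
      have lT: "linear (\<lambda>y. T ?q ((?V j u ?q)(j := y)))"
        by (rule multilinear_form_linear[OF T]) (use Suc in auto)
      have "U j ?q = of_chart A c ?q (field_rep A c (U j) x)"
        by (simp add: field_rep_def of_chart_to_chart c q)
      also have "\<dots> = of_chart A c ?q (\<Sum>b\<in>Basis. (field_rep A c (U j) x \<bullet> b) *\<^sub>R b)"
        by (simp add: euclidean_representation)
      also have "\<dots> = (\<Sum>b\<in>Basis. (field_rep A c (U j) x \<bullet> b) *\<^sub>R of_chart A c ?q b)"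
        by (simp add: linear_sum[OF lo] linear_scale[OF lo])
      finally have Uj: "U j ?q = \<dots>" .
      have "?V (Suc j) u ?q = (?V j u ?q)(j := U j ?q)" by (auto simp: fun_eq_iff less_Suc_eq)
      then have "T ?q (?V (Suc j) u ?q) = T ?q ((?V j u ?q)(j := \<Sum>b\<in>Basis. (field_rep A c (U j) x \<bullet> b) *\<^sub>R of_chart A c ?q b))"
        using Uj by simp
      also have "\<dots> = (\<Sum>b\<in>Basis. (field_rep A c (U j) x \<bullet> b) *\<^sub>R T ?q ((?V j u ?q)(j := of_chart A c ?q b)))"
        by (simp add: linear_sum[OF lT] linear_scale[OF lT])
      also have "\<dots> = (\<Sum>b\<in>Basis. (field_rep A c (U j) x \<bullet> b) *\<^sub>R T ?q (?V j (u(j := b)) ?q))"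
        by (simp only: upd)
      finally show ?thesis
        by (simp only: field_rep_def linear_sum[OF lt] linear_scale[OF lt])
    qed
    have "smooth_on (chart_img c) (\<lambda>x. \<Sum>b\<in>Basis. (field_rep A c (U j) x \<bullet> b) *\<^sub>R field_rep A c (\<lambda>q. T q (?V j (u(j := b)) q)) x)"
      using Suc by (intro smooth_on_sum smooth_on_scaleR smooth_on_inner open_chart_img c
          vector_field_on U smooth_on_const Suc.IH) auto
    then show ?case by (subst smooth_on_cong[OF open_chart_img[OF c] eq])
  qed (use sm c in simp)
  have "T q (?V n (\<lambda>_. 0) q) = T q (\<lambda>i. U i q)" for q
    by (rule multilinear_form_cong[OF T]) auto
  then show "smooth_on (chart_img c) (field_rep A c (\<lambda>q. T q (\<lambda>i. U i q)))"
    using *[OF order_refl, of "\<lambda>_. 0"] by (simp only:)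
qed

text \<open>With this description, derivatives and sums of forms can be shown smooth without
  charts.\<close>

lemma Omega_TM_iff:
  "\<psi> \<in> Omega_TM A k \<longleftrightarrow> (\<forall>p. alternating_form k (\<psi> p)) \<and>
    (\<forall>U. (\<forall>i. vector_field A (U i)) \<longrightarrow> vector_field A (\<lambda>q. \<psi> q (\<lambda>i. U i q)))"
proof -
  have "vector_field A (\<lambda>q. \<psi> q (\<lambda>i. U i q))"
    if "\<psi> \<in> Omega_TM A k" "\<forall>i. vector_field A (U i)" for U
    by (rule vector_field_multilinear[of k])
      (use that alternating_form_multilinear in \<open>auto simp: Omega_TM_def form_rep_def\<close>)
  then show ?thesis
    using smooth_on_coordinates[of \<psi>] by (auto simp: Omega_TM_def form_rep_def)
qed

lemma Omega_o_iff:
  "\<Psi> \<in> Omega_o A g k \<longleftrightarrow> (\<forall>p. alternating_form k (\<Psi> p)) \<and>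
    (\<forall>p v x y. g p (blinfun_apply (\<Psi> p v) x) y = - g p x (blinfun_apply (\<Psi> p v) y)) \<and>
    (\<forall>U Y. (\<forall>i. vector_field A (U i)) \<longrightarrow> vector_field A Y \<longrightarrow>
      vector_field A (\<lambda>q. blinfun_apply (\<Psi> q (\<lambda>i. U i q)) (Y q)))"
proof (cases "\<forall>p. alternating_form k (\<Psi> p)")
  case True
  then have alt: "alternating_form k (\<Psi> p)" for p by blast
  let ?T = "\<lambda>q v. blinfun_apply (\<Psi> q v) (v k)"
  have upd: "\<Psi> q (\<lambda>i. h q ((u(k := y)) i)) = \<Psi> q (\<lambda>i. h q (u i))" for q h u y
    by (rule alternating_form_cong[OF alt]) auto
  have 1: "vector_field A (\<lambda>q. \<Psi> q (\<lambda>i. U i q) (Y q))"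
    if "\<forall>c\<in>A. \<forall>u y. smooth_on (chart_img c) (field_rep A c (\<lambda>q.
        \<Psi> q (\<lambda>i. of_chart A c q (u i)) (of_chart A c q y)))"
      "\<forall>i. vector_field A (U i)" "vector_field A Y" for U Y
  proof -
    have "vector_field A (\<lambda>q. ?T q (\<lambda>i. (U(k := Y)) i q))"
      by (rule vector_field_multilinear[of "Suc k"]) (use that multilinear_form_apply[OF alt] in auto)
    then show ?thesis using upd[of _ "\<lambda>q X. X q" U Y] by simp
  qed
  have 2: "smooth_on (chart_img c) (field_rep A c (\<lambda>q. \<Psi> q (\<lambda>i. of_chart A c q (u i)) (of_chart A c q y)))"
    if "\<forall>U Y. (\<forall>i. vector_field A (U i)) \<longrightarrow> vector_field A Y \<longrightarrow>
      vector_field A (\<lambda>q. blinfun_apply (\<Psi> q (\<lambda>i. U i q)) (Y q))" "c \<in> A" for c u y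
  proof -
    have "smooth_on (chart_img c) (field_rep A c (\<lambda>q. ?T q (\<lambda>i. of_chart A c q ((u(k := y)) i))))"
      by (rule smooth_on_coordinates) (use that in auto)
    then show ?thesis using upd[of _ "\<lambda>q v. of_chart A c q v" u y] by simp
  qed
  show ?thesis using 1 2 by (auto simp: Omega_o_def)
next
  case False
  then show ?thesis unfolding Omega_o_def by blast
qed

end

section \<open>The Levi-Civita connection and its curvature\<close>

locale riemannian_manifold = smooth_manifold A
  for A :: "('m::t2_space, 'e::euclidean_space) chart set" +
  fixes g :: "'m \<Rightarrow> 'e \<Rightarrow> 'e \<Rightarrow> real" and D :: "('m, 'e) connection"
  assumes metric: "riemannian_metric A g" and connection: "levi_civita A g D"
begin

section \<open>Rules for the metric and the connection\<close>

lemma g_bilinear: "bilinear (g p)" and g_sym: "g p u v = g p v u" and g_pos: "u \<noteq> 0 \<Longrightarrow> g p u u > 0"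
  using metric by (auto simp: riemannian_metric_def)

lemmas g_add_left = bilinear_ladd[OF g_bilinear] and g_add_right = bilinear_radd[OF g_bilinear]
  and g_scale_left = bilinear_lmul[OF g_bilinear] and g_scale_right = bilinear_rmul[OF g_bilinear]
  and g_diff_left = bilinear_lsub[OF g_bilinear] and g_diff_right = bilinear_rsub[OF g_bilinear]
  and g_minus_left = bilinear_lneg[OF g_bilinear]
  and g_zero_left = bilinear_lzero[OF g_bilinear] and g_zero_right = bilinear_rzero[OF g_bilinear]

text \<open>The standard way below to prove identities between endomorphisms:
  \<open>skew_part\<close> and \<open>koszul\<close> are accessible only through inner
  products.\<close>

lemma g_cancel: "(\<And>z. g p w z = g p w' z) \<Longrightarrow> w = w'"
  using g_pos[of "w - w'" p] g_diff_left[of p w w' "w - w'"] by force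

lemma affine: "affine_connection A D"
  using connection by (simp add: levi_civita_def)

lemma D_field: "vector_field A X \<Longrightarrow> vector_field A Y \<Longrightarrow> vector_field A (D X Y)"
  and D_add_left: "vector_field A X \<Longrightarrow> vector_field A X' \<Longrightarrow> vector_field A Y \<Longrightarrow>
    D (\<lambda>q. X q + X' q) Y p = D X Y p + D X' Y p"
  and D_scale_left: "smooth_fun A f \<Longrightarrow> vector_field A X \<Longrightarrow> vector_field A Y \<Longrightarrow>
    D (\<lambda>q. f q *\<^sub>R X q) Y p = f p *\<^sub>R D X Y p"
  and D_add_right: "vector_field A X \<Longrightarrow> vector_field A Y \<Longrightarrow> vector_field A Y' \<Longrightarrow>
    D X (\<lambda>q. Y q + Y' q) p = D X Y p + D X Y' p"
  and D_leibniz: "smooth_fun A f \<Longrightarrow> vector_field A X \<Longrightarrow> vector_field A Y \<Longrightarrow>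
    D X (\<lambda>q. f q *\<^sub>R Y q) p = dir_deriv A X f p *\<^sub>R Y p + f p *\<^sub>R D X Y p"
  using affine unfolding affine_connection_def by blast+

lemma D_metric:
  "vector_field A X \<Longrightarrow> vector_field A Y \<Longrightarrow> vector_field A Z \<Longrightarrow>
    dir_deriv A X (\<lambda>q. g q (Y q) (Z q)) p = g p (D X Y p) (Z p) + g p (Y p) (D X Z p)"
  and D_torsion_free:
  "vector_field A X \<Longrightarrow> vector_field A Y \<Longrightarrow> lie_bracket A X Y = (\<lambda>p. D X Y p - D Y X p)"
  using connection unfolding levi_civita_def by (blast, auto)

lemma D_tensorial: "vector_field A Y \<Longrightarrow> tensorial_at p (\<lambda>X. D X Y p)"
  unfolding tensorial_at_def using D_add_left D_scale_left by blast

lemma D_cmult_right: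
  "vector_field A X \<Longrightarrow> vector_field A Y \<Longrightarrow> D X (\<lambda>q. a *\<^sub>R Y q) p = a *\<^sub>R D X Y p"
  using D_leibniz[OF smooth_fun_const[of a]] by (simp add: dir_deriv_const)

lemma D_zero_right: "vector_field A X \<Longrightarrow> D X (\<lambda>q. 0) p = 0"
  using D_cmult_right[OF _ vector_field_zero, of X 0] by simp

lemma D_minus_right:
  "vector_field A X \<Longrightarrow> vector_field A Y \<Longrightarrow> D X (\<lambda>q. - Y q) p = - D X Y p"
  using D_cmult_right[of X Y "-1"] by simp

lemma D_minus_left:
  "vector_field A X \<Longrightarrow> vector_field A Y \<Longrightarrow> D (\<lambda>q. - X q) Y p = - D X Y p"
  using D_scale_left[OF smooth_fun_const[of "-1"], of X Y] by simp

lemma D_diff_right: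
  "vector_field A X \<Longrightarrow> vector_field A Y \<Longrightarrow> vector_field A Z \<Longrightarrow>
    D X (\<lambda>q. Y q - Z q) p = D X Y p - D X Z p"
  using D_add_right[of X Y "\<lambda>q. - Z q"] by (simp add: D_minus_right vector_field_minus)

lemma D_diff_left:
  "vector_field A X \<Longrightarrow> vector_field A Y \<Longrightarrow> vector_field A Z \<Longrightarrow>
    D (\<lambda>q. X q - Y q) Z p = D X Z p - D Y Z p"
  using D_add_left[of X "\<lambda>q. - Y q"] by (simp add: D_minus_left vector_field_minus)

lemma D_sum_right:
  assumes X: "vector_field A X"
  shows "(\<And>i. i \<in> I \<Longrightarrow> vector_field A (Y i)) \<Longrightarrow> D X (\<lambda>q. \<Sum>i\<in>I. Y i q) p = (\<Sum>i\<in>I. D X (Y i) p)"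
proof (induction I rule: infinite_finite_induct)
  case (insert i I)
  have "D X (\<lambda>q. Y i q + (\<Sum>i\<in>I. Y i q)) p = D X (Y i) p + D X (\<lambda>q. \<Sum>i\<in>I. Y i q) p"
    by (intro D_add_right X vector_field_sum) (use insert in auto)
  then show ?case using insert by simp
qed (auto simp: D_zero_right[OF X])

section \<open>The connection depends on one-jets\<close>

lemma D_jet_zero:
  assumes X: "vector_field A X" and Z: "vector_field A Z" and c: "c \<in> A" "p \<in> fst c"
    and X0: "field_rep A c X (snd c p) = 0"
    and X1: "(field_rep A c X has_derivative (\<lambda>v. 0)) (at (snd c p))"
  shows "D Z X p = 0"
proof -
  obtain \<beta> w E N where d: "smooth_fun A \<beta>" "\<And>b. smooth_fun A (w b)" "\<And>b. vector_field A (E b)"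
    "open N" "p \<in> N" "N \<subseteq> fst c" "\<And>q. q \<in> N \<Longrightarrow> \<beta> q = 1"
    "\<And>q b. q \<in> N \<Longrightarrow> w b q = field_rep A c X (snd c q) \<bullet> b"
    "(\<lambda>q. \<beta> q *\<^sub>R X q) = (\<lambda>q. \<Sum>b\<in>Basis. w b q *\<^sub>R E b q)"
    by (rule field_decomposition[OF X c]) blast
  have Xp: "X p = 0"
    using X0 of_chart_to_chart[OF c, of "X p"] linear_0[OF linear_of_chart[OF c]] by (simp add: field_rep_chart c)
  have wp: "w b p = 0" for b using d(5,8) X0 by simp
  have "((\<lambda>x. field_rep A c X x \<bullet> b) has_derivative (\<lambda>v. 0)) (at (snd c p))" for b
    using bounded_linear.has_derivative[OF bounded_linear_inner_left X1, of b] by simp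
  then have dw: "dir_deriv A Z (w b) p = 0" for b
    using dir_deriv_zeroI[OF c(1) d(4,5,6) d(2) d(8)] by blast
  \<comment> \<open>The Leibniz rule for \<beta> leaves an extra multiple of \<open>X p\<close>,
    which is 0. In the decomposed sum it leaves values and derivatives of the coefficients at
    \<open>p\<close>, and both vanish.\<close>
  have "D Z X p = D Z (\<lambda>q. \<beta> q *\<^sub>R X q) p"
    using D_leibniz[OF d(1) Z X, of p] d(5,7) Xp by simp
  also have "\<dots> = (\<Sum>b\<in>Basis. D Z (\<lambda>q. w b q *\<^sub>R E b q) p)"
    unfolding d(9) by (intro D_sum_right Z vector_field_scaleR d)
  also have "\<dots> = 0" using D_leibniz[OF d(2) Z d(3)] by (simp add: wp dw)
  finally show ?thesis .
qed

lemma D_jet_eq: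
  assumes X: "vector_field A X" and Y: "vector_field A Y" and Z: "vector_field A Z"
    and c: "c \<in> A" "p \<in> fst c"
    and eq: "field_rep A c X (snd c p) = field_rep A c Y (snd c p)"
    "frechet_derivative (field_rep A c X) (at (snd c p)) = frechet_derivative (field_rep A c Y) (at (snd c p))"
  shows "D Z X p = D Z Y p"
proof -
  note XY = vector_field_diff[OF X Y]
  note pc = chart_in_img[OF c(2)]
  have rep: "field_rep A c (\<lambda>q. X q - Y q) x = field_rep A c X x - field_rep A c Y x"
    if "x \<in> chart_img c" for x
    by (simp add: field_rep_def linear_diff[OF linear_to_chart] chart_inv_in c that)
  have "D Z (\<lambda>q. X q - Y q) p = 0"
  proof (rule D_jet_zero[OF XY Z c])
    show "field_rep A c (\<lambda>q. X q - Y q) (snd c p) = 0" by (simp add: rep pc eq)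
    have "((\<lambda>x. field_rep A c X x - field_rep A c Y x) has_derivative (\<lambda>v. 0)) (at (snd c p))"
      using has_derivative_diff[OF smooth_on_has_derivative[OF vector_field_on[OF X c(1)] pc]
          smooth_on_has_derivative[OF vector_field_on[OF Y c(1)] pc]] by (simp add: eq)
    then show "(field_rep A c (\<lambda>q. X q - Y q) has_derivative (\<lambda>v. 0)) (at (snd c p))"
      by (rule has_derivative_transform_within_open[OF _ open_chart_img[OF c(1)] pc]) (simp add: rep)
  qed
  then show ?thesis by (simp add: D_diff_right X Y Z)
qed

section \<open>Smoothness detected by the metric\<close>

lemma smooth_fun_metric:
  assumes X: "vector_field A X" and Y: "vector_field A Y"
  shows "smooth_fun A (\<lambda>q. g q (X q) (Y q))"
  unfolding smooth_fun_def
proof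
  fix c assume c: "c \<in> A"
  let ?G = "\<lambda>x u v. g (chart_inv c x) (of_chart A c (chart_inv c x) u) (of_chart A c (chart_inv c x) v)"
  have bil: "bilinear (?G x)" if "x \<in> chart_img c" for x
    using linear_of_chart[OF c chart_inv_in[OF c that]]
    by (simp add: bilinear_def linear_iff g_add_left g_add_right g_scale_left g_scale_right)
  have sm: "smooth_on (chart_img c) (\<lambda>x. ?G x u v)" for u v
    using metric c by (simp add: riemannian_metric_def Let_def)
  have eq: "((\<lambda>q. g q (X q) (Y q)) \<circ> chart_inv c) x = ?G x (field_rep A c X x) (field_rep A c Y x)"
    if "x \<in> chart_img c" for x
    using chart_inv_in[OF c that] by (simp add: field_rep_def of_chart_to_chart c)
  show "smooth_on (chart_img c) ((\<lambda>q. g q (X q) (Y q)) \<circ> chart_inv c)"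
    by (rule smooth_on_cong[OF open_chart_img[OF c] eq, THEN iffD2], assumption)
      (rule smooth_on_bilinear_family[where G = ?G, OF open_chart_img[OF c] bil sm
          vector_field_on[OF X c] vector_field_on[OF Y c]])
qed

text \<open>Vectors obtained from \<open>riesz\<close> have no coordinate formula, so this is the
  access to their smoothness. Near a point it suffices to pair with coordinate fields, which is the
  situation of \<open>smooth_on_riesz\<close>.\<close>

lemma vector_field_riesz:
  assumes W: "\<And>Z. vector_field A Z \<Longrightarrow> smooth_fun A (\<lambda>q. g q (W q) (Z q))"
  shows "vector_field A W"
proof (rule vector_fieldI)
  fix p
  let ?c = "chart_at A p"
  have c: "?c \<in> A" "p \<in> fst ?c" by (auto simp: chart_at_in in_chart_at)
  obtain E N where N: "open N" "p \<in> N" "N \<subseteq> fst ?c" and E: "\<And>v. vector_field A (E v)"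
    and EN: "\<And>q v. q \<in> N \<Longrightarrow> E v q = of_chart A ?c q v"
    by (rule coordinate_fields[OF c], rule that)
  let ?S = "snd ?c ` N"
  let ?G = "\<lambda>x u v. g (chart_inv ?c x) (of_chart A ?c (chart_inv ?c x) u) (of_chart A ?c (chart_inv ?c x) v)"
  have S: "open ?S" using open_chart_image[OF c(1) N(1)] N(3) by (simp add: Int_absorb1)
  have Sc: "?S \<subseteq> chart_img ?c" using N by (auto simp: chart_img_def)
  have inN: "chart_inv ?c x \<in> N" if "x \<in> ?S" for x using that N c by (auto simp: chart_inv_chart subset_iff)
  have lin: "linear (of_chart A ?c (chart_inv ?c x))" if "x \<in> ?S" for x
    by (rule linear_of_chart[OF c(1)]) (use inN[OF that] N in auto)
  have "smooth_on ?S (field_rep A ?c W)"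
  proof (rule smooth_on_riesz[OF S])
    show "bilinear (?G x)" if "x \<in> ?S" for x
      using lin[OF that]
      by (simp add: bilinear_def linear_iff g_add_left g_add_right g_scale_left g_scale_right)
    show "?G x u v = ?G x v u" for x u v by (rule g_sym)
    show "?G x u u > 0" if "x \<in> ?S" "u \<noteq> 0" for x u
    proof (rule g_pos)
      show "of_chart A ?c (chart_inv ?c x) u \<noteq> 0"
        using that inN[OF that(1)] N to_chart_of_chart[OF c(1), of "chart_inv ?c x" u]
          linear_0[OF linear_to_chart[OF c(1), of "chart_inv ?c x"]] by (auto simp: subset_iff)
    qed
    show "smooth_on ?S (\<lambda>x. ?G x u v)" for u v
      using metric c by (intro smooth_on_subset[OF _ Sc]) (simp add: riemannian_metric_def Let_def)
    show "smooth_on ?S (\<lambda>x. ?G x (field_rep A ?c W x) u)" for u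
    proof -
      have a: "smooth_on ?S ((\<lambda>q. g q (W q) (E u q)) \<circ> chart_inv ?c)"
        by (intro smooth_on_subset[OF _ Sc] smooth_fun_on W E c)
      have e: "?G x (field_rep A ?c W x) u = ((\<lambda>q. g q (W q) (E u q)) \<circ> chart_inv ?c) x" if "x \<in> ?S" for x
        using inN[OF that] N by (simp add: field_rep_def of_chart_to_chart c EN subset_iff)
      show ?thesis by (rule smooth_on_cong[OF S e, THEN iffD2, OF _ a])
    qed
  qed
  then show "\<exists>c W'. c \<in> A \<and> open W' \<and> p \<in> W' \<and> W' \<subseteq> fst c \<and> smooth_on (snd c ` W') (field_rep A c W)"
    using c N by blast
qed

section \<open>Tensoriality and skew symmetry of the curvature\<close>

lemma vector_field_lie_bracket:
  "vector_field A X \<Longrightarrow> vector_field A Y \<Longrightarrow> vector_field A (lie_bracket A X Y)"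
  by (simp add: D_torsion_free vector_field_diff D_field)

text \<open>\<open>curvature\<close> evaluates this expression on chosen extensions. For arbitrary
  fields it can be shown tensorial, and this removes the choice.\<close>

definition curv :: "('m \<Rightarrow> 'e) \<Rightarrow> ('m \<Rightarrow> 'e) \<Rightarrow> ('m \<Rightarrow> 'e) \<Rightarrow> 'm \<Rightarrow> 'e" where
  "curv X Y Z p = D X (D Y Z) p - D Y (D X Z) p - D (lie_bracket A X Y) Z p"

lemma vector_field_curv:
  "vector_field A X \<Longrightarrow> vector_field A Y \<Longrightarrow> vector_field A Z \<Longrightarrow> vector_field A (curv X Y Z)"
  unfolding curv_def[abs_def] by (intro vector_field_diff D_field vector_field_lie_bracket)

lemma curv_tensorial_1:
  assumes Y: "vector_field A Y" and Z: "vector_field A Z"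
  shows "tensorial_at p (\<lambda>X. curv X Y Z p)"
  unfolding tensorial_at_def
proof (intro conjI allI impI)
  fix X X' assume X: "vector_field A X" "vector_field A X'"
  have 1: "D (\<lambda>q. X q + X' q) Z = (\<lambda>q. D X Z q + D X' Z q)"
    by (rule ext) (simp add: D_add_left X Z)
  have 2: "lie_bracket A (\<lambda>q. X q + X' q) Y = (\<lambda>q. lie_bracket A X Y q + lie_bracket A X' Y q)"
    by (simp add: fun_eq_iff D_torsion_free vector_field_add X Y D_add_left D_add_right)
  show "curv (\<lambda>q. X q + X' q) Y Z p = curv X Y Z p + curv X' Y Z p"
    unfolding curv_def 1 2
    by (simp add: D_add_left D_add_right D_field X Y Z vector_field_lie_bracket)
next
  fix f X assume f: "smooth_fun A f" and X: "vector_field A X"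
  have 1: "D (\<lambda>q. f q *\<^sub>R X q) Z = (\<lambda>q. f q *\<^sub>R D X Z q)"
    by (rule ext) (simp add: D_scale_left f X Z)
  \<comment> \<open>The derivative of \<open>f\<close> along \<open>Y\<close> in the bracket cancels
    the Leibniz term that arises when \<open>D Y\<close> is applied to \<open>f\<close> times
    \<open>D X Z\<close>.\<close>
  have 2: "lie_bracket A (\<lambda>q. f q *\<^sub>R X q) Y
      = (\<lambda>q. f q *\<^sub>R lie_bracket A X Y q - dir_deriv A Y f q *\<^sub>R X q)"
    by (simp add: fun_eq_iff D_torsion_free vector_field_scaleR f X Y D_scale_left D_leibniz algebra_simps)
  have 3: "D (\<lambda>q. f q *\<^sub>R lie_bracket A X Y q - dir_deriv A Y f q *\<^sub>R X q) Z p
      = f p *\<^sub>R D (lie_bracket A X Y) Z p - dir_deriv A Y f p *\<^sub>R D X Z p"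
    by (simp add: D_diff_left D_scale_left vector_field_scaleR f X Y Z vector_field_lie_bracket smooth_fun_dir_deriv)
  show "curv (\<lambda>q. f q *\<^sub>R X q) Y Z p = f p *\<^sub>R curv X Y Z p"
    unfolding curv_def 1 2 3
    by (simp add: D_scale_left D_leibniz D_field f X Y Z algebra_simps)
qed

lemma curv_antisym:
  assumes "vector_field A X" "vector_field A Y" "vector_field A Z"
  shows "curv X Y Z p = - curv Y X Z p"
proof -
  have "lie_bracket A Y X = (\<lambda>q. - lie_bracket A X Y q)"
    using assms by (simp add: D_torsion_free)
  then show ?thesis
    using assms by (simp add: curv_def D_minus_left vector_field_lie_bracket)
qed

lemma curv_tensorial_2:
  assumes X: "vector_field A X" and Z: "vector_field A Z"
  shows "tensorial_at p (\<lambda>Y. curv X Y Z p)"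
  using curv_tensorial_1[OF X Z, of p] unfolding tensorial_at_def
  by (simp add: curv_antisym[OF X _ Z] vector_field_add vector_field_scaleR)

text \<open>Terms with first derivatives of \<open>f\<close> cancel in pairs. The rest is
  \<open>X (Y f) - Y (X f) - [X,Y] f\<close> times \<open>Z\<close>, and
  \<open>lie_bracket_dir_deriv\<close> makes it 0.\<close>

lemma curv_tensorial_3:
  assumes X: "vector_field A X" and Y: "vector_field A Y"
  shows "tensorial_at p (\<lambda>Z. curv X Y Z p)"
  unfolding tensorial_at_def
proof (intro conjI allI impI)
  fix Z Z' assume Z: "vector_field A Z" "vector_field A Z'"
  have 1: "D W (\<lambda>q. Z q + Z' q) = (\<lambda>q. D W Z q + D W Z' q)" if "vector_field A W" for W
    by (rule ext) (simp add: D_add_right Z that)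
  show "curv X Y (\<lambda>q. Z q + Z' q) p = curv X Y Z p + curv X Y Z' p"
    by (simp add: curv_def 1 X Y D_add_right D_field Z vector_field_lie_bracket)
next
  fix f Z assume f: "smooth_fun A f" and Z: "vector_field A Z"
  have 1: "D W (\<lambda>q. f q *\<^sub>R Z q) = (\<lambda>q. dir_deriv A W f q *\<^sub>R Z q + f q *\<^sub>R D W Z q)"
    if "vector_field A W" for W
    by (rule ext) (simp add: D_leibniz f Z that)
  show "curv X Y (\<lambda>q. f q *\<^sub>R Z q) p = f p *\<^sub>R curv X Y Z p"
    by (simp add: curv_def 1 X Y D_add_right D_leibniz D_field f Z vector_field_lie_bracket
        vector_field_scaleR smooth_fun_dir_deriv lie_bracket_dir_deriv algebra_simps)
qed

text \<open>\<open>Blinfun\<close> can be unfolded only for a bounded linear argument; tensoriality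
  in the third slot and finite dimension provide that.\<close>

lemma curvature_extend:
  "blinfun_apply (curvature A D p u v) w = curv (extend A p u) (extend A p v) (extend A p w) p"
proof -
  have "linear (\<lambda>w. curv (extend A p u) (extend A p v) (extend A p w) p)"
    by (intro tensorial_at_linear curv_tensorial_3 vector_field_extend)
  then have "bounded_linear (\<lambda>w. curv (extend A p u) (extend A p v) (extend A p w) p)"
    by (simp add: linear_conv_bounded_linear)
  then show ?thesis by (simp add: curvature_def curv_def Let_def bounded_linear_Blinfun_apply)
qed

lemma curvature_apply:
  assumes "vector_field A X" "vector_field A Y" "vector_field A Z"
  shows "blinfun_apply (curvature A D p (X p) (Y p)) (Z p) = curv X Y Z p"
  unfolding curvature_extend
  using tensorial_at_extend[OF curv_tensorial_1] tensorial_at_extend[OF curv_tensorial_2]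
    tensorial_at_extend[OF curv_tensorial_3] assms vector_field_extend by simp

lemma curvature_linear_1: "linear (\<lambda>u. blinfun_apply (curvature A D p u v) w)"
  and curvature_linear_2: "linear (\<lambda>v. blinfun_apply (curvature A D p u v) w)"
  unfolding curvature_extend
  by (intro tensorial_at_linear curv_tensorial_1 curv_tensorial_2 vector_field_extend)+

text \<open>Differentiate \<open>g Z W\<close> twice. In the commutator the products of first
  derivatives cancel, and comparison with the derivative along the bracket leaves
  \<open>g (R Z) W + g Z (R W) = 0\<close>.\<close>

lemma curvature_skew:
  "g p (blinfun_apply (curvature A D p u v) w) z = - g p w (blinfun_apply (curvature A D p u v) z)"
proof -
  define X Y Z W where "X = extend A p u" and "Y = extend A p v" and "Z = extend A p w" and "W = extend A p z"
  have vf: "vector_field A X" "vector_field A Y" "vector_field A Z" "vector_field A W"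
    by (simp_all add: X_def Y_def Z_def W_def vector_field_extend)
  have at: "Z p = w" "W p = z" by (simp_all add: Z_def W_def extend_at)
  let ?f = "\<lambda>q. g q (Z q) (W q)"
  have sf: "smooth_fun A ?f" by (rule smooth_fun_metric[OF vf(3,4)])
  have 2: "dir_deriv A V (dir_deriv A V' ?f) p = g p (D V (D V' Z) p) (W p) + g p (D V' Z p) (D V W p)
      + (g p (D V Z p) (D V' W p) + g p (Z p) (D V (D V' W) p))"
    if V: "vector_field A V" "vector_field A V'" for V V'
  proof -
    have "dir_deriv A V' ?f = (\<lambda>q. g q (D V' Z q) (W q) + g q (Z q) (D V' W q))"
      by (rule ext) (rule D_metric[OF V(2) vf(3,4)])
    then show ?thesis
      by (simp add: dir_deriv_add smooth_fun_metric D_metric D_field V vf)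
  qed
  have "dir_deriv A (lie_bracket A X Y) ?f p
      = dir_deriv A X (dir_deriv A Y ?f) p - dir_deriv A Y (dir_deriv A X ?f) p"
    by (rule lie_bracket_dir_deriv[OF vf(1,2) sf])
  then have "g p (curv X Y Z p) (W p) = - g p (Z p) (curv X Y W p)"
    by (simp add: 2 vf D_metric vector_field_lie_bracket curv_def g_diff_left g_diff_right)
  then show ?thesis unfolding curvature_extend at by (simp add: X_def Y_def Z_def W_def)
qed

section \<open>The connection on endomorphisms\<close>

definition endo_field :: "('m \<Rightarrow> 'e \<Rightarrow>\<^sub>L 'e) \<Rightarrow> bool" where
  "endo_field \<Phi> \<longleftrightarrow> (\<forall>Z. vector_field A Z \<longrightarrow> vector_field A (\<lambda>q. blinfun_apply (\<Phi> q) (Z q)))"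

text \<open>The term with the derivative of \<open>f\<close> occurs in both summands and
  cancels.\<close>

lemma conn_End_tensorial:
  assumes X: "vector_field A X" and \<Phi>: "endo_field \<Phi>"
  shows "tensorial_at p (\<lambda>Z. D X (\<lambda>q. blinfun_apply (\<Phi> q) (Z q)) p - blinfun_apply (\<Phi> p) (D X Z p))"
  unfolding tensorial_at_def using \<Phi>
  by (auto simp: endo_field_def blinfun.add_right blinfun.scaleR_right D_add_right D_leibniz X algebra_simps)

lemma conn_End_apply:
  assumes X: "vector_field A X" and \<Phi>: "endo_field \<Phi>" and Z: "vector_field A Z"
  shows "blinfun_apply (conn_End A D X \<Phi> p) (Z p)
    = D X (\<lambda>q. blinfun_apply (\<Phi> q) (Z q)) p - blinfun_apply (\<Phi> p) (D X Z p)"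
proof -
  note t = conn_End_tensorial[OF X \<Phi>, of p]
  have "bounded_linear (\<lambda>w. D X (\<lambda>q. blinfun_apply (\<Phi> q) (extend A p w q)) p
      - blinfun_apply (\<Phi> p) (D X (extend A p w) p))"
    using tensorial_at_linear[OF t] by (simp add: linear_conv_bounded_linear)
  then show ?thesis
    using tensorial_at_extend[OF t Z] by (simp add: conn_End_def Let_def bounded_linear_Blinfun_apply)
qed

text \<open>Differentiate \<open>g (\<Phi> Y) Z = - g Y (\<Phi> Z)\<close> along \<open>X\<close>;
  the terms in which \<open>Y\<close> or \<open>Z\<close> is differentiated are matched by skewness
  of \<Phi> itself.\<close>

lemma conn_End_skew:
  assumes X: "vector_field A X" and \<Phi>: "endo_field \<Phi>"
    and skew: "\<And>q x y. g q (blinfun_apply (\<Phi> q) x) y = - g q x (blinfun_apply (\<Phi> q) y)"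
  shows "g p (blinfun_apply (conn_End A D X \<Phi> p) x) y = - g p x (blinfun_apply (conn_End A D X \<Phi> p) y)"
proof -
  define Y Z where "Y = extend A p x" and "Z = extend A p y"
  have vf: "vector_field A Y" "vector_field A Z" by (simp_all add: Y_def Z_def vector_field_extend)
  have vf': "vector_field A (\<lambda>q. \<Phi> q (Y q))" "vector_field A (\<lambda>q. \<Phi> q (Z q))"
    using \<Phi> vf by (auto simp: endo_field_def)
  have "dir_deriv A X (\<lambda>q. g q (\<Phi> q (Y q)) (Z q)) p = dir_deriv A X (\<lambda>q. (-1) * g q (Y q) (\<Phi> q (Z q))) p"
    by (simp add: skew)
  also have "\<dots> = - dir_deriv A X (\<lambda>q. g q (Y q) (\<Phi> q (Z q))) p"
    using dir_deriv_mult[OF smooth_fun_const[of "-1"] smooth_fun_metric[OF vf(1) vf'(2)]]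
    by (simp add: dir_deriv_const)
  finally have "g p (blinfun_apply (conn_End A D X \<Phi> p) (Y p)) (Z p)
      = - g p (Y p) (blinfun_apply (conn_End A D X \<Phi> p) (Z p))"
    using skew[of p "Y p" "D X Z p"] skew[of p "D X Y p" "Z p"]
    by (simp add: D_metric X vf vf' conn_End_apply \<Phi> g_diff_left g_diff_right)
  then show ?thesis by (simp add: Y_def Z_def extend_at)
qed

section \<open>Covariant derivatives of tensor fields\<close>

definition tensor_field :: "nat \<Rightarrow> ('m \<Rightarrow> (nat \<Rightarrow> 'e) \<Rightarrow> 'e) \<Rightarrow> bool" where
  "tensor_field n T \<longleftrightarrow> (\<forall>q. multilinear_form n (T q)) \<and>
    (\<forall>U. (\<forall>i. vector_field A (U i)) \<longrightarrow> vector_field A (\<lambda>q. T q (\<lambda>i. U i q)))"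

definition nabla :: "nat \<Rightarrow> ('m \<Rightarrow> (nat \<Rightarrow> 'e) \<Rightarrow> 'e) \<Rightarrow> ('m \<Rightarrow> 'e) \<Rightarrow> (nat \<Rightarrow> 'm \<Rightarrow> 'e) \<Rightarrow> 'm \<Rightarrow> 'e" where
  "nabla n T X U p = D X (\<lambda>q. T q (\<lambda>i. U i q)) p - (\<Sum>j<n. T p ((\<lambda>i. U i p)(j := D X (U j) p)))"

text \<open>Covariant derivative as a tensor on vectors. The extensions in it are a choice; by
  \<open>nabla_eq_nabla_at\<close> any other fields with the same values at \<open>p\<close> give
  the same result.\<close>

definition nabla_at :: "nat \<Rightarrow> ('m \<Rightarrow> (nat \<Rightarrow> 'e) \<Rightarrow> 'e) \<Rightarrow> 'm \<Rightarrow> 'e \<Rightarrow> (nat \<Rightarrow> 'e) \<Rightarrow> 'e" where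
  "nabla_at n T p x v = nabla n T (extend A p x) (\<lambda>i. extend A p (v i)) p"

lemma tensor_fieldD:
  "tensor_field n T \<Longrightarrow> multilinear_form n (T q)"
  "tensor_field n T \<Longrightarrow> (\<And>i. vector_field A (U i)) \<Longrightarrow> vector_field A (\<lambda>q. T q (\<lambda>i. U i q))"
  by (simp_all add: tensor_field_def)

lemma vector_field_nabla:
  assumes T: "tensor_field n T" and X: "vector_field A X" and U: "\<And>i. vector_field A (U i)"
  shows "vector_field A (nabla n T X U)"
proof -
  have "(\<lambda>i. U i q)(j := D X (U j) q) = (\<lambda>i. (U(j := D X (U j))) i q)" for q j
    by (auto simp: fun_eq_iff)
  then show ?thesis
    unfolding nabla_def[abs_def]
    by (auto intro!: vector_field_diff vector_field_sum D_field X U tensor_fieldD[OF T])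
qed

lemma nabla_cong:
  assumes T: "tensor_field n T" and eq: "\<And>i. i < n \<Longrightarrow> U i = V i"
  shows "nabla n T X U p = nabla n T X V p"
proof -
  note cong = multilinear_form_cong[OF tensor_fieldD(1)[OF T]]
  have "(\<lambda>q. T q (\<lambda>i. U i q)) = (\<lambda>q. T q (\<lambda>i. V i q))"
    by (rule ext, rule cong) (simp add: eq)
  moreover have "T p ((\<lambda>i. U i p)(j := D X (U j) p)) = T p ((\<lambda>i. V i p)(j := D X (V j) p))" if "j < n" for j
    by (rule cong) (simp add: eq that)
  ultimately show ?thesis by (simp add: nabla_def cong: sum.cong_simp)
qed

lemma nabla_tensorial_direction:
  assumes T: "tensor_field n T" and U: "\<And>i. vector_field A (U i)"
  shows "tensorial_at p (\<lambda>X. nabla n T X U p)"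
  unfolding tensorial_at_def
proof (intro conjI allI impI)
  note TU = tensor_fieldD(2)[OF T U]
  have lin: "linear (\<lambda>x. T p ((\<lambda>i. U i p)(j := x)))" if "j < n" for j
    by (rule multilinear_form_linear[OF tensor_fieldD(1)[OF T] that])
  show "nabla n T (\<lambda>q. X q + Y q) U p = nabla n T X U p + nabla n T Y U p"
    if "vector_field A X" "vector_field A Y" for X Y
    by (simp add: nabla_def D_add_left that U TU linear_add[OF lin] sum.distrib)
  show "nabla n T (\<lambda>q. f q *\<^sub>R X q) U p = f p *\<^sub>R nabla n T X U p"
    if "smooth_fun A f" "vector_field A X" for f X
    by (simp add: nabla_def D_scale_left that U TU linear_scale[OF lin] scaleR_diff_right scaleR_sum_right)
qed

lemma nabla_tensorial_slot:
  assumes T: "tensor_field n T" and X: "vector_field A X" and U: "\<And>i. vector_field A (U i)" and i: "i < n"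
  shows "tensorial_at p (\<lambda>Y. nabla n T X (U(i := Y)) p)"
proof -
  let ?L = "\<lambda>q y. T q ((\<lambda>k. U k q)(i := y))"
  let ?M = "\<lambda>j y. T p ((\<lambda>k. U k p)(j := D X (U j) p, i := y))"
  have lin: "linear (?L q)" for q
    by (rule multilinear_form_linear[OF tensor_fieldD(1)[OF T] i])
  have lin': "linear (?M j)" for j
    by (rule multilinear_form_linear[OF tensor_fieldD(1)[OF T] i])
  have upd: "(\<lambda>k. (U(i := Y)) k q) = (\<lambda>k. U k q)(i := Y q)" for Y q by (auto simp: fun_eq_iff)
  have LY: "vector_field A (\<lambda>q. ?L q (Y q))" if Y: "vector_field A Y" for Y
  proof -
    have "vector_field A (\<lambda>q. T q (\<lambda>k. (U(i := Y)) k q))"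
      by (rule tensor_fieldD(2)[OF T]) (simp add: U Y)
    then show ?thesis by (simp only: upd)
  qed
  \<comment> \<open>The summand \<open>j = i\<close> is separated because it is the one that
    differentiates \<open>Y\<close>, and its Leibniz term cancels that of the leading summand. The
    other summands contain only the value of \<open>Y\<close> at \<open>p\<close>.\<close>
  have eq: "nabla n T X (U(i := Y)) p
    = D X (\<lambda>q. ?L q (Y q)) p - (?L p (D X Y p) + (\<Sum>j\<in>{..<n} - {i}. ?M j (Y p)))" for Y
  proof -
    have "(\<Sum>j<n. T p ((\<lambda>k. (U(i := Y)) k p)(j := D X ((U(i := Y)) j) p)))
      = T p ((\<lambda>k. (U(i := Y)) k p)(i := D X ((U(i := Y)) i) p))
        + (\<Sum>j\<in>{..<n} - {i}. T p ((\<lambda>k. (U(i := Y)) k p)(j := D X ((U(i := Y)) j) p)))"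
      using i by (intro sum.remove) auto
    also have "T p ((\<lambda>k. (U(i := Y)) k p)(i := D X ((U(i := Y)) i) p)) = ?L p (D X Y p)"
      unfolding upd by simp
    also have "(\<Sum>j\<in>{..<n} - {i}. T p ((\<lambda>k. (U(i := Y)) k p)(j := D X ((U(i := Y)) j) p)))
      = (\<Sum>j\<in>{..<n} - {i}. ?M j (Y p))"
      unfolding upd by (intro sum.cong refl) (simp add: fun_upd_twist)
    finally show ?thesis by (simp only: nabla_def upd)
  qed
  show ?thesis
    unfolding tensorial_at_def eq
  proof (intro conjI allI impI)
    fix Y Y' assume Y: "vector_field A Y" "vector_field A Y'"
    show "D X (\<lambda>q. ?L q (Y q + Y' q)) p - (?L p (D X (\<lambda>q. Y q + Y' q) p) + (\<Sum>j\<in>{..<n} - {i}. ?M j (Y p + Y' p)))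
      = D X (\<lambda>q. ?L q (Y q)) p - (?L p (D X Y p) + (\<Sum>j\<in>{..<n} - {i}. ?M j (Y p)))
        + (D X (\<lambda>q. ?L q (Y' q)) p - (?L p (D X Y' p) + (\<Sum>j\<in>{..<n} - {i}. ?M j (Y' p))))"
      by (simp add: linear_add[OF lin] linear_add[OF lin'] D_add_right X Y LY sum.distrib)
  next
    fix f Y assume f: "smooth_fun A f" and Y: "vector_field A Y"
    show "D X (\<lambda>q. ?L q (f q *\<^sub>R Y q)) p - (?L p (D X (\<lambda>q. f q *\<^sub>R Y q) p) + (\<Sum>j\<in>{..<n} - {i}. ?M j (f p *\<^sub>R Y p)))
      = f p *\<^sub>R (D X (\<lambda>q. ?L q (Y q)) p - (?L p (D X Y p) + (\<Sum>j\<in>{..<n} - {i}. ?M j (Y p))))"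
      by (simp add: linear_add[OF lin] linear_scale[OF lin] linear_scale[OF lin'] D_leibniz f X Y LY
          scaleR_diff_right scaleR_add_right scaleR_sum_right)
  qed
qed

lemma nabla_eq_nabla_at:
  assumes T: "tensor_field n T" and X: "vector_field A X" and U: "\<And>i. vector_field A (U i)"
  shows "nabla n T X U p = nabla_at n T p (X p) (\<lambda>i. U i p)"
proof -
  have "nabla n T X U p = nabla n T (extend A p (X p)) U p"
    by (rule tensorial_at_extend[OF nabla_tensorial_direction[OF T U] X, symmetric])
  also have "\<dots> = nabla n T (extend A p (X p)) (\<lambda>i. extend A p (U i p)) p"
  proof (rule tensorial_at_multi_eq[where n = n and p = p and F = "\<lambda>U. nabla n T (extend A p (X p)) U p"])
    show "tensorial_at p (\<lambda>Y. nabla n T (extend A p (X p)) (U(i := Y)) p)"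
      if "\<And>i. vector_field A (U i)" "i < n" for U i
      by (rule nabla_tensorial_slot[OF T vector_field_extend that])
    show "nabla n T (extend A p (X p)) U p = nabla n T (extend A p (X p)) V p"
      if "\<And>i. i < n \<Longrightarrow> U i = V i" for U V
      by (rule nabla_cong[OF T that])
  qed (simp_all add: U vector_field_extend extend_at)
  finally show ?thesis by (simp add: nabla_at_def)
qed

lemma nabla_at_linear:
  assumes T: "tensor_field n T"
  shows "linear (\<lambda>x. nabla_at n T p x v)"
  unfolding nabla_at_def
  by (rule tensorial_at_linear) (rule nabla_tensorial_direction[OF T vector_field_extend])

lemma nabla_at_multilinear:
  assumes T: "tensor_field n T"
  shows "multilinear_form n (nabla_at n T p x)"
  unfolding multilinear_form_def
proof (intro conjI allI impI)
  fix v w :: "nat \<Rightarrow> 'e" assume "\<forall>i<n. v i = w i"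
  then show "nabla_at n T p x v = nabla_at n T p x w"
    unfolding nabla_at_def by (intro nabla_cong[OF T]) auto
next
  fix v :: "nat \<Rightarrow> 'e" and i assume i: "i < n"
  have "(\<lambda>k. extend A p ((v(i := y)) k)) = (\<lambda>k. extend A p (v k))(i := extend A p y)" for y
    by (auto simp: fun_eq_iff)
  then have "(\<lambda>y. nabla_at n T p x (v(i := y)))
      = (\<lambda>y. nabla n T (extend A p x) ((\<lambda>k. extend A p (v k))(i := extend A p y)) p)"
    unfolding nabla_at_def by metis
  then show "linear (\<lambda>y. nabla_at n T p x (v(i := y)))"
    using tensorial_at_linear[OF nabla_tensorial_slot[OF T vector_field_extend vector_field_extend i]]
    by (simp only:)
qed

text \<open>Stated for a single pair of slots, as the tensor of an endomorphism-valued
  \<open>k\<close>-form alternates only in its first \<open>k\<close> slots. Correction terms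
  elsewhere keep both equal entries, and those in \<open>a\<close> and \<open>b\<close> are
  negatives of each other.\<close>

lemma nabla_at_alternating:
  assumes T: "tensor_field n T" and ab: "a \<noteq> b" "a < n" "b < n"
    and alt: "\<And>q v. v a = v b \<Longrightarrow> T q v = 0" and v: "v a = v b"
  shows "nabla_at n T p x v = 0"
proof -
  let ?U = "\<lambda>i. extend A p (v i)"
  let ?V = "\<lambda>i. ?U i p"
  let ?f = "\<lambda>j. T p (?V(j := D (extend A p x) (?U j) p))"
  \<comment> \<open>\<open>extend\<close> is a function of the vector, so equal entries receive the
    same field, and the tensor vanishes at every \<open>q\<close> rather than at \<open>p\<close>
    alone.\<close>
  have 1: "(\<lambda>q. T q (\<lambda>i. ?U i q)) = (\<lambda>q. 0)"
    by (rule ext, rule alt) (simp add: v)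
  have "(\<Sum>j<n. ?f j) = (\<Sum>j\<in>{a, b}. ?f j)"
  proof (rule sum.mono_neutral_right)
    show "\<forall>j\<in>{..<n} - {a, b}. ?f j = 0"
    proof
      fix j assume "j \<in> {..<n} - {a, b}"
      then show "?f j = 0" by (intro alt) (auto simp: v)
    qed
  qed (use ab in auto)
  also have "\<dots> = ?f a + ?f b" using ab by simp
  also have "\<dots> = 0"
  proof -
    let ?d = "D (extend A p x) (?U a) p"
    have "T p (?V(a := ?d, b := ?V b)) = - T p (?V(a := ?V b, b := ?d))"
      by (rule multilinear_form_swap[OF tensor_fieldD(1)[OF T] ab alt])
    moreover have "?V(a := ?d, b := ?V b) = ?V(a := ?d)" using ab by (auto simp: fun_eq_iff)
    moreover have "?V(a := ?V b, b := ?d) = ?V(b := ?d)" using ab v by (auto simp: fun_eq_iff)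
    ultimately show ?thesis by (simp add: v)
  qed
  finally show ?thesis
    by (simp add: nabla_at_def nabla_def 1 D_zero_right vector_field_extend)
qed

end

section \<open>The splitting operators\<close>

context riemannian_manifold
begin

section \<open>The exterior derivative as an antisymmetrised covariant derivative\<close>

lemma omit_fields: "omit i (\<lambda>j. X j q) = (\<lambda>j. omit i X j q)"
  by (auto simp: omit_def)

lemma omit_extend: "omit i (\<lambda>j. extend A p (v j)) = (\<lambda>j. extend A p (omit i v j))"
  by (auto simp: omit_def)

lemma tensor_field_Omega_TM: "\<psi> \<in> Omega_TM A k \<Longrightarrow> tensor_field k \<psi>"
  by (auto simp: Omega_TM_iff tensor_field_def alternating_form_multilinear)

lemma tensor_field_Omega_o:
  "\<Psi> \<in> Omega_o A g k \<Longrightarrow> tensor_field (Suc k) (\<lambda>q v. blinfun_apply (\<Psi> q v) (v k))"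
  by (auto simp: Omega_o_iff tensor_field_def multilinear_form_apply)

text \<open>The right-hand side is built from a tensor, free of the chosen fields and brackets that
  hide linearity on the left.\<close>

lemma cov_ext_deriv_TM:
  assumes \<psi>: "\<psi> \<in> Omega_TM A k"
  shows "cov_ext_deriv A D k \<psi> p v = (\<Sum>i\<le>k. (-1) ^ i *\<^sub>R nabla_at k \<psi> p (v i) (omit i v))"
proof -
  define \<xi> where "\<xi> = (\<lambda>i. extend A p (v i))"
  define M where "M i j = D (\<xi> i) (\<xi> j) p" for i j
  have vf: "vector_field A (\<xi> i)" for i by (simp add: \<xi>_def vector_field_extend)
  have vfo: "vector_field A (omit i \<xi> j)" for i j by (simp add: \<xi>_def omit_extend vector_field_extend)
  have at: "\<xi> i p = v i" "omit i \<xi> j p = omit i v j" for i j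
    by (simp_all add: \<xi>_def omit_extend extend_at)
  have alt: "alternating_form k (\<psi> p)" for p using \<psi> by (simp add: Omega_TM_iff)
  have 1: "D (\<xi> i) (\<lambda>q. \<psi> q (omit i (\<lambda>j. \<xi> j q))) p
      = nabla_at k \<psi> p (v i) (omit i v) + (\<Sum>j<k. \<psi> p ((omit i v)(j := omit i (M i) j)))" for i
  proof -
    have "D (\<xi> i) (omit i \<xi> j) p = omit i (M i) j" for j
      by (simp add: M_def omit_def)
    then have "nabla k \<psi> (\<xi> i) (omit i \<xi>) p = D (\<xi> i) (\<lambda>q. \<psi> q (omit i (\<lambda>j. \<xi> j q))) p
        - (\<Sum>j<k. \<psi> p ((omit i v)(j := omit i (M i) j)))"
      by (simp add: nabla_def omit_fields at)
    then show ?thesis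
      using nabla_eq_nabla_at[where U = "omit i \<xi>" and X = "\<xi> i" and p = p, OF tensor_field_Omega_TM[OF \<psi>] vf vfo] by (simp add: at)
  qed
  have 2: "lie_bracket A (\<xi> i) (\<xi> j) p = M i j - M j i" for i j
    by (simp add: D_torsion_free vf M_def)
  show ?thesis
    using alternating_form_bracket_sum[OF alt[of p], of v M]
    by (simp add: cov_ext_deriv_def Let_def flip: \<xi>_def) (simp add: 1 2 scaleR_add_right sum.distrib)
qed

text \<open>Evaluation on \<open>w\<close> adds a slot, in which \<open>W\<close> is differentiated
  as well; the resulting extra correction term is the one that \<open>conn_End\<close>
  subtracts.\<close>

lemma cov_ext_deriv_End:
  assumes \<Psi>: "\<Psi> \<in> Omega_o A g k"
  shows "blinfun_apply (cov_ext_deriv A (conn_End A D) k \<Psi> p v) w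
    = (\<Sum>i\<le>k. (-1) ^ i *\<^sub>R nabla_at (Suc k) (\<lambda>q v. blinfun_apply (\<Psi> q v) (v k)) p (v i) ((omit i v)(k := w)))"
proof -
  let ?T = "\<lambda>q v. blinfun_apply (\<Psi> q v) (v k)"
  define \<xi> where "\<xi> = (\<lambda>i. extend A p (v i))"
  define W where "W = extend A p w"
  define M where "M i j = D (\<xi> i) (\<xi> j) p" for i j
  have vf: "vector_field A (\<xi> i)" "vector_field A W" for i by (simp_all add: \<xi>_def W_def vector_field_extend)
  have vfo: "vector_field A (((omit i \<xi>)(k := W)) j)" for i j
    by (simp add: \<xi>_def W_def omit_extend vector_field_extend)
  have at: "\<xi> i p = v i" "omit i \<xi> j p = omit i v j" "W p = w" for i j
    by (simp_all add: \<xi>_def W_def omit_extend extend_at)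
  have alt: "alternating_form k (\<Psi> p)" for p using \<Psi> by (simp add: Omega_o_iff)
  have upd: "\<Psi> q (u(k := y)) = \<Psi> q u" for q u y by (rule alternating_form_cong[OF alt]) auto
  have ef: "endo_field (\<lambda>q. \<Psi> q (omit i (\<lambda>j. \<xi> j q)))" for i
    using \<Psi> by (simp add: endo_field_def Omega_o_iff omit_fields) (simp add: \<xi>_def omit_extend vector_field_extend)
  have 1: "blinfun_apply (conn_End A D (\<xi> i) (\<lambda>q. \<Psi> q (omit i (\<lambda>j. \<xi> j q))) p) w
      = nabla_at (Suc k) ?T p (v i) ((omit i v)(k := w))
        + (\<Sum>j<k. \<Psi> p ((omit i v)(j := omit i (M i) j)) w)" for i
  proof -
    let ?U = "(omit i \<xi>)(k := W)"
    have U: "(\<lambda>j. ?U j q) = (omit i (\<lambda>j. \<xi> j q))(k := W q)" for q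
      by (auto simp: fun_eq_iff omit_fields)
    have Up: "(\<lambda>j. ?U j p) = (omit i v)(k := w)"
      by (auto simp: fun_eq_iff at)
    have "?T p ((\<lambda>l. ?U l p)(j := D (\<xi> i) (?U j) p)) = \<Psi> p ((omit i v)(j := omit i (M i) j)) w" if "j < k" for j
    proof -
      have "D (\<xi> i) (?U j) p = omit i (M i) j" using that by (simp add: M_def omit_def)
      moreover have "(omit i v)(k := w, j := y) = (omit i v)(j := y, k := w)" for y
        using that by (auto simp: fun_eq_iff)
      ultimately show ?thesis using that unfolding Up by (simp add: upd)
    qed
    moreover have "?T p ((\<lambda>l. ?U l p)(k := D (\<xi> i) (?U k) p)) = \<Psi> p (omit i v) (D (\<xi> i) W p)"
      unfolding Up by (simp add: upd)
    ultimately have "nabla (Suc k) ?T (\<xi> i) ?U p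
        = D (\<xi> i) (\<lambda>q. \<Psi> q (omit i (\<lambda>j. \<xi> j q)) (W q)) p
          - ((\<Sum>j<k. \<Psi> p ((omit i v)(j := omit i (M i) j)) w) + \<Psi> p (omit i v) (D (\<xi> i) W p))"
      unfolding nabla_def U by (simp add: upd)
    moreover have "nabla (Suc k) ?T (\<xi> i) ?U p = nabla_at (Suc k) ?T p (v i) ((omit i v)(k := w))"
      using nabla_eq_nabla_at[where U = ?U and X = "\<xi> i" and p = p, OF tensor_field_Omega_o[OF \<Psi>] vf(1) vfo] unfolding Up at .
    moreover have "blinfun_apply (conn_End A D (\<xi> i) (\<lambda>q. \<Psi> q (omit i (\<lambda>j. \<xi> j q))) p) w
        = D (\<xi> i) (\<lambda>q. \<Psi> q (omit i (\<lambda>j. \<xi> j q)) (W q)) p - \<Psi> p (omit i v) (D (\<xi> i) W p)"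
      using conn_End_apply[where X = "\<xi> i" and p = p, OF vf(1) ef vf(2)] by (simp add: at)
    ultimately show ?thesis by simp
  qed
  have 2: "lie_bracket A (\<xi> i) (\<xi> j) p = M i j - M j i" for i j
    by (simp add: D_torsion_free vf M_def)
  show ?thesis
    using alternating_form_bracket_sum[OF alternating_form_blinfunD[OF alt[of p], of w], of v M]
    by (simp add: cov_ext_deriv_def Let_def flip: \<xi>_def)
      (simp add: 1 2 scaleR_add_right sum.distrib blinfun.add_left blinfun.sum_left blinfun.scaleR_left)
qed

section \<open>The two components of the deformation derivative\<close>

lemma fst_d_deform:
  "fst (d_deform A D k (AM_col \<psi> \<Psi>) p v)
    = cov_ext_deriv A D k \<psi> p v - (\<Sum>i\<le>k. (-1) ^ i *\<^sub>R blinfun_apply (\<Psi> p (omit i v)) (v i))"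
  \<comment> \<open>The deformation connection is the direct sum of \<open>D\<close> and
    \<open>conn_End\<close> plus terms without derivatives, and the bracket terms involve no
    connection, so everything splits termwise.\<close>
  by (simp add: cov_ext_deriv_def deformation_conn_def AM_col_def Let_def fst_sum extend_at
      scaleR_diff_right sum_subtractf)

lemma snd_d_deform:
  "snd (d_deform A D k (AM_col \<psi> \<Psi>) p v)
    = cov_ext_deriv A (conn_End A D) k \<Psi> p v - (\<Sum>i\<le>k. (-1) ^ i *\<^sub>R curvature A D p (v i) (\<psi> p (omit i v)))"
  by (simp add: cov_ext_deriv_def deformation_conn_def AM_col_def Let_def snd_sum extend_at
      scaleR_diff_right sum_subtractf)

text \<open>Skew endomorphisms form a subspace, and every summand lies in it: covariant derivatives
  by \<open>conn_End_skew\<close>, bracket terms as values of \<Psi>.\<close>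

lemma cov_ext_deriv_End_skew:
  assumes \<Psi>: "\<Psi> \<in> Omega_o A g k"
  shows "g p (blinfun_apply (cov_ext_deriv A (conn_End A D) k \<Psi> p v) x) y
    = - g p x (blinfun_apply (cov_ext_deriv A (conn_End A D) k \<Psi> p v) y)"
proof -
  let ?skew = "\<lambda>B :: 'e \<Rightarrow>\<^sub>L 'e. \<forall>x y. g p (blinfun_apply B x) y = - g p x (blinfun_apply B y)"
  have skew: "?skew (\<Psi> p v)" for v using \<Psi> unfolding Omega_o_iff by blast
  have scale: "?skew (r *\<^sub>R B)" if "?skew B" for r B
    using that by (simp add: blinfun.scaleR_left g_scale_left g_scale_right)
  have add: "?skew (B + C)" if "?skew B" "?skew C" for B C
    using that by (simp add: blinfun.add_left g_add_left g_add_right)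
  have sum: "?skew (\<Sum>i\<in>I. B i)" if "\<And>i. i \<in> I \<Longrightarrow> ?skew (B i)" for I and B :: "nat \<Rightarrow> 'e \<Rightarrow>\<^sub>L 'e"
    using that
  proof (induction I rule: infinite_finite_induct)
    case (insert i I)
    then show ?case using add[of "B i" "\<Sum>i\<in>I. B i"] by (simp only: sum.insert insert_iff simp_thms)
  qed (simp_all add: g_zero_left g_zero_right)
  define \<xi> where "\<xi> = (\<lambda>i. extend A p (v i))"
  have ef: "endo_field (\<lambda>q. \<Psi> q (omit i (\<lambda>j. \<xi> j q)))" for i
    using \<Psi> by (simp add: endo_field_def Omega_o_iff omit_fields) (simp add: \<xi>_def omit_extend vector_field_extend)
  have conn: "?skew (conn_End A D (\<xi> i) (\<lambda>q. \<Psi> q (omit i (\<lambda>j. \<xi> j q))) p)" for i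
    by (intro allI conn_End_skew ef) (use \<Psi> in \<open>auto simp: \<xi>_def vector_field_extend Omega_o_iff\<close>)
  have "?skew (cov_ext_deriv A (conn_End A D) k \<Psi> p v)"
    unfolding cov_ext_deriv_def Let_def \<xi>_def[symmetric]
    by (intro add sum scale conn skew)
  then show ?thesis by blast
qed

text \<open>\<open>?N\<close> joins derivative and curvature into one expression, linear in the
  direction \<open>x\<close> and alternating in \<open>v\<close>. So
  \<open>alternating_form_wedge\<close> gives alternation, and smoothness comes from
  \<open>nabla\<close> and \<open>curv\<close> on fields.\<close>

lemma snd_d_deform_in_Omega_o:
  assumes \<psi>: "\<psi> \<in> Omega_TM A k" and \<Psi>: "\<Psi> \<in> Omega_o A g k"
  shows "(\<lambda>p v. snd (d_deform A D k (AM_col \<psi> \<Psi>) p v)) \<in> Omega_o A g (Suc k)"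
proof -
  let ?T = "\<lambda>q v. blinfun_apply (\<Psi> q v) (v k)"
  let ?N = "\<lambda>p w x v. nabla_at (Suc k) ?T p x (v(k := w)) - blinfun_apply (curvature A D p x (\<psi> p v)) w"
  note T = tensor_field_Omega_o[OF \<Psi>]
  have alt\<Psi>: "alternating_form k (\<Psi> p)" for p using \<Psi> by (simp add: Omega_o_iff)
  have alt\<psi>: "alternating_form k (\<psi> p)" for p using \<psi> by (simp add: Omega_TM_iff)
  have B: "blinfun_apply (snd (d_deform A D k (AM_col \<psi> \<Psi>) p v)) w
      = (\<Sum>i\<le>k. (-1) ^ i *\<^sub>R ?N p w (v i) (omit i v))" for p v w
    unfolding snd_d_deform
    by (simp add: blinfun.diff_left blinfun.sum_left blinfun.scaleR_left cov_ext_deriv_End[OF \<Psi>]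
        scaleR_diff_right sum_subtractf)
  have altN: "alternating_form k (?N p w x)" for p w x
    unfolding alternating_form_def
  proof (intro conjI allI impI)
    fix u v :: "nat \<Rightarrow> 'e" assume eq: "\<forall>i<k. u i = v i"
    have "nabla_at (Suc k) ?T p x (u(k := w)) = nabla_at (Suc k) ?T p x (v(k := w))"
      by (rule multilinear_form_cong[OF nabla_at_multilinear[OF T]]) (use eq in auto)
    moreover have "\<psi> p u = \<psi> p v" by (rule alternating_form_cong[OF alt\<psi>]) (use eq in auto)
    ultimately show "?N p w x u = ?N p w x v" by simp
  next
    fix v :: "nat \<Rightarrow> 'e" and i assume i: "i < k"
    have "linear (\<lambda>y. nabla_at (Suc k) ?T p x ((v(k := w))(i := y)))"
      by (rule multilinear_form_linear[OF nabla_at_multilinear[OF T]]) (use i in auto)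
    moreover have "(v(k := w))(i := y) = (v(i := y))(k := w)" for y using i by (auto simp: fun_eq_iff)
    ultimately have l1: "linear (\<lambda>y. nabla_at (Suc k) ?T p x ((v(i := y))(k := w)))" by (simp only:)
    have l2: "linear (\<lambda>y. blinfun_apply (curvature A D p x (\<psi> p (v(i := y)))) w)"
      using linear_compose[OF alternating_form_linear[OF alt\<psi> i] curvature_linear_2] by (simp add: comp_def)
    show "linear (\<lambda>y. ?N p w x (v(i := y)))" by (rule linear_compose_sub[OF l1 l2])
  next
    fix v :: "nat \<Rightarrow> 'e" and i j assume ij: "i < j \<and> j < k \<and> v i = v j"
    \<comment> \<open>Writing \<open>w\<close> into slot \<open>k\<close> does not touch the slots
      \<open>i < j < k\<close>, so the repeated entry survives.\<close>
    have "nabla_at (Suc k) ?T p x (v(k := w)) = 0"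
    proof (rule nabla_at_alternating[OF T])
      show "?T q u = 0" if "u i = u j" for q u
        using alternating_form_eq_0[OF alt\<Psi>, of i j u q] ij that by simp
    qed (use ij in auto)
    moreover have "\<psi> p v = 0" using alternating_form_eq_0[OF alt\<psi>] ij by blast
    ultimately show "?N p w x v = 0" by (simp add: linear_0[OF curvature_linear_2])
  qed
  have linN: "linear (\<lambda>x. ?N p w x v)" for p w v
    by (intro linear_compose_sub nabla_at_linear[OF T] curvature_linear_1)
  show ?thesis unfolding Omega_o_iff
  proof (intro conjI allI impI)
    fix p
    show "alternating_form (Suc k) (\<lambda>v. snd (d_deform A D k (AM_col \<psi> \<Psi>) p v))"
      by (rule alternating_form_blinfunI) (unfold B, rule alternating_form_wedge[OF altN linN])
  next
    fix p v x y
    show "g p (blinfun_apply (snd (d_deform A D k (AM_col \<psi> \<Psi>) p v)) x) y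
      = - g p x (blinfun_apply (snd (d_deform A D k (AM_col \<psi> \<Psi>) p v)) y)"
    proof -
      have "g p (blinfun_apply (\<Sum>i\<le>k. (-1) ^ i *\<^sub>R curvature A D p (v i) (\<psi> p (omit i v))) x) y
        = - g p x (blinfun_apply (\<Sum>i\<le>k. (-1) ^ i *\<^sub>R curvature A D p (v i) (\<psi> p (omit i v))) y)"
        by (simp add: blinfun.sum_left blinfun.scaleR_left bilinear_sum_left[OF g_bilinear]
            bilinear_sum_right[OF g_bilinear] g_scale_left g_scale_right curvature_skew[of p _ _ x y] sum_negf)
      then show ?thesis
        unfolding snd_d_deform
        by (simp add: blinfun.diff_left g_diff_left g_diff_right cov_ext_deriv_End_skew[OF \<Psi>, of p v x y])
    qed
  next
    fix U :: "nat \<Rightarrow> 'm \<Rightarrow> 'e" and Y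
    assume U: "\<forall>i. vector_field A (U i)" and Y: "vector_field A Y"
    have Uo: "vector_field A (omit i U j)" for i j using U by (simp add: omit_def)
    have "vector_field A (\<lambda>q. ?N q (Y q) (U i q) (omit i (\<lambda>j. U j q)))" for i
    proof (rule vector_field_diff)
      have V: "vector_field A (((omit i U)(k := Y)) j)" for j using Uo Y by simp
      have "(omit i (\<lambda>j. U j q))(k := Y q) = (\<lambda>j. ((omit i U)(k := Y)) j q)" for q
        by (auto simp: fun_eq_iff omit_fields)
      then have "nabla_at (Suc k) ?T q (U i q) ((omit i (\<lambda>j. U j q))(k := Y q))
          = nabla (Suc k) ?T (U i) ((omit i U)(k := Y)) q" for q
        using nabla_eq_nabla_at[where U = "(omit i U)(k := Y)" and X = "U i" and p = q, OF T U[rule_format] V]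
        by (simp only:)
      then show "vector_field A (\<lambda>q. nabla_at (Suc k) ?T q (U i q) ((omit i (\<lambda>j. U j q))(k := Y q)))"
        using vector_field_nabla[where U = "(omit i U)(k := Y)", OF T U[rule_format] V] by (simp only:)
      have P: "vector_field A (\<lambda>q. \<psi> q (omit i (\<lambda>j. U j q)))"
        using \<psi> Uo by (simp add: omit_fields Omega_TM_iff)
      have "(\<lambda>q. blinfun_apply (curvature A D q (U i q) (\<psi> q (omit i (\<lambda>j. U j q)))) (Y q))
          = curv (U i) (\<lambda>q. \<psi> q (omit i (\<lambda>j. U j q))) Y"
        using curvature_apply[OF _ P Y] U by (simp add: fun_eq_iff)
      then show "vector_field A (\<lambda>q. blinfun_apply (curvature A D q (U i q) (\<psi> q (omit i (\<lambda>j. U j q)))) (Y q))"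
        using vector_field_curv[OF _ P Y] U by simp
    qed
    then show "vector_field A (\<lambda>q. blinfun_apply (snd (d_deform A D k (AM_col \<psi> \<Psi>) q (\<lambda>i. U i q))) (Y q))"
      unfolding B by (intro vector_field_sum vector_field_cmult)
  qed
qed

section \<open>Vectors and endomorphisms given by linear and bilinear forms\<close>

definition riesz :: "'m \<Rightarrow> ('e \<Rightarrow> real) \<Rightarrow> 'e" where
  "riesz p a = (THE w. \<forall>z. g p w z = a z)"

text \<open>\<open>?f\<close> collects the components of \<open>g p w\<close>. It is injective by
  definiteness, hence surjective in finite dimension, so the description in \<open>riesz\<close> is
  satisfied by exactly one vector.\<close>

lemma g_riesz:
  assumes a: "linear a"
  shows "g p (riesz p a) z = a z"
proof -
  let ?f = "\<lambda>w. \<Sum>b\<in>Basis. g p w b *\<^sub>R b"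
  have gl: "linear (g p w)" "linear (\<lambda>w. g p w z)" for w z using g_bilinear by (simp_all add: bilinear_def)
  have f: "linear ?f"
    by (rule linearI) (simp_all add: g_add_left g_scale_left scaleR_add_left sum.distrib scaleR_sum_right)
  have coord: "?f w \<bullet> b = g p w b" if "b \<in> Basis" for w b
    using that by (simp add: inner_sum_left_Basis)
  have "inj ?f"
  proof (rule injI)
    fix w w' assume eq: "?f w = ?f w'"
    have "g p w b = g p w' b" if "b \<in> Basis" for b using coord[OF that] eq by metis
    then have "g p w = g p w'" by (rule linear_eq_stdbasis[OF gl(1) gl(1)])
    then show "w = w'" by (intro g_cancel[of p]) simp
  qed
  then have surj: "surj ?f" by (intro linear_injective_imp_surjective[OF f]) auto
  define w where "w = inv ?f (\<Sum>b\<in>Basis. a b *\<^sub>R b)"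
  have w: "?f w = (\<Sum>b\<in>Basis. a b *\<^sub>R b)" unfolding w_def by (rule surj_f_inv_f[OF surj])
  have "g p w b = a b" if "b \<in> Basis" for b
    using coord[OF that, of w] that unfolding w by (simp add: inner_sum_left_Basis)
  then have "g p w = a" by (rule linear_eq_stdbasis[OF gl(1) a])
  then have ex: "\<forall>z. g p w z = a z" by simp
  have "riesz p a = w" unfolding riesz_def
  proof (rule the_equality)
    show "\<forall>z. g p w z = a z" by (rule ex)
    show "w' = w" if "\<forall>z. g p w' z = a z" for w'
      by (rule g_cancel[of p]) (simp add: that ex)
  qed
  then show ?thesis using ex by simp
qed

lemma g_Blinfun_riesz:
  fixes a :: "'e \<Rightarrow> 'e \<Rightarrow> real"
  assumes a: "\<And>x. linear (a x)" and a': "\<And>z. linear (\<lambda>x. a x z)"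
  shows "g p (blinfun_apply (Blinfun (\<lambda>x. riesz p (a x))) x) z = a x z"
proof -
  have "linear (\<lambda>x. riesz p (a x))"
    by (rule linearI; rule g_cancel[of p])
      (simp_all add: g_riesz[OF a] g_add_left g_scale_left linear_add[OF a'] linear_scale[OF a'])
  then have "bounded_linear (\<lambda>x. riesz p (a x))" by (simp add: linear_conv_bounded_linear)
  then show ?thesis by (simp add: bounded_linear_Blinfun_apply g_riesz[OF a])
qed

section \<open>The splitting operator in degree 0\<close>

definition skew_part :: "('m \<Rightarrow> 'e) \<Rightarrow> 'm \<Rightarrow> 'e \<Rightarrow>\<^sub>L 'e" where
  "skew_part X p = Blinfun (\<lambda>x. riesz p (\<lambda>z.
     (1 / 2) * (g p (D (extend A p x) X p) z - g p x (D (extend A p z) X p))))"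

lemma D_extend_linear: "vector_field A X \<Longrightarrow> linear (\<lambda>x. D (extend A p x) X p)"
  by (intro tensorial_at_linear D_tensorial)

lemma D_extend: "vector_field A X \<Longrightarrow> vector_field A Y \<Longrightarrow> D (extend A p (Y p)) X p = D Y X p"
  by (rule tensorial_at_extend[OF D_tensorial])

text \<open>Working with the bilinear form and its transpose avoids constructing the adjoint of the
  endomorphism \<open>x \<mapsto> D (extend A p x) X p\<close>.\<close>

lemma g_skew_part:
  assumes X: "vector_field A X"
  shows "g p (blinfun_apply (skew_part X p) x) z
    = (1 / 2) * (g p (D (extend A p x) X p) z - g p x (D (extend A p z) X p))"
proof -
  note l = D_extend_linear[OF X, of p]
  let ?a = "\<lambda>x z. (1 / 2) * (g p (D (extend A p x) X p) z - g p x (D (extend A p z) X p))"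
  have "linear (?a x)" for x
    by (rule linearI) (simp_all add: g_add_right g_scale_right linear_add[OF l] linear_scale[OF l] algebra_simps)
  moreover have "linear (\<lambda>x. ?a x z)" for z
    by (rule linearI)
      (simp_all add: g_add_left g_scale_left linear_add[OF l] linear_scale[OF l] algebra_simps)
  ultimately show ?thesis unfolding skew_part_def by (rule g_Blinfun_riesz)
qed

lemma smooth_fun_diff: "smooth_fun A f \<Longrightarrow> smooth_fun A h \<Longrightarrow> smooth_fun A (\<lambda>q. f q - h q)"
  using smooth_fun_add[of f "\<lambda>q. (-1) * h q"] smooth_fun_mult[OF smooth_fun_const[of "-1"], of h] by simp

lemma skew_part_in_Omega_o:
  assumes X: "vector_field A X"
  shows "(\<lambda>p _. skew_part X p) \<in> Omega_o A g 0"
  unfolding Omega_o_iff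
proof (intro conjI allI impI)
  show "alternating_form 0 (\<lambda>_. skew_part X p)" for p by (simp add: alternating_form_def)
  show "g p (skew_part X p x) y = - g p x (skew_part X p y)" for p x y
    using g_sym[of p x "skew_part X p y"] g_sym[of p x "D (extend A p y) X p"] g_sym[of p y "D (extend A p x) X p"]
    unfolding g_skew_part[OF X] by argo
  show "vector_field A (\<lambda>q. skew_part X q (Y q))" if Y: "vector_field A Y" for Y
  proof (rule vector_field_riesz)
    fix Z assume Z: "vector_field A Z"
    \<comment> \<open>On fields \<open>Y\<close> and \<open>Z\<close> the chosen extensions
      disappear by \<open>D_extend\<close>, and only inner products of smooth fields remain.\<close>
    have "smooth_fun A (\<lambda>q. (1 / 2) * (g q (D Y X q) (Z q) - g q (Y q) (D Z X q)))"
      by (intro smooth_fun_mult smooth_fun_const smooth_fun_diff smooth_fun_metric D_field X Y Z)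
    then show "smooth_fun A (\<lambda>q. g q (skew_part X q (Y q)) (Z q))"
      by (simp add: g_skew_part[OF X] D_extend X Y Z)
  qed
qed

lemma AM_col_fst_snd: "AM_col (\<lambda>p v. fst (F p v)) (\<lambda>p v. snd (F p v)) = F"
  by (simp add: AM_col_def)

lemma Gamma_H1_plus_o_iff:
  "F \<in> Gamma_H1_plus_o A g \<longleftrightarrow> (\<lambda>p v. fst (F p v)) \<in> Gamma_H1 A g \<and> (\<lambda>p v. snd (F p v)) \<in> Omega_o A g 1"
proof
  assume "(\<lambda>p v. fst (F p v)) \<in> Gamma_H1 A g \<and> (\<lambda>p v. snd (F p v)) \<in> Omega_o A g 1"
  then show "F \<in> Gamma_H1_plus_o A g"
    unfolding Gamma_H1_plus_o_def using AM_col_fst_snd[of F, symmetric] by blast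
qed (auto simp: Gamma_H1_plus_o_def AM_col_def)

lemma Omega_o_in_AM_iff:
  "F \<in> Omega_o_in_AM A g k \<longleftrightarrow> (\<forall>p v. fst (F p v) = 0) \<and> (\<lambda>p v. snd (F p v)) \<in> Omega_o A g k"
proof
  assume "(\<forall>p v. fst (F p v) = 0) \<and> (\<lambda>p v. snd (F p v)) \<in> Omega_o A g k"
  then have "F = AM_col (\<lambda>_ _. 0) (\<lambda>p v. snd (F p v))" by (simp add: AM_col_def prod_eq_iff fun_eq_iff)
  then show "F \<in> Omega_o_in_AM A g k"
    unfolding Omega_o_in_AM_def using \<open>_ \<and> _\<close> by blast
qed (auto simp: Omega_o_in_AM_def AM_col_def)

lemma Omega_TM_0:
  assumes "vector_field A X"
  shows "(\<lambda>p _. X p) \<in> Omega_TM A 0"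
  using assms by (simp add: Omega_TM_iff alternating_form_def)

lemma fst_d_deform_0:
  "fst (d_deform A D 0 (AM_col (\<lambda>p _. X p) \<Phi>) p v) = D (extend A p (v 0)) X p - blinfun_apply (\<Phi> p (omit 0 v)) (v 0)"
  unfolding fst_d_deform by (simp add: cov_ext_deriv_def)

lemma splitting_0:
  assumes X: "vector_field A X" and \<Phi>: "\<Phi> \<in> Omega_o A g 0"
  shows "d_deform A D 0 (AM_col (\<lambda>p _. X p) \<Phi>) \<in> Gamma_H1_plus_o A g \<longleftrightarrow> \<Phi> = (\<lambda>p _. skew_part X p)"
proof
  assume "d_deform A D 0 (AM_col (\<lambda>p _. X p) \<Phi>) \<in> Gamma_H1_plus_o A g"
  then have sym: "g p (D (extend A p x) X p - \<Phi> p (omit 0 (\<lambda>_. x)) x) y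
      = g p x (D (extend A p y) X p - \<Phi> p (omit 0 (\<lambda>_. y)) y)" for p x y
    by (simp add: Gamma_H1_plus_o_iff Gamma_H1_def fst_d_deform_0)
  \<comment> \<open>A 0-form is constant in its sequence, so the different arguments
    \<open>omit 0 _\<close> in \<open>sym\<close> can be identified.\<close>
  have c: "\<Phi> p u = \<Phi> p v" for p u v
    using \<Phi> by (auto simp: Omega_o_iff intro: alternating_form_cong)
  have skew: "g p (\<Phi> p v x) y = - g p x (\<Phi> p v y)" for p v x y
    using \<Phi> unfolding Omega_o_iff by blast
  have "g p (\<Phi> p v x) y = g p (skew_part X p x) y" for p v x y
    using sym[of p x y] skew[of p v x y]
    unfolding c[of p "omit 0 (\<lambda>_. x)" v] c[of p "omit 0 (\<lambda>_. y)" v] g_skew_part[OF X] g_diff_left g_diff_right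
    by argo
  then show "\<Phi> = (\<lambda>p _. skew_part X p)"
    by (intro ext blinfun_eqI g_cancel) auto
next
  assume \<Phi>_eq: "\<Phi> = (\<lambda>p _. skew_part X p)"
  note l = D_extend_linear[OF X]
  let ?\<psi> = "\<lambda>p v. fst (d_deform A D 0 (AM_col (\<lambda>p _. X p) \<Phi>) p v)"
  have eq: "?\<psi> p v = D (extend A p (v 0)) X p - skew_part X p (v 0)" for p v
    by (simp add: fst_d_deform_0 \<Phi>_eq)
  have "?\<psi> \<in> Omega_TM A 1"
    unfolding Omega_TM_iff eq
  proof (intro conjI allI impI)
    show "alternating_form 1 (\<lambda>v. D (extend A p (v 0)) X p - skew_part X p (v 0))" for p
      by (auto simp: alternating_form_def l blinfun.bounded_linear_right bounded_linear.linear
          intro!: linear_compose_sub)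
    show "vector_field A (\<lambda>q. D (extend A q (U 0 q)) X q - skew_part X q (U 0 q))"
      if "\<forall>i. vector_field A (U i)" for U
      using that skew_part_in_Omega_o[OF X] by (auto simp: D_extend X Omega_o_iff intro!: vector_field_diff D_field)
  qed
  moreover have "g p (D (extend A p x) X p - skew_part X p x) y = g p x (D (extend A p y) X p - skew_part X p y)"
    for p x y
    using g_sym[of p x "skew_part X p y"] g_sym[of p x "D (extend A p y) X p"] g_sym[of p y "D (extend A p x) X p"]
    unfolding g_diff_left g_diff_right g_skew_part[OF X] by argo
  ultimately have "?\<psi> \<in> Gamma_H1 A g"
    unfolding Gamma_H1_def mem_Collect_eq eq by blast
  moreover have "(\<lambda>p v. snd (d_deform A D 0 (AM_col (\<lambda>p _. X p) \<Phi>) p v)) \<in> Omega_o A g 1"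
    using snd_d_deform_in_Omega_o[OF Omega_TM_0[OF X] \<Phi>] by simp
  ultimately show "d_deform A D 0 (AM_col (\<lambda>p _. X p) \<Phi>) \<in> Gamma_H1_plus_o A g"
    by (simp add: Gamma_H1_plus_o_iff)
qed

text \<open>Turning the two conditions into one equation settles both the unique existence and the
  description operator in \<open>L0\<close>.\<close>

lemma splitting_0_unique:
  assumes X: "vector_field A X"
  shows "\<Phi> \<in> Omega_o A g 0 \<and> d_deform A D 0 (AM_col (\<lambda>p _. X p) \<Phi>) \<in> Gamma_H1_plus_o A g
    \<longleftrightarrow> \<Phi> = (\<lambda>p _. skew_part X p)"
  using splitting_0[OF X] skew_part_in_Omega_o[OF X] by blast

lemma L0_eq:
  assumes X: "vector_field A X"
  shows "L0 A g D (\<lambda>p _. X p) = AM_col (\<lambda>p _. X p) (\<lambda>p _. skew_part X p)"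
  by (simp add: L0_def splitting_0_unique[OF X])

lemma same_1jet_value:
  assumes "same_1jet A p \<psi> \<psi>'"
  shows "\<psi> p v = \<psi>' p v"
  using assms
  by (simp add: same_1jet_def Let_def form_rep_def field_rep_chart chart_at_in in_chart_at
      to_chart_chart_at of_chart_chart_at)

lemma L0_diff_op: "linear_first_order_diff_op A (Gamma_H0 A) (Omega_AM A g 0) (L0 A g D)"
  unfolding linear_first_order_diff_op_def
proof (intro conjI ballI allI impI)
  fix s assume "s \<in> Gamma_H0 A"
  then obtain X where X: "vector_field A X" and s: "s = (\<lambda>p _. X p)" by (auto simp: Gamma_H0_def)
  show "L0 A g D s \<in> Omega_AM A g 0"
    unfolding s L0_eq[OF X] Omega_AM_def using Omega_TM_0[OF X] skew_part_in_Omega_o[OF X] by blast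
  show "L0 A g D (\<lambda>p v. a *\<^sub>R s p v) = (\<lambda>p v. a *\<^sub>R L0 A g D s p v)" for a
  proof -
    note aX = vector_field_cmult[OF X, of a]
    have "skew_part (\<lambda>q. a *\<^sub>R X q) p = a *\<^sub>R skew_part X p" for p
      by (rule blinfun_eqI, rule g_cancel[of p])
        (simp add: g_skew_part X aX blinfun.scaleR_left g_scale_left g_scale_right D_cmult_right
          vector_field_extend algebra_simps)
    then show ?thesis unfolding s L0_eq[OF X] L0_eq[OF aX] by (simp add: AM_col_def)
  qed
  fix t assume "t \<in> Gamma_H0 A"
  then obtain Y where Y: "vector_field A Y" and t: "t = (\<lambda>p _. Y p)" by (auto simp: Gamma_H0_def)
  show "L0 A g D (\<lambda>p v. s p v + t p v) = (\<lambda>p v. L0 A g D s p v + L0 A g D t p v)"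
  proof -
    note XY = vector_field_add[OF X Y]
    have "skew_part (\<lambda>q. X q + Y q) p = skew_part X p + skew_part Y p" for p
      by (rule blinfun_eqI, rule g_cancel[of p])
        (simp add: g_skew_part X Y XY blinfun.add_left g_add_left g_add_right D_add_right
          vector_field_extend algebra_simps)
    then show ?thesis unfolding s t L0_eq[OF X] L0_eq[OF Y] L0_eq[OF XY] by (simp add: AM_col_def)
  qed
  fix p assume j: "same_1jet A p s t"
  \<comment> \<open>Apart from its value, the field enters \<open>L0\<close> only under one
    application of \<open>D\<close>; \<open>same_1jet\<close> is exactly the hypothesis of
    \<open>D_jet_eq\<close> in the chart at \<open>p\<close>.\<close>
  have "D Z X p = D Z Y p" if "vector_field A Z" for Z
    by (rule D_jet_eq[OF X Y that chart_at_in in_chart_at])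
      (use j in \<open>simp_all add: same_1jet_def Let_def s t form_rep_def\<close>)
  then have "skew_part X p = skew_part Y p"
    by (intro blinfun_eqI g_cancel[of p]) (simp add: g_skew_part X Y vector_field_extend)
  moreover have "X p = Y p" using same_1jet_value[OF j] by (simp add: s t)
  ultimately show "L0 A g D s p = L0 A g D t p"
    unfolding s t L0_eq[OF X] L0_eq[OF Y] by (simp add: AM_col_def)
qed

section \<open>The splitting operator in degree 1\<close>

definition ext_deriv_1 :: "('m \<Rightarrow> (nat \<Rightarrow> 'e) \<Rightarrow> 'e) \<Rightarrow> 'm \<Rightarrow> 'e \<Rightarrow> 'e \<Rightarrow> 'e" where
  "ext_deriv_1 \<psi> p x y = nabla_at 1 \<psi> p x (\<lambda>_. y) - nabla_at 1 \<psi> p y (\<lambda>_. x)"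

text \<open>Solves \<open>ext_deriv_1 \<psi> p x y = P y x - P x y\<close> for \<open>P\<close> with
  skew values. Put \<open>c x y z = g p (P x y) z\<close>: the three cyclic instances of the
  equation, taken with signs plus, minus, minus, add up to \<open>2 * c x y z\<close>. The same
  algebra recovers a metric connection from its torsion.\<close>

definition koszul :: "('m \<Rightarrow> (nat \<Rightarrow> 'e) \<Rightarrow> 'e) \<Rightarrow> 'm \<Rightarrow> 'e \<Rightarrow> 'e \<Rightarrow>\<^sub>L 'e" where
  "koszul \<psi> p x = Blinfun (\<lambda>y. riesz p (\<lambda>z. (1 / 2) *
     (g p (ext_deriv_1 \<psi> p y z) x - g p (ext_deriv_1 \<psi> p z x) y - g p (ext_deriv_1 \<psi> p x y) z)))"

context
  fixes \<psi> assumes \<psi>: "\<psi> \<in> Omega_TM A 1"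
begin

text \<open>A constant sequence is the normal form for the argument of a 1-form, which reads entry 0
  only.\<close>

lemma nabla_at_1_const: "nabla_at 1 \<psi> p x v = nabla_at 1 \<psi> p x (\<lambda>_. v 0)"
  by (rule multilinear_form_cong[OF nabla_at_multilinear[OF tensor_field_Omega_TM[OF \<psi>]]]) simp

lemma ext_deriv_1_bilinear: "bilinear (ext_deriv_1 \<psi> p)"
proof -
  note T = tensor_field_Omega_TM[OF \<psi>]
  have l1: "linear (\<lambda>x. nabla_at 1 \<psi> p x v)" for v by (rule nabla_at_linear[OF T])
  have "linear (\<lambda>y. nabla_at 1 \<psi> p x ((\<lambda>_. 0)(0 := y)))" for x
    by (rule multilinear_form_linear[OF nabla_at_multilinear[OF T]]) simp
  then have l2: "linear (\<lambda>y. nabla_at 1 \<psi> p x (\<lambda>_. y))" for x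
    by (subst (asm) nabla_at_1_const) simp
  show ?thesis unfolding bilinear_def ext_deriv_1_def
    by (intro conjI allI linear_compose_sub l1 l2)
qed

lemmas ext_deriv_1_simps = bilinear_ladd[OF ext_deriv_1_bilinear] bilinear_radd[OF ext_deriv_1_bilinear]
  bilinear_lmul[OF ext_deriv_1_bilinear] bilinear_rmul[OF ext_deriv_1_bilinear]

lemma ext_deriv_1_antisym: "ext_deriv_1 \<psi> p y x = - ext_deriv_1 \<psi> p x y"
  by (simp add: ext_deriv_1_def)

lemma g_ext_deriv_1_antisym: "g p (ext_deriv_1 \<psi> p y x) z = - g p (ext_deriv_1 \<psi> p x y) z"
  by (simp add: ext_deriv_1_antisym[of p y x] g_minus_left)

lemma vector_field_ext_deriv_1:
  assumes "vector_field A X" "vector_field A Y"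
  shows "vector_field A (\<lambda>q. ext_deriv_1 \<psi> q (X q) (Y q))"
proof -
  note T = tensor_field_Omega_TM[OF \<psi>]
  have e: "nabla_at 1 \<psi> q (Z q) (\<lambda>_. W q) = nabla 1 \<psi> Z (\<lambda>_. W) q"
    if "vector_field A Z" "vector_field A W" for Z W q
    by (rule nabla_eq_nabla_at[OF T that, symmetric])
  have "vector_field A (\<lambda>q. nabla 1 \<psi> X (\<lambda>_. Y) q - nabla 1 \<psi> Y (\<lambda>_. X) q)"
    by (intro vector_field_diff vector_field_nabla T assms)
  then show ?thesis by (simp only: e[OF assms] e[OF assms(2,1)] ext_deriv_1_def)
qed

lemma g_koszul:
  "g p (blinfun_apply (koszul \<psi> p x) y) z = (1 / 2) *
     (g p (ext_deriv_1 \<psi> p y z) x - g p (ext_deriv_1 \<psi> p z x) y - g p (ext_deriv_1 \<psi> p x y) z)"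
proof -
  let ?a = "\<lambda>y z. (1 / 2) * (g p (ext_deriv_1 \<psi> p y z) x - g p (ext_deriv_1 \<psi> p z x) y - g p (ext_deriv_1 \<psi> p x y) z)"
  have a: "linear (?a y)" for y
    by (rule linearI) (simp_all add: ext_deriv_1_simps g_add_left g_scale_left g_add_right g_scale_right algebra_simps)
  have a': "linear (\<lambda>y. ?a y z)" for z
    by (rule linearI) (simp_all add: ext_deriv_1_simps g_add_left g_scale_left g_add_right g_scale_right algebra_simps)
  show ?thesis unfolding koszul_def by (rule g_Blinfun_riesz[OF a a'])
qed

lemma koszul_in_Omega_o: "(\<lambda>p v. koszul \<psi> p (v 0)) \<in> Omega_o A g 1"
  unfolding Omega_o_iff
proof (intro conjI allI impI)
  have "linear (koszul \<psi> p)" for p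
    by (rule linearI; rule blinfun_eqI; rule g_cancel[of p])
      (simp_all add: g_koszul blinfun.add_left blinfun.scaleR_left ext_deriv_1_simps g_add_left g_scale_left
        g_add_right g_scale_right algebra_simps)
  then show "alternating_form 1 (\<lambda>v. koszul \<psi> p (v 0))" for p
    by (simp add: alternating_form_def)
  \<comment> \<open>Exchanging the last two arguments in the formula negates its first term and
    sends each of the other two to the negative of the other.\<close>
  show "g p (koszul \<psi> p (v 0) x) y = - g p x (koszul \<psi> p (v 0) y)" for p v x y
    using g_sym[of p x "koszul \<psi> p (v 0) y"] g_ext_deriv_1_antisym[of p y x "v 0"]
      g_ext_deriv_1_antisym[of p y "v 0" x] g_ext_deriv_1_antisym[of p "v 0" x y]
    unfolding g_koszul by argo
  show "vector_field A (\<lambda>q. koszul \<psi> q (U 0 q) (Y q))"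
    if U: "\<forall>i. vector_field A (U i)" and Y: "vector_field A Y" for U Y
  proof (rule vector_field_riesz)
    fix Z assume Z: "vector_field A Z"
    show "smooth_fun A (\<lambda>q. g q (koszul \<psi> q (U 0 q) (Y q)) (Z q))"
      unfolding g_koszul
      by (intro smooth_fun_mult smooth_fun_const smooth_fun_diff smooth_fun_metric vector_field_ext_deriv_1 Y Z U[rule_format])
  qed
qed

lemma fst_d_deform_1:
  assumes \<Psi>: "\<Psi> \<in> Omega_o A g 1"
  shows "fst (d_deform A D 1 (AM_col \<psi> \<Psi>) p v)
    = ext_deriv_1 \<psi> p (v 0) (v 1) - (blinfun_apply (\<Psi> p (\<lambda>_. v 1)) (v 0) - blinfun_apply (\<Psi> p (\<lambda>_. v 0)) (v 1))"
proof -
  have "\<Psi> p (omit i v) = \<Psi> p (\<lambda>_. omit i v 0)" for i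
    using \<Psi> by (auto simp: Omega_o_iff intro: alternating_form_cong)
  then show ?thesis
    unfolding fst_d_deform cov_ext_deriv_TM[OF \<psi>]
    using nabla_at_1_const[of p "v 0" "omit 0 v"] nabla_at_1_const[of p "v 1" "omit 1 v"]
    by (simp add: ext_deriv_1_def omit_def)
qed

text \<open>After substitution of \<open>eq\<close> the formula consists of six terms. Skewness
  cancels four of them in pairs, and the remaining two coincide, whence the factor
  \<open>1 / 2\<close>.\<close>

lemma koszul_unique:
  assumes skew: "\<And>x y z. g p (P x y) z = - g p y (P x z)"
    and eq: "\<And>x y. ext_deriv_1 \<psi> p x y = P y x - P x y"
  shows "P x y = koszul \<psi> p x y"
proof (rule g_cancel[of p])
  fix z
  have s: "g p (P u v) w = - g p (P u w) v" for u v w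
    using skew[of u v w] g_sym[of p v] by simp
  show "g p (P x y) z = g p (koszul \<psi> p x y) z"
    unfolding g_koszul eq g_diff_left
    using s[of x y z] s[of y z x] s[of z x y] by simp
qed

lemma splitting_1:
  assumes \<Psi>: "\<Psi> \<in> Omega_o A g 1"
  shows "d_deform A D 1 (AM_col \<psi> \<Psi>) \<in> Omega_o_in_AM A g 2 \<longleftrightarrow> \<Psi> = (\<lambda>p v. koszul \<psi> p (v 0))"
proof
  assume "d_deform A D 1 (AM_col \<psi> \<Psi>) \<in> Omega_o_in_AM A g 2"
  then have z: "fst (d_deform A D 1 (AM_col \<psi> \<Psi>) p v) = 0" for p v
    by (simp add: Omega_o_in_AM_iff)
  have eq: "ext_deriv_1 \<psi> p x y = \<Psi> p (\<lambda>_. y) x - \<Psi> p (\<lambda>_. x) y" for p x y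
    \<comment> \<open>The sequence \<open>x, y, y, ...\<close> has the prescribed entries 0 and
      1.\<close>
    using z[of p "case_nat x (\<lambda>_. y)"] unfolding fst_d_deform_1[OF \<Psi>] by simp
  have skew: "g p (\<Psi> p v x) y = - g p x (\<Psi> p v y)" for p v x y
    using \<Psi> unfolding Omega_o_iff by blast
  have "\<Psi> p v = \<Psi> p (\<lambda>_. v 0)" for p v
    using \<Psi> by (auto simp: Omega_o_iff intro: alternating_form_cong)
  moreover have "\<Psi> p (\<lambda>_. x) y = koszul \<psi> p x y" for p x y
    by (rule koszul_unique[where P = "\<lambda>x y. \<Psi> p (\<lambda>_. x) y", OF skew eq])
  ultimately show "\<Psi> = (\<lambda>p v. koszul \<psi> p (v 0))"
    by (intro ext blinfun_eqI) metis
next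
  assume \<Psi>_eq: "\<Psi> = (\<lambda>p v. koszul \<psi> p (v 0))"
  \<comment> \<open>In the difference of the two formulas the terms paired with \<open>x\<close> and
    with \<open>y\<close> cancel by antisymmetry, and the one paired with \<open>z\<close>
    doubles.\<close>
  have "ext_deriv_1 \<psi> p x y = koszul \<psi> p y x - koszul \<psi> p x y" for p x y
  proof (rule g_cancel[of p])
    fix z
    show "g p (ext_deriv_1 \<psi> p x y) z = g p (koszul \<psi> p y x - koszul \<psi> p x y) z"
      using g_ext_deriv_1_antisym[of p y x z] g_ext_deriv_1_antisym[of p z x y] g_ext_deriv_1_antisym[of p z y x]
      unfolding g_diff_left g_koszul by argo
  qed
  then have "fst (d_deform A D 1 (AM_col \<psi> \<Psi>) p v) = 0" for p v
    unfolding fst_d_deform_1[OF \<Psi>] by (simp add: \<Psi>_eq)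
  moreover have "(\<lambda>p v. snd (d_deform A D 1 (AM_col \<psi> \<Psi>) p v)) \<in> Omega_o A g 2"
    using snd_d_deform_in_Omega_o[OF \<psi> \<Psi>] by (simp add: numeral_2_eq_2)
  ultimately show "d_deform A D 1 (AM_col \<psi> \<Psi>) \<in> Omega_o_in_AM A g 2"
    by (simp add: Omega_o_in_AM_iff)
qed

lemma splitting_1_unique:
  "\<Psi> \<in> Omega_o A g 1 \<and> d_deform A D 1 (AM_col \<psi> \<Psi>) \<in> Omega_o_in_AM A g 2
    \<longleftrightarrow> \<Psi> = (\<lambda>p v. koszul \<psi> p (v 0))"
  using splitting_1 koszul_in_Omega_o by blast

lemma L1_eq: "L1 A g D \<psi> = AM_col \<psi> (\<lambda>p v. koszul \<psi> p (v 0))"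
  unfolding L1_def splitting_1_unique by simp

end

text \<open>Reduces the first-order property of \<open>L1\<close> to that of the covariant
  derivative.\<close>

lemma koszul_cong:
  assumes "\<psi> \<in> Omega_TM A 1" "\<psi>' \<in> Omega_TM A 1"
    and "\<And>x y. nabla_at 1 \<psi> p x (\<lambda>_. y) = nabla_at 1 \<psi>' p x (\<lambda>_. y)"
  shows "koszul \<psi> p = koszul \<psi>' p"
  by (intro ext blinfun_eqI g_cancel[of p]) (simp add: g_koszul assms ext_deriv_1_def del: One_nat_def)

text \<open>The 1-jet of a form is that of its coefficients on constant coordinate vectors. So the
  derivative is computed on the coordinate field \<open>E y\<close>, which is such a vector near
  \<open>p\<close>, instead of \<open>extend A p y\<close>, whose shape near \<open>p\<close> is
  unknown; \<open>nabla_eq_nabla_at\<close> permits the exchange.\<close>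

lemma nabla_at_1_jet:
  assumes \<psi>: "\<psi> \<in> Omega_TM A 1" and \<psi>': "\<psi>' \<in> Omega_TM A 1" and j: "same_1jet A p \<psi> \<psi>'"
  shows "nabla_at 1 \<psi> p x (\<lambda>_. y) = nabla_at 1 \<psi>' p x (\<lambda>_. y)"
proof -
  let ?c = "chart_at A p"
  have c: "?c \<in> A" "p \<in> fst ?c" by (auto simp: chart_at_in in_chart_at)
  obtain E N where N: "open N" "p \<in> N" "N \<subseteq> fst ?c" and E: "\<And>v. vector_field A (E v)"
    and EN: "\<And>q v. q \<in> N \<Longrightarrow> E v q = of_chart A ?c q v"
    by (rule coordinate_fields[OF c], rule that)
  let ?S = "snd ?c ` (fst ?c \<inter> N)"
  have S: "open ?S" by (rule open_chart_image[OF c(1) N(1)])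
  have pS: "snd ?c p \<in> ?S" using c N by auto
  have Ep: "E y p = y" using N by (simp add: EN of_chart_chart_at)
  let ?X = "extend A p x"
  have n: "nabla_at 1 \<phi> p x (\<lambda>_. y) = D ?X (\<lambda>q. \<phi> q (\<lambda>_. E y q)) p - \<phi> p (\<lambda>_. D ?X (E y) p)"
    if \<phi>: "\<phi> \<in> Omega_TM A 1" for \<phi>
  proof -
    have "nabla 1 \<phi> ?X (\<lambda>_. E y) p = nabla_at 1 \<phi> p x (\<lambda>_. y)"
      using nabla_eq_nabla_at[OF tensor_field_Omega_TM[OF \<phi>] vector_field_extend E] by (simp add: extend_at Ep)
    moreover have "\<phi> p ((\<lambda>_. E y p)(0 := D ?X (E y) p)) = \<phi> p (\<lambda>_. D ?X (E y) p)"
      using \<phi> by (auto simp: Omega_TM_iff intro: alternating_form_cong)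
    ultimately show ?thesis by (simp add: nabla_def)
  qed
  have rep: "field_rep A ?c (\<lambda>q. \<phi> q (\<lambda>_. E y q)) z = form_rep A ?c \<phi> (\<lambda>_. y) z" if "z \<in> ?S" for \<phi> z
    using that c by (auto simp: form_rep_def field_rep_chart EN)
  have vf: "vector_field A (\<lambda>q. \<phi> q (\<lambda>_. E y q))" if "\<phi> \<in> Omega_TM A 1" for \<phi>
    using that E by (simp add: Omega_TM_iff)
  have drep: "frechet_derivative (field_rep A ?c (\<lambda>q. \<phi> q (\<lambda>_. E y q))) (at (snd ?c p))
      = frechet_derivative (form_rep A ?c \<phi> (\<lambda>_. y)) (at (snd ?c p))" for \<phi>
    by (rule frechet_derivative_cong_open[OF S pS rep])
  have "D ?X (\<lambda>q. \<psi> q (\<lambda>_. E y q)) p = D ?X (\<lambda>q. \<psi>' q (\<lambda>_. E y q)) p"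
    by (rule D_jet_eq[OF vf[OF \<psi>] vf[OF \<psi>'] vector_field_extend c])
      (use j in \<open>simp_all add: drep rep[OF pS] same_1jet_def Let_def\<close>)
  then show ?thesis using same_1jet_value[OF j] by (simp add: n \<psi> \<psi>' del: One_nat_def)
qed

lemma Gamma_H1_Omega_TM: "\<psi> \<in> Gamma_H1 A g \<Longrightarrow> \<psi> \<in> Omega_TM A 1"
  by (simp add: Gamma_H1_def)

lemma Omega_TM_add:
  assumes "\<psi> \<in> Omega_TM A k" "\<psi>' \<in> Omega_TM A k"
  shows "(\<lambda>p v. \<psi> p v + \<psi>' p v) \<in> Omega_TM A k"
  unfolding Omega_TM_iff alternating_form_def
proof (intro conjI allI impI)
  note alt = assms[unfolded Omega_TM_iff, THEN conjunct1, rule_format]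
  show "\<psi> p v + \<psi>' p v = \<psi> p w + \<psi>' p w" if "\<forall>i<k. v i = w i" for p v w
    using that alternating_form_cong[OF alt(1), of v w p] alternating_form_cong[OF alt(2), of v w p] by simp
  show "linear (\<lambda>x. \<psi> p (v(i := x)) + \<psi>' p (v(i := x)))" if "i < k" for p v i
    by (intro linear_compose_add alternating_form_linear[OF alt(1)] alternating_form_linear[OF alt(2)] that)
  show "\<psi> p v + \<psi>' p v = 0" if "i < j \<and> j < k \<and> v i = v j" for p v i j
    using that alternating_form_eq_0[OF alt(1), of i j v p] alternating_form_eq_0[OF alt(2), of i j v p] by simp
  show "vector_field A (\<lambda>q. \<psi> q (\<lambda>i. U i q) + \<psi>' q (\<lambda>i. U i q))" if "\<forall>i. vector_field A (U i)" for U
    using that assms by (auto simp: Omega_TM_iff intro!: vector_field_add)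
qed

lemma Omega_TM_cmult:
  assumes "\<psi> \<in> Omega_TM A k"
  shows "(\<lambda>p v. a *\<^sub>R \<psi> p v) \<in> Omega_TM A k"
  unfolding Omega_TM_iff alternating_form_def
proof (intro conjI allI impI)
  note alt = assms[unfolded Omega_TM_iff, THEN conjunct1, rule_format]
  show "a *\<^sub>R \<psi> p v = a *\<^sub>R \<psi> p w" if "\<forall>i<k. v i = w i" for p v w
    using that alternating_form_cong[OF alt, of v w p] by simp
  show "linear (\<lambda>x. a *\<^sub>R \<psi> p (v(i := x)))" if "i < k" for p v i
    by (intro linear_compose_scale_right alternating_form_linear[OF alt] that)
  show "a *\<^sub>R \<psi> p v = 0" if "i < j \<and> j < k \<and> v i = v j" for p v i j
    using that alternating_form_eq_0[OF alt, of i j v p] by simp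
  show "vector_field A (\<lambda>q. a *\<^sub>R \<psi> q (\<lambda>i. U i q))" if "\<forall>i. vector_field A (U i)" for U
    using that assms by (auto simp: Omega_TM_iff intro!: vector_field_cmult)
qed

lemma nabla_at_add:
  assumes \<psi>: "\<psi> \<in> Omega_TM A k" and \<psi>': "\<psi>' \<in> Omega_TM A k"
  shows "nabla_at k (\<lambda>p v. \<psi> p v + \<psi>' p v) p x v = nabla_at k \<psi> p x v + nabla_at k \<psi>' p x v"
  using \<psi> \<psi>' by (simp add: nabla_at_def nabla_def D_add_right vector_field_extend Omega_TM_iff sum.distrib)

lemma nabla_at_cmult:
  assumes \<psi>: "\<psi> \<in> Omega_TM A k"
  shows "nabla_at k (\<lambda>p v. a *\<^sub>R \<psi> p v) p x v = a *\<^sub>R nabla_at k \<psi> p x v"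
  using \<psi> by (simp add: nabla_at_def nabla_def D_cmult_right vector_field_extend Omega_TM_iff
      scaleR_diff_right scaleR_sum_right)

lemma L1_diff_op: "linear_first_order_diff_op A (Gamma_H1 A g) (Omega_AM A g 1) (L1 A g D)"
  unfolding linear_first_order_diff_op_def
proof (intro conjI ballI allI impI)
  fix s assume "s \<in> Gamma_H1 A g"
  then have s: "s \<in> Omega_TM A 1" by (rule Gamma_H1_Omega_TM)
  show "L1 A g D s \<in> Omega_AM A g 1"
    unfolding L1_eq[OF s] Omega_AM_def using s koszul_in_Omega_o[OF s] by blast
  show "L1 A g D (\<lambda>p v. a *\<^sub>R s p v) = (\<lambda>p v. a *\<^sub>R L1 A g D s p v)" for a
  proof -
    note as = Omega_TM_cmult[OF s, of a]
    have "koszul (\<lambda>p v. a *\<^sub>R s p v) p x = a *\<^sub>R koszul s p x" for p x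
      by (rule blinfun_eqI, rule g_cancel[of p])
        (simp add: g_koszul s as ext_deriv_1_def nabla_at_cmult[OF s] blinfun.scaleR_left
          g_scale_left g_diff_left algebra_simps del: One_nat_def)
    then show ?thesis unfolding L1_eq[OF s] L1_eq[OF as] by (simp add: AM_col_def)
  qed
  fix t assume "t \<in> Gamma_H1 A g"
  then have t: "t \<in> Omega_TM A 1" by (rule Gamma_H1_Omega_TM)
  show "L1 A g D (\<lambda>p v. s p v + t p v) = (\<lambda>p v. L1 A g D s p v + L1 A g D t p v)"
  proof -
    note st = Omega_TM_add[OF s t]
    have "koszul (\<lambda>p v. s p v + t p v) p x = koszul s p x + koszul t p x" for p x
      by (rule blinfun_eqI, rule g_cancel[of p])
        (simp add: g_koszul s t st ext_deriv_1_def nabla_at_add[OF s t] blinfun.add_left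
          g_add_left g_diff_left algebra_simps del: One_nat_def)
    then show ?thesis unfolding L1_eq[OF s] L1_eq[OF t] L1_eq[OF st] by (simp add: AM_col_def)
  qed
  fix p assume j: "same_1jet A p s t"
  have "koszul s p = koszul t p"
    by (rule koszul_cong[OF s t nabla_at_1_jet[OF s t j]])
  then show "L1 A g D s p = L1 A g D t p"
    unfolding L1_eq[OF s] L1_eq[OF t] using same_1jet_value[OF j] by (simp add: AM_col_def)
qed

section \<open>The tensorial operators in higher degrees\<close>

lemma Omega_TM_zero: "(\<lambda>_ _. 0) \<in> Omega_TM A k"
  by (simp add: Omega_TM_iff alternating_form_def linear_zero vector_field_zero)

lemma Lk_tensorial: "tensorial_op A (Gamma_H A g k) (Omega_AM A g k) Lk"
  unfolding tensorial_op_def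
proof (intro conjI ballI allI impI)
  fix s assume "s \<in> Gamma_H A g k"
  then show "Lk s \<in> Omega_AM A g k"
    unfolding Lk_def Omega_AM_def Gamma_H_def using Omega_TM_zero by blast
qed (simp_all add: Lk_def AM_col_def)

lemma d_deform_Lk:
  assumes "\<Psi> \<in> Gamma_H A g k"
  shows "d_deform A D k (Lk \<Psi>) \<in> Omega_o_in_AM A g (Suc k)"
proof -
  have \<Psi>: "\<Psi> \<in> Omega_o A g k" and Alt: "Alt k \<Psi> p v = 0" for p v
    using assms by (simp_all add: Gamma_H_def)
  \<comment> \<open>\<open>Alt\<close> counts signs from the last argument, the exterior derivative
    from the first; the two differ by the overall factor \<open>(-1) ^ k\<close>.\<close>
  have "(\<Sum>i\<le>k. (-1) ^ i *\<^sub>R blinfun_apply (\<Psi> p (omit i v)) (v i)) = (-1) ^ k *\<^sub>R Alt k \<Psi> p v" for p v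
    unfolding Alt_def scaleR_sum_right
  proof (rule sum.cong)
    fix i assume "i \<in> {..k}"
    then have "(-1::real) ^ k * (-1) ^ (k - i) = (-1) ^ i"
      by (simp add: minus_one_power_iff)
    then show "(-1) ^ i *\<^sub>R blinfun_apply (\<Psi> p (omit i v)) (v i)
        = (-1) ^ k *\<^sub>R (-1) ^ (k - i) *\<^sub>R blinfun_apply (\<Psi> p (omit i v)) (v i)"
      by (simp only: scaleR_scaleR)
  qed simp
  moreover have "cov_ext_deriv A D k (\<lambda>_ _. 0) p v = 0" for p v
    by (simp add: cov_ext_deriv_def Let_def D_zero_right vector_field_extend)
  ultimately have "fst (d_deform A D k (Lk \<Psi>) p v) = 0" for p v
    unfolding Lk_def fst_d_deform by (simp add: Alt)
  then show ?thesis
    unfolding Omega_o_in_AM_iff Lk_def using snd_d_deform_in_Omega_o[OF Omega_TM_zero \<Psi>] by simp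
qed

end

theorem theorem2p5:
  fixes A :: "('m::{t2_space, second_countable_topology}, 'e::euclidean_space) chart set"
    and g :: "'m \<Rightarrow> 'e \<Rightarrow> 'e \<Rightarrow> real"
    and D :: "('m, 'e) connection"
  assumes "smooth_atlas A" and "riemannian_metric A g" and "levi_civita A g D"
    and "DIM('e) \<ge> 2"
  shows
    "(\<forall>\<eta>\<in>Gamma_H0 A. \<exists>!\<Phi>. \<Phi> \<in> Omega_o A g 0 \<and>
        d_deform A D 0 (AM_col \<eta> \<Phi>) \<in> Gamma_H1_plus_o A g) \<and>
     linear_first_order_diff_op A (Gamma_H0 A) (Omega_AM A g 0) (L0 A g D) \<and>
     (\<forall>\<psi>\<in>Gamma_H1 A g. \<exists>!\<Psi>. \<Psi> \<in> Omega_o A g 1 \<and>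
        d_deform A D 1 (AM_col \<psi> \<Psi>) \<in> Omega_o_in_AM A g 2) \<and>
     linear_first_order_diff_op A (Gamma_H1 A g) (Omega_AM A g 1) (L1 A g D) \<and>
     (\<forall>k\<ge>2. tensorial_op A (Gamma_H A g k) (Omega_AM A g k) Lk \<and>
        (\<forall>\<Psi>\<in>Gamma_H A g k. d_deform A D k (Lk \<Psi>) \<in> Omega_o_in_AM A g (k + 1)))"
proof -
  interpret riemannian_manifold A g D
    by unfold_locales (fact assms)+
  have "\<exists>!\<Phi>. \<Phi> \<in> Omega_o A g 0 \<and> d_deform A D 0 (AM_col \<eta> \<Phi>) \<in> Gamma_H1_plus_o A g"
    if \<eta>0: "\<eta> \<in> Gamma_H0 A" for \<eta>
  proof -
    obtain X where X: "vector_field A X" and \<eta>: "\<eta> = (\<lambda>p _. X p)" using \<eta>0 by (auto simp: Gamma_H0_def)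
    show ?thesis unfolding \<eta> splitting_0_unique[OF X] by simp
  qed
  moreover have "\<exists>!\<Psi>. \<Psi> \<in> Omega_o A g 1 \<and> d_deform A D 1 (AM_col \<psi> \<Psi>) \<in> Omega_o_in_AM A g 2"
    if "\<psi> \<in> Gamma_H1 A g" for \<psi>
    unfolding splitting_1_unique[OF Gamma_H1_Omega_TM[OF that]] by simp
  ultimately show ?thesis
    using L0_diff_op L1_diff_op Lk_tensorial d_deform_Lk by simp
qed

end
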